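(* Let $$s(q,v)=\left(\sum_{1\le i<j\le N}\frac{(v_i-v_j)^T(v_i-v_j)}{(q_i-q_j)^T(q_i-q_j)}+\sum_{1\le i<j\le N}\frac{K_i(q)+K_j(q)}{\sqrt{(q_i-q_j)^T(q_i-q_j)}}\right)^{-1/2},\qquad K_i(q)=\sum_{\substack{k=1\\k\ne i}}^N\frac{G m_k}{(q_i-q_k)^T(q_i-q_k)}.$$ For arbitrary $q^0\in\mathbb{R}^{3N}\setminus\Delta$ and $v^0\in\mathbb{R}^{3N}$, the solution $(\hat q(\tau),\hat v(\tau))$ of $$\frac{d\hat q_i}{d\tau}=s(\hat q,\hat v)\,\hat v_i,\qquad \frac{d\hat v_i}{d\tau}=s(\hat q,\hat v)\sum_{j\ne i}\frac{G m_j}{\|\hat q_i-\hat q_j\|^3}(\hat q_j-\hat q_i),\qquad i=1,\dots,N,$$ with $\hat q(0)=q^0$, $\hat v(0)=v^0$, is uniquely defined as a holomorphic function of the complex variable $\tau$ in the strip $$\{\tau\in\mathbb{C}: |\mathrm{Im}(\tau)|\le 0.0444443\}.$$ In other words, $s(q,v)$ determines a uniform global time-renormalization of the $N$-body equations, with $\beta=0.0444443$.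
   Context: $N\ge2$ is an integer, $G>0$ is the gravitational constant, $m_1,\dots,m_N>0$ are masses; $q=(q_1,\dots,q_N)$, $v=(v_1,\dots,v_N)$ with $q_i,v_i\in\mathbb{R}^3$; $\|\cdot\|$ is the Euclidean norm, and $u^Tu=\sum_k u_k^2$ (without conjugation). $\Delta=\{q\in\mathbb{R}^{3N}: q_i=q_j\text{ for some }i\ne j\}$. For complex arguments, $\|\hat q_i-\hat q_j\|^3$ in the equations is understood as the analytic continuation $((\hat q_i-\hat q_j)^T(\hat q_i-\hat q_j))^{3/2}$, and $s$ as the analytic continuation of its real expression. The $N$-body equations are $\frac{dq_i}{dt}=v_i$, $\frac{dv_i}{dt}=\sum_{j\ne i}\frac{Gm_j}{\|q_i-q_j\|^3}(q_j-q_i)$, $i=1,\dots,N$. For $q^0\in\mathbb{R}^{3N}\setminus\Delta$, $v^0\in\mathbb{R}^{3N}$, let $(q(t),v(t))$, $t\in(t_a,t_b)$, be the maximal real solution with $q(0)=q^0$, $v(0)=v^0$. Given a real-analytic positive function $s$ on $(\mathbb{R}^{3N}\setminus\Delta)\times\mathbb{R}^{3N}$, put $\theta(t)=\int_0^t s(q(t'),v(t'))^{-1}dt'$; the solution in $\tau$ is $(\hat q(\tau),\hat v(\tau))$ with $(\hat q(\theta(t)),\hat v(\theta(t)))=(q(t),v(t))$. Definition: $s$ determines a uniform global time-renormalization of the $N$-body equations (with parameter $\beta>0$) if for arbitrary $q^0\in\mathbb{R}^{3N}\setminus\Delta$, $v^0\in\mathbb{R}^{3N}$, the solution $(\hat q(\tau),\hat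 v(\tau))$ in $\tau$ can be extended analytically to the strip $\{\tau\in\mathbb{C}:|\mathrm{Im}(\tau)|\le\beta\}$, where $\beta$ does not depend on $(q^0,v^0)$. *)

theory Defs
  imports "HOL-Analysis.Analysis"
begin

text \<open>The \<open>N\<close> bodies are indexed by a finite linearly ordered type \<open>'n\<close> with \<open>N = CARD('n)\<close>;
  the numeral types provide an instance for every \<open>N\<close>.
  The formulas that are used both for real and for complexified configurations are stated once,
  over an arbitrary real normed field \<open>'a\<close>.\<close>

text \<open>\<open>u\<^sup>T u\<close>, without conjugation in the complex case.\<close>

definition sqT :: "'a::real_normed_field ^ 3 \<Rightarrow> 'a" where
  "sqT u = (\<Sum>k\<in>UNIV. (u $ k)^2)"

definition collision_set :: "(real ^ 3 ^ 'n) set" where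
  "collision_set = {q. \<exists>i j. i \<noteq> j \<and> q $ i = q $ j}"

definition complexify :: "real ^ 3 ^ 'n \<Rightarrow> complex ^ 3 ^ 'n" where
  "complexify q = (\<chi> i k. complex_of_real (q $ i $ k))"

text \<open>The parameter \<open>r3 i j\<close> is the value to be used for \<open>\<parallel>q\<^sub>i - q\<^sub>j\<parallel>\<^sup>3\<close>: a genuine power of the
  norm for real arguments, a branch of \<open>(sqT (q\<^sub>i - q\<^sub>j))\<^bsup>3/2\<^esup>\<close> for complex ones.\<close>

definition nbody_acc ::
  "real \<Rightarrow> ('n::finite \<Rightarrow> real) \<Rightarrow> 'a::real_normed_field ^ 3 ^ 'n \<Rightarrow> ('n \<Rightarrow> 'n \<Rightarrow> 'a) \<Rightarrow> 'n \<Rightarrow> 'a ^ 3"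
where
  "nbody_acc G m q r3 i = (\<Sum>j\<in>UNIV - {i}. (of_real (G * m j) / r3 i j) *s (q $ j - q $ i))"

definition K_coeff ::
  "real \<Rightarrow> ('n::finite \<Rightarrow> real) \<Rightarrow> 'a::real_normed_field ^ 3 ^ 'n \<Rightarrow> 'n \<Rightarrow> 'a" where
  "K_coeff G m q i = (\<Sum>k\<in>UNIV - {i}. of_real (G * m k) / sqT (q $ i - q $ k))"

text \<open>The expression whose power with exponent \<open>-1/2\<close> is \<open>s(q,v)\<close>; here \<open>r1 i j\<close> is the value to be
  used for the square root of \<open>sqT (q\<^sub>i - q\<^sub>j)\<close>.\<close>

definition s_radicand ::
  "real \<Rightarrow> ('n::{finite,linorder} \<Rightarrow> real) \<Rightarrow> 'a::real_normed_field ^ 3 ^ 'n::{finite,linorder} \<Rightarrow> 'a ^ 3 ^ 'n::{finite,linorder}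
     \<Rightarrow> ('n \<Rightarrow> 'n \<Rightarrow> 'a) \<Rightarrow> 'a" where
  "s_radicand G m q v r1 =
     (\<Sum>(i,j)\<in>{(i,j). i < j}. sqT (v $ i - v $ j) / sqT (q $ i - q $ j)) +
     (\<Sum>(i,j)\<in>{(i,j). i < j}. (K_coeff G m q i + K_coeff G m q j) / r1 i j)"

definition s_fun ::
  "real \<Rightarrow> ('n::{finite,linorder} \<Rightarrow> real) \<Rightarrow> (real ^ 3 ^ 'n::{finite,linorder}) \<times> (real ^ 3 ^ 'n::{finite,linorder}) \<Rightarrow> real" where
  "s_fun G m = (\<lambda>(q, v).
     (s_radicand G m q v (\<lambda>i j. sqrt (sqT (q $ i - q $ j)))) powr (- 1/2))"

definition closed_strip :: "real \<Rightarrow> complex set" where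
  "closed_strip \<beta> = {\<tau>. \<bar>Im \<tau>\<bar> \<le> \<beta>}"

text \<open>\<open>g\<close> is the analytic continuation over \<open>S\<close> of \<open>f\<^sup>a\<close>, starting at \<open>0 \<in> S\<close> (\<open>S\<close> connected) from the
  positive real power of the positive real number \<open>f 0\<close>: \<open>L\<close> is the logarithm of \<open>f\<close> continued from
  its real value at \<open>0\<close>. No principal branch is used, so \<open>f\<close> may cross the negative real axis.
  In particular \<open>f\<close> has no zeros on \<open>S\<close>.\<close>

definition powr_continuation_on ::
  "complex set \<Rightarrow> (complex \<Rightarrow> complex) \<Rightarrow> real \<Rightarrow> (complex \<Rightarrow> complex) \<Rightarrow> bool" where
  "powr_continuation_on S f a g \<longleftrightarrow>
     (\<exists>L. L analytic_on S \<and> L 0 \<in> \<real> \<and>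
          (\<forall>\<tau>\<in>S. exp (L \<tau>) = f \<tau> \<and> g \<tau> = exp (of_real a * L \<tau>)))"

text \<open>Holomorphy on a set that is not open means holomorphy on a neighbourhood of it, which is what
  \<open>analytic_on\<close> expresses.\<close>

definition vec_analytic_on :: "(complex \<Rightarrow> complex ^ 3 ^ 'n) \<Rightarrow> complex set \<Rightarrow> bool" where
  "vec_analytic_on Q S \<longleftrightarrow> (\<forall>i k. (\<lambda>\<tau>. Q \<tau> $ i $ k) analytic_on S)"

definition renormalized_solution ::
  "real \<Rightarrow> ('n::{finite,linorder} \<Rightarrow> real) \<Rightarrow> complex set \<Rightarrow> real ^ 3 ^ 'n::{finite,linorder} \<Rightarrow> real ^ 3 ^ 'n::{finite,linorder}
     \<Rightarrow> (complex \<Rightarrow> complex ^ 3 ^ 'n::{finite,linorder}) \<Rightarrow> (complex \<Rightarrow> complex ^ 3 ^ 'n::{finite,linorder}) \<Rightarrow> bool" where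
  "renormalized_solution G m S q0 v0 Q V \<longleftrightarrow>
     vec_analytic_on Q S \<and> vec_analytic_on V S \<and>
     Q 0 = complexify q0 \<and> V 0 = complexify v0 \<and>
     (\<exists>r1 r3 \<sigma>.
        (\<forall>i j. i \<noteq> j \<longrightarrow>
           powr_continuation_on S (\<lambda>\<tau>. sqT (Q \<tau> $ i - Q \<tau> $ j)) (1/2) (r1 i j) \<and>
           powr_continuation_on S (\<lambda>\<tau>. sqT (Q \<tau> $ i - Q \<tau> $ j)) (3/2) (r3 i j)) \<and>
        powr_continuation_on S (\<lambda>\<tau>. s_radicand G m (Q \<tau>) (V \<tau>) (\<lambda>i j. r1 i j \<tau>)) (- 1/2) \<sigma> \<and>
        (\<forall>\<tau>\<in>S. \<forall>i k.
           ((\<lambda>z. Q z $ i $ k) has_field_derivative \<sigma> \<tau> * V \<tau> $ i $ k) (at \<tau>) \<and>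
           ((\<lambda>z. V z $ i $ k) has_field_derivative
               \<sigma> \<tau> * nbody_acc G m (Q \<tau>) (\<lambda>i j. r3 i j \<tau>) i $ k) (at \<tau>)))"

definition nbody_solution ::
  "real \<Rightarrow> ('n::finite \<Rightarrow> real) \<Rightarrow> real set \<Rightarrow> real ^ 3 ^ 'n \<Rightarrow> real ^ 3 ^ 'n
     \<Rightarrow> (real \<Rightarrow> real ^ 3 ^ 'n) \<Rightarrow> (real \<Rightarrow> real ^ 3 ^ 'n) \<Rightarrow> bool" where
  "nbody_solution G m T q0 v0 q v \<longleftrightarrow>
     open T \<and> is_interval T \<and> 0 \<in> T \<and> q 0 = q0 \<and> v 0 = v0 \<and>
     (\<forall>t\<in>T. q t \<notin> collision_set \<and>
        (\<forall>i. ((\<lambda>u. q u $ i) has_vector_derivative v t $ i) (at t) \<and>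
             ((\<lambda>u. v u $ i) has_vector_derivative
                nbody_acc G m (q t) (\<lambda>i j. norm (q t $ i - q t $ j) ^ 3) i) (at t)))"

definition maximal_nbody_solution ::
  "real \<Rightarrow> ('n::finite \<Rightarrow> real) \<Rightarrow> real set \<Rightarrow> real ^ 3 ^ 'n \<Rightarrow> real ^ 3 ^ 'n
     \<Rightarrow> (real \<Rightarrow> real ^ 3 ^ 'n) \<Rightarrow> (real \<Rightarrow> real ^ 3 ^ 'n) \<Rightarrow> bool" where
  "maximal_nbody_solution G m T q0 v0 q v \<longleftrightarrow>
     nbody_solution G m T q0 v0 q v \<and>
     (\<forall>T' q' v'. nbody_solution G m T' q0 v0 q' v' \<and> T \<subseteq> T' \<and> (\<forall>t\<in>T. q' t = q t \<and> v' t = v t)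
        \<longrightarrow> T' = T)"

text \<open>Local expansion into a power series in several variables; the multi-indices are functions on
  \<open>Basis\<close>. Meant for open \<open>U\<close>.\<close>

definition real_analytic_on :: "('a::euclidean_space \<Rightarrow> real) \<Rightarrow> 'a set \<Rightarrow> bool" where
  "real_analytic_on f U \<longleftrightarrow>
     (\<forall>x\<in>U. \<exists>r>0. \<exists>c::('a \<Rightarrow> nat) \<Rightarrow> real. \<forall>y\<in>ball x r.
        ((\<lambda>\<alpha>. c \<alpha> * (\<Prod>b\<in>Basis. ((y - x) \<bullet> b) ^ \<alpha> b)) has_sum f y) (PiE Basis (\<lambda>_. UNIV)))"

definition new_time ::
  "((real ^ 3 ^ 'n) \<times> (real ^ 3 ^ 'n) \<Rightarrow> real)
     \<Rightarrow> (real \<Rightarrow> real ^ 3 ^ 'n) \<Rightarrow> (real \<Rightarrow> real ^ 3 ^ 'n) \<Rightarrow> real \<Rightarrow> real" where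
  "new_time s q v t = (LBINT u=ereal 0..ereal t. 1 / s (q u, v u))"

text \<open>Positivity and real analyticity of \<open>s\<close> are the standing assumptions on \<open>s\<close>. By uniqueness for
  the initial value problem, ranging over every maximal solution is the same as speaking about
  the maximal solution. As \<open>s > 0\<close>, \<open>new_time\<close> is injective on its interval \<open>T\<close>, so the last two
  equations say exactly that \<open>Q\<close>, \<open>V\<close> extend the solution in the new time.\<close>

definition uniform_time_renormalization ::
  "real \<Rightarrow> ('n::finite \<Rightarrow> real) \<Rightarrow> ((real ^ 3 ^ 'n) \<times> (real ^ 3 ^ 'n) \<Rightarrow> real) \<Rightarrow> real \<Rightarrow> bool"
where
  "uniform_time_renormalization G m s \<beta> \<longleftrightarrow>
     0 < \<beta> \<and>
     real_analytic_on s ((- collision_set) \<times> UNIV) \<and>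
     (\<forall>z \<in> (- collision_set) \<times> UNIV. 0 < s z) \<and>
     (\<forall>q0 v0 T q v. q0 \<notin> collision_set \<and> maximal_nbody_solution G m T q0 v0 q v \<longrightarrow>
        (\<exists>Q V. vec_analytic_on Q (closed_strip \<beta>) \<and> vec_analytic_on V (closed_strip \<beta>) \<and>
           (\<forall>t\<in>T. Q (of_real (new_time s q v t)) = complexify (q t) \<and>
                  V (of_real (new_time s q v t)) = complexify (v t))))"

end

theory Submission
  imports Defs "HOL-Complex_Analysis.Complex_Analysis"
begin

text \<open>
The reason behind the theorem is a scale-free a priori estimate. Fix a real collision-free state
with distances \<open>r i j\<close>, relative speeds \<open>n i j\<close>, coefficients \<open>K i\<close>, and let \<open>R = 1/s\<close>, so that
\<open>R\<^sup>2\<close> is the sum over all pairs of \<open>(n i j / r i j)\<^sup>2 + (K i + K j) / r i j\<close>. Measured in the new time,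
each pair separates at a relative rate of at most 1, because \<open>n i j \<le> R * r i j\<close>; and since \<open>K i\<close>
bounds the acceleration of body \<open>i\<close>, the relative velocity of a pair changes at a rate of at most
\<open>(K i + K j) / R\<close>. Hence the complex states with
\<open>\<bar>q\<^sub>i - q\<^sub>j - (q\<^sub>i\<^sup>0 - q\<^sub>j\<^sup>0)\<bar> \<le> r i j / 16\<close> and \<open>\<bar>v\<^sub>i - v\<^sub>i\<^sup>0\<bar> \<le> K i / (12 * R)\<close> form a set \<open>D\<close>
on which all quantities stay comparable to their values at the centre: the squared distances
change by a factor within \<open>33/256\<close> of 1 (\<open>position_facts\<close>), the accelerations stay below \<open>4/3 * K i\<close>
(\<open>norm_cacc_le\<close>), and the radicand of \<open>s\<close> stays within \<open>9/25 * R\<^sup>2\<close> of \<open>R\<^sup>2\<close> (\<open>crad_perturbation\<close>), so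
that \<open>\<bar>s\<bar> \<le> 5 / (4 * R)\<close>. The estimate of the radicand is uniform in the number of bodies because
the increment of the velocity term of a pair is bounded, by the inequality
\<open>2ab \<le> a\<^sup>2 + b\<^sup>2\<close>, by the two contributions of that same pair to \<open>R\<^sup>2\<close>.

These bounds reproduce themselves: a curve whose velocity is the vector field at points of \<open>D\<close>
cannot leave \<open>D\<close> before \<open>\<bar>\<tau>\<bar>\<close> reaches \<open>1/20\<close>, as \<open>1/20 * 5/4 = 1/16\<close> and \<open>1/20 * 5/4 * 4/3 = 1/12\<close>
(\<open>D_invariant\<close>). Picard iteration therefore converges on the whole disc of radius \<open>1/20\<close>
(\<open>picard_holomorphic\<close>, \<open>local_solution\<close>). On \<open>D\<close> the squared distances and the radicand have
positive real part, so principal branches suffice.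

The radius does not depend on the state, and solutions are real on the real axis. So one can
restart at real points and glue: discs of radius \<open>1/20\<close> centred on the real axis contain the rectangles of half-height
\<open>9/200\<close> and half-width \<open>1/50\<close>, and these cover the strip \<open>\<bar>Im \<tau>\<bar> < 9/200\<close> (\<open>strip_solution\<close>). It
contains the closed strip of half-height \<open>0.0444443\<close>. Any other continuation has the same branches
and the same vector field near 0, hence agrees near 0 by a Lipschitz estimate and on
the strip by the identity theorem (\<open>renormalized_solution_unique\<close>). Likewise a solution in physical
time \<open>t\<close> and the strip solution composed with the new time solve one and the same equation
\<open>u' = F u / s\<close> on the time interval, so they coincide (\<open>solution_in_new_time\<close>).

Real analyticity of \<open>s\<close> is proved with absolutely convergent power series: they are closed under
sums and products, and the power \<open>-1/2\<close> of a positive one is obtained from the binomial series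
(\<open>analytic_germ_inverse_sqrt\<close>).
\<close>

section \<open>Picard iteration on a complex disc\<close>

text \<open>States are families of complex numbers. The Lipschitz condition is with respect to the supremum
distance, written without a norm so that Picard iteration only has to estimate scalar functions.\<close>

definition lipschitz_field ::
  "('i \<Rightarrow> complex) set \<Rightarrow> (('i \<Rightarrow> complex) \<Rightarrow> 'i \<Rightarrow> complex) \<Rightarrow> real \<Rightarrow> bool" where
  "lipschitz_field D F L \<longleftrightarrow>
     (\<forall>z\<in>D. \<forall>w\<in>D. \<forall>d i. (\<forall>j. cmod (z j - w j) \<le> d) \<longrightarrow> cmod (F z i - F w i) \<le> L * d)"

lemma lipschitz_fieldD:
  assumes "lipschitz_field D F L" "z \<in> D" "w \<in> D" "\<And>j. cmod (z j - w j) \<le> d"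
  shows "cmod (F z i - F w i) \<le> L * d"
  using assms unfolding lipschitz_field_def by blast

text \<open>One integration step: a bound \<open>t\<^sup>n / n!\<close> for the derivative gives \<open>t\<^sup>n\<^sup>+\<^sup>1 / (n+1)!\<close> for the
increment. Iterating it produces the terms of the exponential series, which drive both the
convergence of Picard iteration and the uniqueness of solutions.\<close>

lemma vector_growth_bound:
  fixes g :: "real \<Rightarrow> 'a::real_normed_vector"
  assumes g: "\<And>t. t \<in> {0..1} \<Longrightarrow> (g has_vector_derivative g' t) (at t within {0..1})"
    and le: "\<And>t. t \<in> {0..1} \<Longrightarrow> norm (g' t) \<le> C * t ^ n / fact n"
    and x: "x \<in> {0..1}"
  shows "norm (g x - g 0) \<le> C * x ^ Suc n / fact (Suc n)"
proof (cases "x = 0")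
  case True
  then show ?thesis by simp
next
  case False
  define \<phi> where "\<phi> = (\<lambda>t::real. C * t ^ Suc n / fact (Suc n))"
  have "norm (g x - g 0) \<le> \<phi> x - \<phi> 0"
  proof (rule differentiable_bound_general[where f' = g' and \<phi>' = "\<lambda>t. C * t ^ n / fact n"])
    show "0 < x" using False x by simp
    have "continuous_on {0..1} g"
      using g by (rule continuous_on_vector_derivative)
    then show "continuous_on {0..x} g"
      by (rule continuous_on_subset) (use x in auto)
    show "continuous_on {0..x} \<phi>" unfolding \<phi>_def by (intro continuous_intros) simp
    fix t assume t: "0 < t" "t < x"
    then have t1: "t \<in> {0<..<1}" using x by auto
    then show "(g has_vector_derivative g' t) (at t)"
      using g[of t] at_within_interior[of t "{0..1}"] by (auto simp: interior_atLeastAtMost_real)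
    show "(\<phi> has_vector_derivative C * t ^ n / fact n) (at t)"
    proof -
      have "((\<lambda>t. t ^ Suc n) has_real_derivative real (Suc n) * t ^ n) (at t)"
        using DERIV_pow[of "Suc n" t] by simp
      then have "(\<phi> has_real_derivative C / fact (Suc n) * (real (Suc n) * t ^ n)) (at t)"
        unfolding \<phi>_def times_divide_eq_left[symmetric] by (rule DERIV_cmult)
      moreover have "C / fact (Suc n) * (real (Suc n) * t ^ n) = C * t ^ n / fact n"
        unfolding fact_Suc of_nat_mult by (simp del: of_nat_Suc)
      ultimately show ?thesis by (simp add: has_real_derivative_iff_has_vector_derivative)
    qed
    show "norm (g' t) \<le> C * t ^ n / fact n" using le t1 by auto
  qed
  then show ?thesis by (simp add: \<phi>_def)
qed

lemma has_vector_derivative_along_ray: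
  fixes f :: "complex \<Rightarrow> complex"
  assumes "(f has_field_derivative d) (at (a + of_real t * \<tau>))"
  shows "((\<lambda>t. f (a + of_real t * \<tau>)) has_vector_derivative \<tau> * d) (at t within A)"
proof -
  have "((\<lambda>t. a + complex_of_real t * \<tau>) has_vector_derivative \<tau>) (at t within A)"
    by (auto intro!: derivative_eq_intros has_vector_derivative_real_field)
  from field_vector_diff_chain_within[OF this has_field_derivative_at_within[OF assms]]
  show ?thesis by (simp add: o_def)
qed

lemma ray_in_ball:
  fixes \<tau> :: complex
  assumes "\<tau> \<in> ball 0 \<rho>" "t \<in> {0..1}"
  shows "0 + of_real t * \<tau> \<in> ball 0 \<rho>"
proof -
  have "\<bar>t\<bar> * cmod \<tau> \<le> 1 * cmod \<tau>" using assms by (intro mult_right_mono) auto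
  then show ?thesis using assms by (auto simp: norm_mult)
qed

text \<open>The same step on a disc follows by integrating along the ray from 0.\<close>

lemma holomorphic_growth_bound:
  assumes f: "\<And>\<tau>. \<tau> \<in> ball 0 \<rho> \<Longrightarrow> (f has_field_derivative f' \<tau>) (at \<tau>)"
    and le: "\<And>\<tau>. \<tau> \<in> ball 0 \<rho> \<Longrightarrow> cmod (f' \<tau>) \<le> C * cmod \<tau> ^ n / fact n"
    and x: "\<tau> \<in> ball 0 \<rho>"
  shows "cmod (f \<tau> - f 0) \<le> C * cmod \<tau> ^ Suc n / fact (Suc n)"
proof -
  define g where "g = (\<lambda>t. f (0 + of_real t * \<tau>))"
  note ins = ray_in_ball[OF x]
  have "norm (g 1 - g 0) \<le> (C * cmod \<tau> ^ Suc n) * 1 ^ Suc n / fact (Suc n)"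
  proof (rule vector_growth_bound[where g' = "\<lambda>t. \<tau> * f' (0 + of_real t * \<tau>)"])
    fix t :: real assume t: "t \<in> {0..1}"
    show "(g has_vector_derivative \<tau> * f' (0 + of_real t * \<tau>)) (at t within {0..1})"
      unfolding g_def by (intro has_vector_derivative_along_ray f ins t)
    have "cmod (f' (0 + of_real t * \<tau>)) \<le> C * (t * cmod \<tau>) ^ n / fact n"
      using le[OF ins[OF t]] t by (simp add: norm_mult)
    then show "norm (\<tau> * f' (0 + of_real t * \<tau>)) \<le> C * cmod \<tau> ^ Suc n * t ^ n / fact n"
      using mult_left_mono[of "cmod (f' (0 + of_real t * \<tau>))" "C * (t * cmod \<tau>) ^ n / fact n" "cmod \<tau>"]
      by (simp add: norm_mult power_mult_distrib mult_ac)
  qed simp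
  then show ?thesis by (simp add: g_def)
qed

lemma exp_term_tendsto_0: "(\<lambda>n. M * a ^ n / fact n :: real) \<longlonglongrightarrow> 0"
proof -
  have "summable (\<lambda>n. inverse (fact n) * a ^ n)" by (rule summable_exp)
  then have "(\<lambda>n. M * (inverse (fact n) * a ^ n)) \<longlonglongrightarrow> M * 0"
    by (intro tendsto_mult tendsto_const summable_LIMSEQ_zero)
  then show ?thesis by (simp add: field_simps)
qed

text \<open>The scalar factor \<open>k\<close> makes the lemma serve twice: it is the direction of a ray for holomorphic
solutions, and the rate of change of a time substitution for real ones. The difference of two solutions is
at most \<open>M * (C * L * t) ^ n / n!\<close> for every \<open>n\<close>, and this tends to 0.\<close>

theorem lipschitz_ivp_unique:
  fixes x y :: "real \<Rightarrow> 'i::finite \<Rightarrow> complex"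
  assumes lip: "lipschitz_field D F L" and L: "0 \<le> L"
    and inD: "\<And>t. t \<in> {0..1} \<Longrightarrow> x t \<in> D" "\<And>t. t \<in> {0..1} \<Longrightarrow> y t \<in> D"
    and x: "\<And>t i. t \<in> {0..1} \<Longrightarrow> ((\<lambda>t. x t i) has_vector_derivative k t * F (x t) i) (at t within {0..1})"
    and y: "\<And>t i. t \<in> {0..1} \<Longrightarrow> ((\<lambda>t. y t i) has_vector_derivative k t * F (y t) i) (at t within {0..1})"
    and k: "\<And>t. t \<in> {0..1} \<Longrightarrow> cmod (k t) \<le> C"
    and init: "x 0 = y 0" and t: "t \<in> {0..1}"
  shows "x t = y t"
proof -
  have C: "0 \<le> C" using order_trans[OF norm_ge_zero k[of 0]] by simp
  have der: "((\<lambda>t. x t i - y t i) has_vector_derivative k t * (F (x t) i - F (y t) i)) (at t within {0..1})"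
    if "t \<in> {0..1}" for t i
    using has_vector_derivative_diff[OF x[OF that] y[OF that]] by (simp add: algebra_simps)
  have "\<exists>M. \<forall>t\<in>{0..1}. cmod (x t i - y t i) \<le> M" for i
  proof -
    have "continuous_on {0..1} (\<lambda>t. x t i - y t i)"
      using der by (rule continuous_on_vector_derivative)
    then have "bounded ((\<lambda>t. x t i - y t i) ` {0..1})"
      by (intro compact_imp_bounded compact_continuous_image) auto
    then show ?thesis by (auto simp: bounded_iff)
  qed
  then obtain M' where M': "\<And>i t. t \<in> {0..1} \<Longrightarrow> cmod (x t i - y t i) \<le> M' i" by metis
  define M where "M = Max (range M')"
  have M: "cmod (x t i - y t i) \<le> M" if "t \<in> {0..1}" for t i
    unfolding M_def by (rule order_trans[OF M'[OF that] Max_ge]) auto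
  have bound: "\<forall>t\<in>{0..1}. \<forall>i. cmod (x t i - y t i) \<le> M * (C * L) ^ n * t ^ n / fact n" for n
  proof (induction n)
    case 0
    then show ?case using M by simp
  next
    case (Suc n)
    show ?case
    proof (intro ballI allI)
      fix t :: real and i assume t: "t \<in> {0..1}"
      have "norm ((x t i - y t i) - (x 0 i - y 0 i)) \<le> (M * (C * L) ^ Suc n) * t ^ Suc n / fact (Suc n)"
      proof (rule vector_growth_bound[OF der _ t])
        fix u :: real assume u: "u \<in> {0..1}"
        have "cmod (F (x u) i - F (y u) i) \<le> L * (M * (C * L) ^ n * u ^ n / fact n)"
          using Suc u by (intro lipschitz_fieldD[OF lip] inD) auto
        then have "cmod (k u) * cmod (F (x u) i - F (y u) i) \<le> C * (L * (M * (C * L) ^ n * u ^ n / fact n))"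
          using k[OF u] C by (intro mult_mono) auto
        then show "norm (k u * (F (x u) i - F (y u) i)) \<le> M * (C * L) ^ Suc n * u ^ n / fact n"
          by (simp add: norm_mult mult_ac)
      qed
      then show "cmod (x t i - y t i) \<le> M * (C * L) ^ Suc n * t ^ Suc n / fact (Suc n)"
        using init by simp
    qed
  qed
  show ?thesis
  proof
    fix i
    have "(\<lambda>n. M * (C * L * t) ^ n / fact n) \<longlonglongrightarrow> 0" by (rule exp_term_tendsto_0)
    moreover have "cmod (x t i - y t i) \<le> M * (C * L * t) ^ n / fact n" for n
      unfolding power_mult_distrib[of "C * L" t] mult.assoc[of M, symmetric] using bound[of n] t by blast
    ultimately have "cmod (x t i - y t i) \<le> 0"
      by (intro LIMSEQ_le_const) auto
    then show "x t i = y t i" by simp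
  qed
qed

text \<open>Picard iteration converges on the whole disc because consecutive iterates differ by a term of the
exponential series. That the iterates exist on all of the disc is the assumption \<open>inv\<close>: a primitive of the
field along a curve in \<open>D\<close> stays in \<open>D\<close>. Primitives exist since the disc is convex, and
they are real on the real axis because there the imaginary part has derivative 0.\<close>

theorem picard_holomorphic:
  fixes F :: "('i::finite \<Rightarrow> complex) \<Rightarrow> 'i \<Rightarrow> complex"
  assumes \<rho>: "0 < \<rho>" and z0: "z0 \<in> D" "\<And>i. z0 i \<in> \<real>"
    and lip: "lipschitz_field D F L" and L: "0 \<le> L"
    and bdd: "\<And>z i. z \<in> D \<Longrightarrow> cmod (F z i) \<le> M"
    and closed: "\<And>f l. (\<And>n::nat. f n \<in> D) \<Longrightarrow> (\<And>i. (\<lambda>n. f n i) \<longlonglongrightarrow> l i) \<Longrightarrow> l \<in> D"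
    and hol: "\<And>\<gamma> i. (\<And>\<tau>. \<tau> \<in> ball 0 \<rho> \<Longrightarrow> \<gamma> \<tau> \<in> D) \<Longrightarrow>
          (\<And>i. (\<lambda>\<tau>. \<gamma> \<tau> i) holomorphic_on ball 0 \<rho>) \<Longrightarrow> (\<lambda>\<tau>. F (\<gamma> \<tau>) i) holomorphic_on ball 0 \<rho>"
    and real: "\<And>z i. z \<in> D \<Longrightarrow> (\<And>i. z i \<in> \<real>) \<Longrightarrow> F z i \<in> \<real>"
    and inv: "\<And>\<gamma> \<Gamma> \<tau>. (\<And>\<tau>. \<tau> \<in> ball 0 \<rho> \<Longrightarrow> \<gamma> \<tau> \<in> D) \<Longrightarrow> \<Gamma> 0 = z0 \<Longrightarrow>
          (\<And>\<tau> i. \<tau> \<in> ball 0 \<rho> \<Longrightarrow> ((\<lambda>\<tau>. \<Gamma> \<tau> i) has_field_derivative F (\<gamma> \<tau>) i) (at \<tau>)) \<Longrightarrow>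
          \<tau> \<in> ball 0 \<rho> \<Longrightarrow> \<Gamma> \<tau> \<in> D"
  obtains W where "W 0 = z0" "\<And>\<tau>. \<tau> \<in> ball 0 \<rho> \<Longrightarrow> W \<tau> \<in> D"
    "\<And>\<tau> i. \<tau> \<in> ball 0 \<rho> \<Longrightarrow> ((\<lambda>\<tau>. W \<tau> i) has_field_derivative F (W \<tau>) i) (at \<tau>)"
    "\<And>t i. complex_of_real t \<in> ball 0 \<rho> \<Longrightarrow> W (of_real t) i \<in> \<real>"
proof -
  define B where "B = ball (0::complex) \<rho>"
  have B: "open B" "convex B" "0 \<in> B" using \<rho> by (auto simp: B_def)
  define P where "P = (\<lambda>\<gamma>. (\<forall>\<tau>\<in>B. \<gamma> \<tau> \<in> D) \<and> (\<forall>i. (\<lambda>\<tau>. \<gamma> \<tau> i) holomorphic_on B) \<and>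
      (\<forall>t i. of_real t \<in> B \<longrightarrow> \<gamma> (of_real t) i \<in> \<real>) \<and> \<gamma> 0 = z0)"
  define R where "R = (\<lambda>\<gamma> \<Gamma>. \<forall>\<tau>\<in>B. \<forall>i. ((\<lambda>\<tau>. \<Gamma> \<tau> i) has_field_derivative F (\<gamma> \<tau>) i) (at \<tau>))"
  have step: "\<exists>\<Gamma>. P \<Gamma> \<and> R \<gamma> \<Gamma>" if P: "P \<gamma>" for \<gamma>
  proof -
    have "\<exists>g. \<forall>\<tau>\<in>B. (g has_field_derivative F (\<gamma> \<tau>) i) (at \<tau>)" for i
    proof -
      have "(\<lambda>\<tau>. F (\<gamma> \<tau>) i) holomorphic_on B"
        unfolding B_def
      proof (rule hol)
        show "\<gamma> \<tau> \<in> D" if "\<tau> \<in> ball 0 \<rho>" for \<tau> using P that by (simp add: P_def B_def)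
        show "(\<lambda>\<tau>. \<gamma> \<tau> i) holomorphic_on ball 0 \<rho>" for i using P by (simp add: P_def B_def)
      qed
      then obtain g where "\<And>\<tau>. \<tau> \<in> B \<Longrightarrow> (g has_field_derivative F (\<gamma> \<tau>) i) (at \<tau> within B)"
        using holomorphic_convex_primitive'[of B] B by metis
      then show ?thesis using B(1) by (metis at_within_open)
    qed
    then obtain g where g: "\<And>i \<tau>. \<tau> \<in> B \<Longrightarrow> (g i has_field_derivative F (\<gamma> \<tau>) i) (at \<tau>)" by metis
    define \<Gamma> where "\<Gamma> = (\<lambda>\<tau> i. z0 i + (g i \<tau> - g i 0))"
    have \<Gamma>: "((\<lambda>\<tau>. \<Gamma> \<tau> i) has_field_derivative F (\<gamma> \<tau>) i) (at \<tau>)" if "\<tau> \<in> B" for \<tau> i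
      unfolding \<Gamma>_def using g[OF that] by (auto intro!: derivative_eq_intros)
    have \<Gamma>0: "\<Gamma> 0 = z0" by (simp add: \<Gamma>_def)
    have "\<Gamma> (of_real t) i \<in> \<real>" if t: "of_real t \<in> B" for t i
    proof -
      have seg: "0 + of_real u * of_real t \<in> B" if "u \<in> {0..1}" for u
        using ray_in_ball[of "of_real t" \<rho> u] that t by (simp add: B_def)
      \<comment> \<open>the imaginary part is constant along the real axis\<close>
      have "norm (Im (\<Gamma> (0 + of_real 1 * of_real t) i) - Im (\<Gamma> (0 + of_real 0 * of_real t) i)) \<le> 0 * 1 ^ Suc 0 / fact (Suc 0)"
      proof (rule vector_growth_bound[where g = "\<lambda>u. Im (\<Gamma> (0 + of_real u * of_real t) i)" and g' = "\<lambda>u. Im (of_real t * F (\<gamma> (0 + of_real u * of_real t)) i)"])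
        fix u :: real assume u: "u \<in> {0..1}"
        show "((\<lambda>u. Im (\<Gamma> (0 + of_real u * of_real t) i)) has_vector_derivative
           Im (of_real t * F (\<gamma> (0 + of_real u * of_real t)) i)) (at u within {0..1})"
          by (rule bounded_linear.has_vector_derivative[OF bounded_linear_Im])
             (intro has_vector_derivative_along_ray \<Gamma> seg u)
        have "0 + of_real u * of_real t \<in> B" by (rule seg[OF u])
        then have "F (\<gamma> (0 + of_real u * of_real t)) i \<in> \<real>"
          using P unfolding P_def by (intro real) (auto simp flip: of_real_mult)
        then show "norm (Im (of_real t * F (\<gamma> (0 + of_real u * of_real t)) i)) \<le> 0 * u ^ 0 / fact 0"
          by (auto elim!: Reals_cases simp flip: of_real_mult)
      qed simp
      then have "Im (\<Gamma> (of_real t) i) = Im (z0 i)" using \<Gamma>0 by simp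
      then show ?thesis using z0(2)[of i] by (simp add: complex_is_Real_iff)
    qed
    moreover have "\<Gamma> \<tau> \<in> D" if "\<tau> \<in> B" for \<tau>
    proof (rule inv[of \<gamma> \<Gamma>])
      show "\<gamma> \<tau> \<in> D" if "\<tau> \<in> ball 0 \<rho>" for \<tau> using P that by (simp add: P_def B_def)
      show "((\<lambda>\<tau>. \<Gamma> \<tau> i) has_field_derivative F (\<gamma> \<tau>) i) (at \<tau>)" if "\<tau> \<in> ball 0 \<rho>" for \<tau> i
        using \<Gamma> that by (simp add: B_def)
      show "\<Gamma> 0 = z0" by fact
      show "\<tau> \<in> ball 0 \<rho>" using that by (simp add: B_def)
    qed
    moreover have "(\<lambda>\<tau>. \<Gamma> \<tau> i) holomorphic_on B" for i
      using \<Gamma> B(1) by (auto simp: holomorphic_on_open)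
    ultimately have "P \<Gamma>" using \<Gamma>0 by (simp add: P_def)
    moreover have "R \<gamma> \<Gamma>" using \<Gamma> by (simp add: R_def)
    ultimately show ?thesis by blast
  qed
  have "\<exists>f. \<forall>n. (P (f n) \<and> (n = 0 \<longrightarrow> f n = (\<lambda>_. z0))) \<and> R (f n) (f (Suc n))"
  proof (rule dependent_nat_choice)
    show "\<exists>x. P x \<and> ((0::nat) = 0 \<longrightarrow> x = (\<lambda>_. z0))"
      by (rule exI[of _ "\<lambda>_. z0"]) (use z0 in \<open>auto simp: P_def\<close>)
    fix \<gamma> and n :: nat assume "P \<gamma> \<and> (n = 0 \<longrightarrow> \<gamma> = (\<lambda>_. z0))"
    then show "\<exists>\<Gamma>. (P \<Gamma> \<and> (Suc n = 0 \<longrightarrow> \<Gamma> = (\<lambda>_. z0))) \<and> R \<gamma> \<Gamma>" using step[of \<gamma>] by auto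
  qed
  then obtain f where f: "\<And>n. P (f n)" "\<And>n. R (f n) (f (Suc n))" and start: "f 0 = (\<lambda>_. z0)" by blast
  have fD: "f n \<tau> \<in> D" if "\<tau> \<in> B" for n \<tau> using f(1) that by (auto simp: P_def)
  have f0: "f n 0 = z0" for n using f(1) by (auto simp: P_def)
  have fd: "((\<lambda>\<tau>. f (Suc n) \<tau> i) has_field_derivative F (f n \<tau>) i) (at \<tau>)" if "\<tau> \<in> B" for n \<tau> i
    using f(2) that by (auto simp: R_def)
  have M: "0 \<le> M" using order_trans[OF norm_ge_zero bdd[OF z0(1)]] .
  have incr: "\<forall>\<tau>\<in>B. \<forall>i. cmod (f (Suc n) \<tau> i - f n \<tau> i) \<le> M * L ^ n * cmod \<tau> ^ Suc n / fact (Suc n)" for n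
  proof (induction n)
    case 0
    show ?case
    proof (intro ballI allI)
      fix \<tau> i assume \<tau>: "\<tau> \<in> B"
      have "cmod (f (Suc 0) \<tau> i - f (Suc 0) 0 i) \<le> M * cmod \<tau> ^ Suc 0 / fact (Suc 0)"
        by (rule holomorphic_growth_bound[where f' = "\<lambda>\<tau>. F (f 0 \<tau>) i" and \<rho> = \<rho>])
           (use fd[of _ 0 i] fD[of _ 0] bdd \<tau> in \<open>simp_all add: B_def\<close>)
      then show "cmod (f (Suc 0) \<tau> i - f 0 \<tau> i) \<le> M * L ^ 0 * cmod \<tau> ^ Suc 0 / fact (Suc 0)"
        by (simp add: f0 start)
    qed
  next
    case (Suc n)
    show ?case
    proof (intro ballI allI)
      fix \<tau> i assume \<tau>: "\<tau> \<in> B"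
      have "cmod ((f (Suc (Suc n)) \<tau> i - f (Suc n) \<tau> i) - (f (Suc (Suc n)) 0 i - f (Suc n) 0 i))
          \<le> (M * L ^ Suc n) * cmod \<tau> ^ Suc (Suc n) / fact (Suc (Suc n))"
      proof (rule holomorphic_growth_bound[where f' = "\<lambda>\<tau>. F (f (Suc n) \<tau>) i - F (f n \<tau>) i"])
        fix \<tau> :: complex assume "\<tau> \<in> ball 0 \<rho>"
        then have \<tau>: "\<tau> \<in> B" by (simp add: B_def)
        show "((\<lambda>\<tau>. f (Suc (Suc n)) \<tau> i - f (Suc n) \<tau> i) has_field_derivative F (f (Suc n) \<tau>) i - F (f n \<tau>) i) (at \<tau>)"
          by (rule DERIV_diff[OF fd[OF \<tau>] fd[OF \<tau>]])
        have "cmod (f (Suc n) \<tau> j - f n \<tau> j) \<le> M * L ^ n * cmod \<tau> ^ Suc n / fact (Suc n)" for j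
          using Suc \<tau> by blast
        then have "cmod (F (f (Suc n) \<tau>) i - F (f n \<tau>) i) \<le> L * (M * L ^ n * cmod \<tau> ^ Suc n / fact (Suc n))"
          by (rule lipschitz_fieldD[OF lip fD[OF \<tau>] fD[OF \<tau>]])
        then show "cmod (F (f (Suc n) \<tau>) i - F (f n \<tau>) i) \<le> M * L ^ Suc n * cmod \<tau> ^ Suc n / fact (Suc n)"
          by (simp add: mult_ac)
      qed (use \<tau> in \<open>simp add: B_def\<close>)
      then show "cmod (f (Suc (Suc n)) \<tau> i - f (Suc n) \<tau> i) \<le> M * L ^ Suc n * cmod \<tau> ^ Suc (Suc n) / fact (Suc (Suc n))"
        by (simp add: f0)
    qed
  qed
  define b where "b = (\<lambda>n. M * \<rho> * ((L * \<rho>) ^ n / fact n))"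
  have b: "cmod (f (Suc n) \<tau> i - f n \<tau> i) \<le> b n" if "\<tau> \<in> B" for n \<tau> i
  proof -
    have "cmod (f (Suc n) \<tau> i - f n \<tau> i) \<le> M * L ^ n * cmod \<tau> ^ Suc n / fact (Suc n)" using incr that by blast
    also have "\<dots> \<le> M * L ^ n * \<rho> ^ Suc n / fact n"
      using that M L \<rho> by (intro frac_le mult_left_mono power_mono fact_mono) (auto simp: B_def)
    finally show ?thesis by (simp add: b_def power_mult_distrib mult_ac)
  qed
  have "summable b" unfolding b_def
    by (intro summable_mult) (use summable_exp[of "L * \<rho>"] in \<open>simp add: field_simps\<close>)
  then have ul0: "uniform_limit B (\<lambda>n \<tau>. \<Sum>k<n. f (Suc k) \<tau> i - f k \<tau> i) (\<lambda>\<tau>. \<Sum>k. f (Suc k) \<tau> i - f k \<tau> i) sequentially" for i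
    using b by (intro Weierstrass_m_test) auto
  define W where "W = (\<lambda>\<tau> i. z0 i + (\<Sum>k. f (Suc k) \<tau> i - f k \<tau> i))"
  have telescope: "f n \<tau> i = z0 i + (\<Sum>k<n. f (Suc k) \<tau> i - f k \<tau> i)" for n \<tau> i
    using sum_lessThan_telescope[of "\<lambda>k. f k \<tau> i" n] start by simp
  have ul: "uniform_limit B (\<lambda>n \<tau>. f n \<tau> i) (\<lambda>\<tau>. W \<tau> i) sequentially" for i
  proof -
    have "uniform_limit B (\<lambda>n \<tau>. z0 i + (\<Sum>k<n. f (Suc k) \<tau> i - f k \<tau> i)) (\<lambda>\<tau>. W \<tau> i) sequentially"
      unfolding W_def by (intro uniform_limit_add uniform_limit_const ul0)
    then show ?thesis by (simp only: telescope[symmetric])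
  qed
  have lim: "(\<lambda>n. f n \<tau> i) \<longlonglongrightarrow> W \<tau> i" if "\<tau> \<in> B" for \<tau> i
    using tendsto_uniform_limitI[OF ul that] .
  have W0: "W 0 = z0" by (simp add: W_def f0)
  have WD: "W \<tau> \<in> D" if "\<tau> \<in> B" for \<tau>
    by (rule closed[of "\<lambda>n. f n \<tau>" "W \<tau>", OF fD[OF that] lim[OF that]])
  have Whol: "(\<lambda>\<tau>. W \<tau> i) holomorphic_on B" for i
  proof (rule holomorphic_uniform_sequence[OF B(1)])
    show "(\<lambda>\<tau>. f n \<tau> i) holomorphic_on B" for n using f(1) by (auto simp: P_def)
    fix x assume "x \<in> B"
    then obtain d where "0 < d" "cball x d \<subseteq> B" using B(1) open_contains_cball by blast
    then show "\<exists>d>0. cball x d \<subseteq> B \<and> uniform_limit (cball x d) (\<lambda>n \<tau>. f n \<tau> i) (\<lambda>\<tau>. W \<tau> i) sequentially"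
      by (intro exI[of _ d] conjI uniform_limit_on_subset[OF ul])
  qed
  have Wreal: "W (of_real t) i \<in> \<real>" if "of_real t \<in> B" for t i
  proof (rule Lim_in_closed_set[OF closed_complex_Reals _ _ lim[OF that]])
    have "f n (of_real t) i \<in> \<real>" for n using f(1)[of n] that by (simp add: P_def)
    then show "\<forall>\<^sub>F n in sequentially. f n (of_real t) i \<in> \<real>" by simp
  qed simp
  have "P W" unfolding P_def using WD Whol Wreal W0 by simp
  then obtain \<Gamma> where \<Gamma>: "P \<Gamma>" "R W \<Gamma>" using step by blast
  have "\<Gamma> \<tau> i = W \<tau> i" if \<tau>: "\<tau> \<in> B" for \<tau> i
  proof -
    \<comment> \<open>the limit \<open>W\<close> is a solution: the iterates converge also to its own Picard image \<open>\<Gamma>\<close>\<close>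
    have "(\<lambda>n. f (Suc n) \<tau> i) \<longlonglongrightarrow> \<Gamma> \<tau> i"
    proof (rule tendstoI)
      fix e :: real assume e: "0 < e"
      define c where "c = L * \<rho> + 1"
      have c: "0 < c" using L \<rho> by (simp add: c_def add_nonneg_pos)
      define \<delta> where "\<delta> = e / (2 * c)"
      have \<delta>: "0 < \<delta>" using e c by (simp add: \<delta>_def)
      have "\<forall>\<^sub>F n in sequentially. \<forall>j. \<forall>\<tau>\<in>B. dist (f n \<tau> j) (W \<tau> j) < \<delta>"
        by (intro eventually_all_finite uniform_limitD[OF ul \<delta>])
      then show "\<forall>\<^sub>F n in sequentially. dist (f (Suc n) \<tau> i) (\<Gamma> \<tau> i) < e"
      proof eventually_elim
        case (elim n)
        have "cmod ((f (Suc n) \<tau> i - \<Gamma> \<tau> i) - (f (Suc n) 0 i - \<Gamma> 0 i)) \<le> (L * \<delta>) * cmod \<tau> ^ Suc 0 / fact (Suc 0)"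
        proof (rule holomorphic_growth_bound[where f' = "\<lambda>\<tau>. F (f n \<tau>) i - F (W \<tau>) i"])
          fix \<tau> :: complex assume "\<tau> \<in> ball 0 \<rho>"
          then have \<tau>: "\<tau> \<in> B" by (simp add: B_def)
          show "((\<lambda>\<tau>. f (Suc n) \<tau> i - \<Gamma> \<tau> i) has_field_derivative F (f n \<tau>) i - F (W \<tau>) i) (at \<tau>)"
            using \<Gamma>(2) \<tau> by (intro DERIV_diff fd) (auto simp: R_def)
          have "cmod (f n \<tau> j - W \<tau> j) \<le> \<delta>" for j using elim \<tau> by (simp add: dist_norm less_imp_le)
          then have "cmod (F (f n \<tau>) i - F (W \<tau>) i) \<le> L * \<delta>"
            by (rule lipschitz_fieldD[OF lip fD[OF \<tau>] WD[OF \<tau>]])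
          then show "cmod (F (f n \<tau>) i - F (W \<tau>) i) \<le> L * \<delta> * cmod \<tau> ^ 0 / fact 0" by simp
        qed (use \<tau> in \<open>simp add: B_def\<close>)
        then have "cmod (f (Suc n) \<tau> i - \<Gamma> \<tau> i) \<le> L * \<delta> * cmod \<tau>"
          using \<Gamma>(1) f0 by (simp add: P_def)
        also have "\<dots> \<le> L * \<delta> * \<rho>" using \<tau> L \<delta> by (intro mult_left_mono) (auto simp: B_def)
        also have "\<dots> \<le> c * \<delta>" using \<delta> by (simp add: c_def algebra_simps)
        also have "\<dots> < e" using e c by (simp add: \<delta>_def)
        finally show ?case by (simp add: dist_norm)
      qed
    qed
    moreover have "(\<lambda>n. f (Suc n) \<tau> i) \<longlonglongrightarrow> W \<tau> i" using lim[OF \<tau>] by (rule LIMSEQ_Suc)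
    ultimately show ?thesis by (rule LIMSEQ_unique)
  qed
  note \<Gamma>W = this
  have Wd: "((\<lambda>\<tau>. W \<tau> i) has_field_derivative F (W \<tau>) i) (at \<tau>)" if \<tau>: "\<tau> \<in> B" for \<tau> i
  proof (rule has_field_derivative_transform_within_open[OF _ B(1) \<tau>])
    show "((\<lambda>\<tau>. \<Gamma> \<tau> i) has_field_derivative F (W \<tau>) i) (at \<tau>)" using \<Gamma>(2) \<tau> by (auto simp: R_def)
  qed (use \<Gamma>W in auto)
  show ?thesis
  proof (rule that[of W, OF W0])
    show "W \<tau> \<in> D" if "\<tau> \<in> ball 0 \<rho>" for \<tau> using WD that by (simp add: B_def)
    show "((\<lambda>\<tau>. W \<tau> i) has_field_derivative F (W \<tau>) i) (at \<tau>)" if "\<tau> \<in> ball 0 \<rho>" for \<tau> i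
      using Wd that by (simp add: B_def)
    show "W (of_real t) i \<in> \<real>" if "complex_of_real t \<in> ball 0 \<rho>" for t i using Wreal[of t i] that unfolding B_def by blast
  qed
qed

section \<open>Regular functions and complexified vectors\<close>

text \<open>Everything that Picard iteration asks of a component of the vector field. All four parts survive
sums, products, quotients with denominators bounded away from 0, and square roots bounded away from
the cut, so they are established together by following the shape of the formulas.\<close>

definition regular_on :: "('i \<Rightarrow> complex) set \<Rightarrow> (('i \<Rightarrow> complex) \<Rightarrow> complex) \<Rightarrow> bool" where
  "regular_on D f \<longleftrightarrow>
     (\<exists>B\<ge>0. \<forall>z\<in>D. cmod (f z) \<le> B) \<and>
     (\<exists>L\<ge>0. lipschitz_field D (\<lambda>z _. f z) L) \<and>
     (\<forall>z\<in>D. (\<forall>j. z j \<in> \<real>) \<longrightarrow> f z \<in> \<real>) \<and>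
     (\<forall>S \<gamma>. (\<forall>\<tau>\<in>S. \<gamma> \<tau> \<in> D) \<longrightarrow> (\<forall>j. (\<lambda>\<tau>. \<gamma> \<tau> j) holomorphic_on S) \<longrightarrow>
        (\<lambda>\<tau>. f (\<gamma> \<tau>)) holomorphic_on S)"

lemma regular_onI:
  assumes "0 \<le> B" "\<And>z. z \<in> D \<Longrightarrow> cmod (f z) \<le> B" "0 \<le> L"
    and "\<And>z w d. z \<in> D \<Longrightarrow> w \<in> D \<Longrightarrow> 0 \<le> d \<Longrightarrow> (\<And>j. cmod (z j - w j) \<le> d) \<Longrightarrow> cmod (f z - f w) \<le> L * d"
    and "\<And>z. z \<in> D \<Longrightarrow> (\<And>j. z j \<in> \<real>) \<Longrightarrow> f z \<in> \<real>"
    and "\<And>S \<gamma>. (\<And>\<tau>. \<tau> \<in> S \<Longrightarrow> \<gamma> \<tau> \<in> D) \<Longrightarrow> (\<And>j. (\<lambda>\<tau>. \<gamma> \<tau> j) holomorphic_on S) \<Longrightarrow>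
        (\<lambda>\<tau>. f (\<gamma> \<tau>)) holomorphic_on S"
  shows "regular_on D f"
proof -
  have "lipschitz_field D (\<lambda>z _. f z) L"
    unfolding lipschitz_field_def
  proof (intro ballI allI impI)
    fix z w d assume *: "z \<in> D" "w \<in> D" "\<forall>j. cmod (z j - w j) \<le> d"
    then have "0 \<le> d" using order_trans[OF norm_ge_zero] by blast
    then show "cmod (f z - f w) \<le> L * d" using * by (intro assms(4)) auto
  qed
  then show ?thesis
    unfolding regular_on_def
    by (intro conjI exI[of _ B] exI[of _ L] allI ballI impI assms(1-3)) (simp_all add: assms(5,6))
qed

lemma regular_on_bounded:
  assumes "regular_on D f"
  shows "\<exists>B\<ge>0. \<forall>z\<in>D. cmod (f z) \<le> B"
  using assms unfolding regular_on_def by blast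

lemma regular_on_lipschitz:
  assumes "regular_on D f"
  shows "\<exists>L\<ge>0. lipschitz_field D (\<lambda>z _. f z) L"
  using assms unfolding regular_on_def by blast

lemma regular_on_real:
  assumes "regular_on D f" "z \<in> D" "\<And>j. z j \<in> \<real>"
  shows "f z \<in> \<real>"
  using assms unfolding regular_on_def by blast

lemma regular_on_holomorphic:
  assumes "regular_on D f" "\<And>\<tau>. \<tau> \<in> S \<Longrightarrow> \<gamma> \<tau> \<in> D" "\<And>j. (\<lambda>\<tau>. \<gamma> \<tau> j) holomorphic_on S"
  shows "(\<lambda>\<tau>. f (\<gamma> \<tau>)) holomorphic_on S"
  using assms unfolding regular_on_def by simp

lemma regular_on_const: "regular_on D (\<lambda>_. of_real c)"
  by (rule regular_onI[of "\<bar>c\<bar>" _ _ 0]) auto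

lemma regular_on_coordinate:
  assumes "0 \<le> B" "\<And>z. z \<in> D \<Longrightarrow> cmod (z a) \<le> B"
  shows "regular_on D (\<lambda>z. z a)"
  by (rule regular_onI[of B _ _ 1]) (use assms in auto)

lemma regular_on_coordinate_diff:
  assumes "0 \<le> B" "\<And>z. z \<in> D \<Longrightarrow> cmod (z a - z b) \<le> B"
  shows "regular_on D (\<lambda>z. z a - z b)"
proof (rule regular_onI[of B _ _ 2])
  fix z w :: "'a \<Rightarrow> complex" and d :: real assume *: "\<And>j. cmod (z j - w j) \<le> d"
  have "(z a - z b) - (w a - w b) = (z a - w a) - (z b - w b)" by simp
  then have "cmod ((z a - z b) - (w a - w b)) \<le> cmod (z a - w a) + cmod (z b - w b)"
    by (metis norm_triangle_ineq4)
  then show "cmod (z a - z b - (w a - w b)) \<le> 2 * d" using *[of a] *[of b] by linarith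
qed (use assms in \<open>auto intro: holomorphic_intros\<close>)

lemma regular_on_add:
  assumes "regular_on D f" "regular_on D g"
  shows "regular_on D (\<lambda>z. f z + g z)"
proof -
  obtain B1 where B1: "0 \<le> B1" "\<And>z. z \<in> D \<Longrightarrow> cmod (f z) \<le> B1"
    using regular_on_bounded[OF assms(1)] by blast
  obtain L1 where L1: "0 \<le> L1" "lipschitz_field D (\<lambda>z _. f z) L1"
    using regular_on_lipschitz[OF assms(1)] by blast
  obtain B2 where B2: "0 \<le> B2" "\<And>z. z \<in> D \<Longrightarrow> cmod (g z) \<le> B2"
    using regular_on_bounded[OF assms(2)] by blast
  obtain L2 where L2: "0 \<le> L2" "lipschitz_field D (\<lambda>z _. g z) L2"
    using regular_on_lipschitz[OF assms(2)] by blast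
  show ?thesis
  proof (rule regular_onI[of "B1 + B2" _ _ "L1 + L2"])
    show "cmod (f z + g z) \<le> B1 + B2" if "z \<in> D" for z
      by (rule norm_triangle_mono[OF B1(2)[OF that] B2(2)[OF that]])
    fix z w and d :: real assume zw: "z \<in> D" "w \<in> D" and d0: "0 \<le> d" and d: "\<And>j. cmod (z j - w j) \<le> d"
    have "cmod ((f z - f w) + (g z - g w)) \<le> L1 * d + L2 * d"
      by (rule norm_triangle_mono[OF lipschitz_fieldD[OF L1(2) zw d] lipschitz_fieldD[OF L2(2) zw d]])
    then show "cmod (f z + g z - (f w + g w)) \<le> (L1 + L2) * d" by (simp add: algebra_simps)
  next
    show "f z + g z \<in> \<real>" if "z \<in> D" "\<And>j. z j \<in> \<real>" for z
      using regular_on_real[OF assms(1)] regular_on_real[OF assms(2)] that by simp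
    show "(\<lambda>\<tau>. f (\<gamma> \<tau>) + g (\<gamma> \<tau>)) holomorphic_on S"
      if "\<And>\<tau>. \<tau> \<in> S \<Longrightarrow> \<gamma> \<tau> \<in> D" "\<And>j. (\<lambda>\<tau>. \<gamma> \<tau> j) holomorphic_on S" for S \<gamma>
      by (intro holomorphic_on_add regular_on_holomorphic[OF assms(1)] regular_on_holomorphic[OF assms(2)] that)
  qed (use B1(1) L1(1) B2(1) L2(1) in auto)
qed

lemma regular_on_mult:
  assumes "regular_on D f" "regular_on D g"
  shows "regular_on D (\<lambda>z. f z * g z)"
proof -
  obtain B1 where B1: "0 \<le> B1" "\<And>z. z \<in> D \<Longrightarrow> cmod (f z) \<le> B1"
    using regular_on_bounded[OF assms(1)] by blast
  obtain L1 where L1: "0 \<le> L1" "lipschitz_field D (\<lambda>z _. f z) L1"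
    using regular_on_lipschitz[OF assms(1)] by blast
  obtain B2 where B2: "0 \<le> B2" "\<And>z. z \<in> D \<Longrightarrow> cmod (g z) \<le> B2"
    using regular_on_bounded[OF assms(2)] by blast
  obtain L2 where L2: "0 \<le> L2" "lipschitz_field D (\<lambda>z _. g z) L2"
    using regular_on_lipschitz[OF assms(2)] by blast
  show ?thesis
  proof (rule regular_onI[of "B1 * B2" _ _ "L1 * B2 + B1 * L2"])
    show "cmod (f z * g z) \<le> B1 * B2" if "z \<in> D" for z
      unfolding norm_mult using B1(1) by (intro mult_mono B1(2) B2(2) that norm_ge_zero)
    fix z w and d :: real assume zw: "z \<in> D" "w \<in> D" and d0: "0 \<le> d" and d: "\<And>j. cmod (z j - w j) \<le> d"
    have "cmod (f z - f w) * cmod (g z) \<le> (L1 * d) * B2"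
      using L1(1) d0 by (intro mult_mono lipschitz_fieldD[OF L1(2) zw d] B2(2) zw) auto
    moreover have "cmod (f w) * cmod (g z - g w) \<le> B1 * (L2 * d)"
      using B1(1) by (intro mult_mono lipschitz_fieldD[OF L2(2) zw d] B1(2) zw) auto
    ultimately have "cmod ((f z - f w) * g z + f w * (g z - g w)) \<le> (L1 * d) * B2 + B1 * (L2 * d)"
      unfolding norm_mult[symmetric] by (rule norm_triangle_mono)
    then show "cmod (f z * g z - f w * g w) \<le> (L1 * B2 + B1 * L2) * d" by (simp add: algebra_simps)
  next
    show "f z * g z \<in> \<real>" if "z \<in> D" "\<And>j. z j \<in> \<real>" for z
      using regular_on_real[OF assms(1)] regular_on_real[OF assms(2)] that by simp
    show "(\<lambda>\<tau>. f (\<gamma> \<tau>) * g (\<gamma> \<tau>)) holomorphic_on S"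
      if "\<And>\<tau>. \<tau> \<in> S \<Longrightarrow> \<gamma> \<tau> \<in> D" "\<And>j. (\<lambda>\<tau>. \<gamma> \<tau> j) holomorphic_on S" for S \<gamma>
      by (intro holomorphic_on_mult regular_on_holomorphic[OF assms(1)] regular_on_holomorphic[OF assms(2)] that)
  qed (use B1(1) L1(1) B2(1) L2(1) in auto)
qed

lemma regular_on_power: "regular_on D f \<Longrightarrow> regular_on D (\<lambda>z. f z ^ n)"
proof (induction n)
  case 0
  show ?case using regular_on_const[of D 1] by simp
next
  case (Suc n)
  then show ?case using regular_on_mult[of D f "\<lambda>z. f z ^ n"] by simp
qed

lemma regular_on_sum: "(\<And>a. a \<in> A \<Longrightarrow> regular_on D (f a)) \<Longrightarrow> regular_on D (\<lambda>z. \<Sum>a\<in>A. f a z)"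
proof (induction A rule: infinite_finite_induct)
  case (insert x F)
  then show ?case using regular_on_add[of D "f x" "\<lambda>z. \<Sum>a\<in>F. f a z"] by simp
qed (use regular_on_const[of D 0] in simp_all)

lemma regular_on_inverse:
  assumes "regular_on D g" and c: "0 < c" "\<And>z. z \<in> D \<Longrightarrow> c \<le> cmod (g z)"
  shows "regular_on D (\<lambda>z. inverse (g z))"
proof -
  obtain B2 where B2: "0 \<le> B2" "\<And>z. z \<in> D \<Longrightarrow> cmod (g z) \<le> B2"
    using regular_on_bounded[OF assms(1)] by blast
  obtain L2 where L2: "0 \<le> L2" "lipschitz_field D (\<lambda>z _. g z) L2"
    using regular_on_lipschitz[OF assms(1)] by blast
  have nz: "g z \<noteq> 0" if "z \<in> D" for z using c(1) c(2)[OF that] by auto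
  have le: "cmod (inverse (g z)) \<le> 1 / c" if "z \<in> D" for z
    using c(1) c(2)[OF that] by (simp add: norm_inverse divide_inverse le_imp_inverse_le)
  show ?thesis
  proof (rule regular_onI[of "1 / c" _ _ "1 / c * L2 * (1 / c)"])
    fix z w and d :: real assume zw: "z \<in> D" "w \<in> D" and d0: "0 \<le> d" and d: "\<And>j. cmod (z j - w j) \<le> d"
    have "inverse (g z) - inverse (g w) = inverse (g z) * (g w - g z) * inverse (g w)"
      using nz zw by (simp add: field_simps)
    moreover have "cmod (g w - g z) \<le> L2 * d" using lipschitz_fieldD[OF L2(2) zw d] by (simp add: norm_minus_commute)
    moreover have "cmod (inverse (g z)) * cmod (g w - g z) * cmod (inverse (g w)) \<le> (1 / c) * (L2 * d) * (1 / c)"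
      if "cmod (g w - g z) \<le> L2 * d"
      using c(1) L2(1) d0 by (intro mult_mono le zw that norm_ge_zero mult_nonneg_nonneg) auto
    ultimately show "cmod (inverse (g z) - inverse (g w)) \<le> 1 / c * L2 * (1 / c) * d"
      by (simp add: norm_mult mult_ac)
  next
    show "inverse (g z) \<in> \<real>" if "z \<in> D" "\<And>j. z j \<in> \<real>" for z
      using regular_on_real[OF assms(1)] that by simp
    show "(\<lambda>\<tau>. inverse (g (\<gamma> \<tau>))) holomorphic_on S"
      if "\<And>\<tau>. \<tau> \<in> S \<Longrightarrow> \<gamma> \<tau> \<in> D" "\<And>j. (\<lambda>\<tau>. \<gamma> \<tau> j) holomorphic_on S" for S \<gamma>
      by (intro holomorphic_on_inverse regular_on_holomorphic[OF assms(1)] that nz)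
  qed (use B2(1) L2(1) c le in auto)
qed

lemma regular_on_divide:
  assumes "regular_on D f" "regular_on D g" "0 < c" "\<And>z. z \<in> D \<Longrightarrow> c \<le> cmod (g z)"
  shows "regular_on D (\<lambda>z. f z / g z)"
  unfolding divide_inverse by (intro regular_on_mult assms regular_on_inverse[of D g c])

lemma Re_csqrt_ge:
  assumes "0 < c" "c \<le> Re a"
  shows "sqrt c \<le> Re (csqrt a)"
  using complex_Re_le_cmod[of a] assms by simp

text \<open>The Lipschitz constant comes from \<open>(a - b) (a + b) = a\<^sup>2 - b\<^sup>2\<close>: both square roots have real part at
least \<open>sqrt c\<close>, so their sum is bounded away from 0.\<close>

lemma regular_on_csqrt:
  assumes "regular_on D g" and c: "0 < c" "\<And>z. z \<in> D \<Longrightarrow> c \<le> Re (g z)"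
  shows "regular_on D (\<lambda>z. csqrt (g z))"
proof -
  obtain B2 where B2: "0 \<le> B2" "\<And>z. z \<in> D \<Longrightarrow> cmod (g z) \<le> B2"
    using regular_on_bounded[OF assms(1)] by blast
  obtain L2 where L2: "0 \<le> L2" "lipschitz_field D (\<lambda>z _. g z) L2"
    using regular_on_lipschitz[OF assms(1)] by blast
  show ?thesis
  proof (rule regular_onI[of "sqrt B2" _ _ "L2 / sqrt c"])
    fix z w and d :: real assume zw: "z \<in> D" "w \<in> D" and d0: "0 \<le> d" and d: "\<And>j. cmod (z j - w j) \<le> d"
    have "sqrt c \<le> Re (csqrt (g z))" "sqrt c \<le> Re (csqrt (g w))"
      using Re_csqrt_ge c zw by blast+
    moreover have "0 \<le> sqrt c" using c(1) by simp
    ultimately have "sqrt c \<le> Re (csqrt (g z) + csqrt (g w))"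
      unfolding plus_complex.sel by linarith
    then have s: "sqrt c \<le> cmod (csqrt (g z) + csqrt (g w))" using complex_Re_le_cmod order_trans by blast
    have "(csqrt (g z) - csqrt (g w)) * (csqrt (g z) + csqrt (g w)) = (csqrt (g z))\<^sup>2 - (csqrt (g w))\<^sup>2"
      by (simp add: power2_eq_square algebra_simps del: power2_csqrt)
    then have "(csqrt (g z) - csqrt (g w)) * (csqrt (g z) + csqrt (g w)) = g z - g w" by simp
    then have "cmod (csqrt (g z) - csqrt (g w)) * cmod (csqrt (g z) + csqrt (g w)) = cmod (g z - g w)"
      by (metis norm_mult)
    moreover have "cmod (csqrt (g z) - csqrt (g w)) * sqrt c \<le> cmod (csqrt (g z) - csqrt (g w)) * cmod (csqrt (g z) + csqrt (g w))"
      by (intro mult_left_mono s norm_ge_zero)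
    moreover have "cmod (g z - g w) \<le> L2 * d" by (rule lipschitz_fieldD[OF L2(2) zw d])
    ultimately have "cmod (csqrt (g z) - csqrt (g w)) * sqrt c \<le> L2 * d" by linarith
    then show "cmod (csqrt (g z) - csqrt (g w)) \<le> L2 / sqrt c * d"
      using c(1) by (simp add: field_simps)
  next
    show "csqrt (g z) \<in> \<real>" if "z \<in> D" "\<And>j. z j \<in> \<real>" for z
    proof -
      have "g z = of_real (Re (g z))" using regular_on_real[OF assms(1) that] by simp
      moreover have "0 \<le> Re (g z)" using c(1) c(2)[OF that(1)] by linarith
      ultimately show ?thesis by (metis Reals_of_real of_real_sqrt)
    qed
    show "(\<lambda>\<tau>. csqrt (g (\<gamma> \<tau>))) holomorphic_on S"
      if "\<And>\<tau>. \<tau> \<in> S \<Longrightarrow> \<gamma> \<tau> \<in> D" "\<And>j. (\<lambda>\<tau>. \<gamma> \<tau> j) holomorphic_on S" for S \<gamma>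
    proof (rule holomorphic_on_csqrt')
      show "(\<lambda>\<tau>. g (\<gamma> \<tau>)) holomorphic_on S" by (intro regular_on_holomorphic[OF assms(1)] that)
      show "g (\<gamma> \<tau>) \<notin> \<real>\<^sub>\<le>\<^sub>0" if "\<tau> \<in> S" for \<tau>
        using c(1) c(2)[of "\<gamma> \<tau>"] \<open>\<And>\<tau>. \<tau> \<in> S \<Longrightarrow> \<gamma> \<tau> \<in> D\<close>[OF that] by (auto simp: complex_nonpos_Reals_iff)
    qed
  qed (use B2 L2(1) c(1) in auto)
qed

text \<open>The number \<open>33/256 = 2 * (1/16) + (1/16)\<^sup>2\<close> is the relative change of a squared distance when the
relative position moves by one sixteenth of its length. The bounds for the square root use that its
real part is at least \<open>93/100\<close>, which makes \<open>\<bar>csqrt z + 1\<bar> \<ge> 193/100\<close>.\<close>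

lemma sqrt_perturbation:
  assumes z: "cmod (z - 1) \<le> 33/256"
  shows "223/256 \<le> Re z" "223/256 \<le> cmod z" "cmod (1 / z - 1) \<le> 3/20"
    "93/100 \<le> cmod (csqrt z)" "cmod (1 / csqrt z - 1) \<le> 2/25"
proof -
  have "\<bar>Re (z - 1)\<bar> \<le> 33/256" using abs_Re_le_cmod z order_trans by blast
  then have "- (33/256) \<le> Re (z - 1)" by linarith
  then show re: "223/256 \<le> Re z" by simp
  then show cz: "223/256 \<le> cmod z" using complex_Re_le_cmod[of z] by linarith
  have z0: "z \<noteq> 0" using re by auto
  have "1 / z - 1 = (1 - z) / z" using z0 by (simp add: field_simps)
  then have "cmod (1 / z - 1) = cmod (z - 1) / cmod z" by (simp add: norm_divide norm_minus_commute)
  also have "\<dots> \<le> (33/256) / (223/256)" using z cz by (intro frac_le) auto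
  finally show "cmod (1 / z - 1) \<le> 3/20" by simp
  define s where "s = csqrt z"
  have "sqrt ((93/100)\<^sup>2) \<le> sqrt (223/256)"
    by (rule real_sqrt_le_mono) (simp add: power2_eq_square)
  then have "93/100 \<le> sqrt (223/256)" by (simp only: real_sqrt_abs)
  then have res: "93/100 \<le> Re s" using Re_csqrt_ge[of "223/256" z] re unfolding s_def by linarith
  then show cs: "93/100 \<le> cmod (csqrt z)" using complex_Re_le_cmod[of s] unfolding s_def by linarith
  have "193/100 \<le> Re (s + 1)" using res by simp
  then have s1: "193/100 \<le> cmod (s + 1)" using complex_Re_le_cmod[of "s + 1"] by linarith
  have "(s - 1) * (s + 1) = z - 1"
    using power2_csqrt[of z] unfolding s_def[symmetric] by (simp add: algebra_simps power2_eq_square)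
  then have "cmod (s - 1) * cmod (s + 1) \<le> 33/256" using z by (metis norm_mult)
  moreover have "cmod (s - 1) * (193/100) \<le> cmod (s - 1) * cmod (s + 1)" by (intro mult_left_mono s1) auto
  ultimately have sm: "cmod (s - 1) \<le> 67/1000" by linarith
  have s0: "s \<noteq> 0" using res by auto
  have "1 / s - 1 = (1 - s) / s" using s0 by (simp add: field_simps)
  then have "cmod (1 / s - 1) = cmod (s - 1) / cmod s" by (simp add: norm_divide norm_minus_commute)
  also have "\<dots> \<le> (67/1000) / (93/100)" using sm cs by (intro frac_le) (auto simp: s_def)
  finally show "cmod (1 / csqrt z - 1) \<le> 2/25" by (simp add: s_def)
qed

definition cvec :: "real ^ 3 \<Rightarrow> complex ^ 3" where
  "cvec u = (\<chi> k. of_real (u $ k))"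

lemma cvec_diff: "cvec (u - w) = cvec u - cvec w"
  by (simp add: cvec_def vec_eq_iff)

lemma norm_vec_power2: "(norm (u :: 'a::real_normed_vector ^ 'k))\<^sup>2 = (\<Sum>k\<in>UNIV. (norm (u $ k))\<^sup>2)"
  by (simp add: norm_vec_def L2_set_def sum_nonneg)

lemma sqT_real: "sqT u = (norm u)\<^sup>2" for u :: "real ^ 3"
  by (simp add: sqT_def norm_vec_power2)

lemma sqT_cvec: "sqT (cvec u) = of_real ((norm u)\<^sup>2)"
  by (simp add: sqT_def cvec_def norm_vec_power2)

lemma norm_cvec: "norm (cvec u) = norm u"
proof -
  have "(norm (cvec u))\<^sup>2 = (norm u)\<^sup>2" unfolding norm_vec_power2 by (simp add: cvec_def)
  then show ?thesis by (simp add: power2_eq_iff_nonneg)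
qed

lemma norm_vector_scalar_mult: "norm (c *s u) = cmod c * norm u" for u :: "complex ^ 'k"
proof -
  have "(norm (c *s u))\<^sup>2 = (cmod c * norm u)\<^sup>2"
    unfolding power_mult_distrib norm_vec_power2 by (simp add: norm_mult power_mult_distrib sum_distrib_left)
  then show ?thesis by (simp add: power2_eq_iff_nonneg)
qed

text \<open>Cauchy--Schwarz for the bilinear product, which carries no conjugation.\<close>

lemma cmod_dot_le: "cmod (\<Sum>k\<in>UNIV. u $ k * w $ k) \<le> norm u * norm w" for u w :: "complex ^ 'k"
proof -
  have "cmod (\<Sum>k\<in>UNIV. u $ k * w $ k) \<le> (\<Sum>k\<in>UNIV. \<bar>cmod (u $ k)\<bar> * \<bar>cmod (w $ k)\<bar>)"
    by (rule order_trans[OF norm_sum]) (simp add: norm_mult)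
  also have "\<dots> \<le> norm u * norm w" unfolding norm_vec_def by (rule L2_set_mult_ineq)
  finally show ?thesis .
qed

lemma cmod_sqT_diff_le:
  fixes u w :: "complex ^ 3"
  shows "cmod (sqT u - sqT w) \<le> 2 * norm w * norm (u - w) + (norm (u - w))\<^sup>2"
proof -
  have "sqT u - sqT w = 2 * (\<Sum>k\<in>UNIV. w $ k * (u - w) $ k) + (\<Sum>k\<in>UNIV. (u - w) $ k * (u - w) $ k)"
    by (simp add: sqT_def sum_subtractf[symmetric] sum_distrib_left sum.distrib[symmetric] power2_eq_square algebra_simps)
  then have "cmod (sqT u - sqT w) \<le> cmod (2 * (\<Sum>k\<in>UNIV. w $ k * (u - w) $ k)) + cmod (\<Sum>k\<in>UNIV. (u - w) $ k * (u - w) $ k)"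
    by (metis norm_triangle_ineq)
  also have "\<dots> \<le> 2 * (norm w * norm (u - w)) + norm (u - w) * norm (u - w)"
    unfolding norm_mult by (intro add_mono mult_mono cmod_dot_le) auto
  finally show ?thesis by (simp add: power2_eq_square)
qed

lemma has_vector_derivative_vec:
  fixes f :: "real \<Rightarrow> 'a::real_normed_vector ^ 'k::finite"
  assumes "\<And>k. ((\<lambda>t. f t $ k) has_vector_derivative f' $ k) (at x within S)"
  shows "(f has_vector_derivative f') (at x within S)"
proof -
  have "((\<lambda>y. (1 / norm (y - x)) *\<^sub>R (f y - (f x + (y - x) *\<^sub>R f'))) \<longlongrightarrow> 0) (at x within S)"
  proof (rule vec_tendstoI)
    fix k
    show "((\<lambda>y. ((1 / norm (y - x)) *\<^sub>R (f y - (f x + (y - x) *\<^sub>R f'))) $ k) \<longlongrightarrow> 0 $ k) (at x within S)"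
      using assms[of k] unfolding has_vector_derivative_def has_derivative_within by simp
  qed
  then show ?thesis
    unfolding has_vector_derivative_def has_derivative_within by (simp add: bounded_linear_scaleR_left)
qed

section \<open>A priori estimates near a real state\<close>

text \<open>A state is a family indexed by a flag (position or velocity), a body and a coordinate.\<close>

definition positions :: "(bool \<times> 'n \<times> 3 \<Rightarrow> complex) \<Rightarrow> complex ^ 3 ^ 'n" where
  "positions z = (\<chi> i k. z (True, i, k))"

definition velocities :: "(bool \<times> 'n \<times> 3 \<Rightarrow> complex) \<Rightarrow> complex ^ 3 ^ 'n" where
  "velocities z = (\<chi> i k. z (False, i, k))"

lemma positions_nth [simp]: "positions z $ i $ k = z (True, i, k)"
  by (simp add: positions_def)

lemma velocities_nth [simp]: "velocities z $ i $ k = z (False, i, k)"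
  by (simp add: velocities_def)

definition real_state :: "real ^ 3 ^ 'n \<Rightarrow> real ^ 3 ^ 'n \<Rightarrow> bool \<times> 'n \<times> 3 \<Rightarrow> complex" where
  "real_state q v = (\<lambda>(b, i, k). of_real (if b then q $ i $ k else v $ i $ k))"

text \<open>Principal branches of the square roots suffice, since the squared distances and the radicand of \<open>s\<close>
keep a positive real part along the whole solution.\<close>

definition cdist :: "complex ^ 3 ^ 'n \<Rightarrow> 'n \<Rightarrow> 'n \<Rightarrow> complex" where
  "cdist q i j = csqrt (sqT (q $ i - q $ j))"

definition crad :: "real \<Rightarrow> ('n::{finite,linorder} \<Rightarrow> real) \<Rightarrow> (bool \<times> 'n \<times> 3 \<Rightarrow> complex) \<Rightarrow> complex" where
  "crad G m z = s_radicand G m (positions z) (velocities z) (cdist (positions z))"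

definition cacc :: "real \<Rightarrow> ('n::{finite,linorder} \<Rightarrow> real) \<Rightarrow> (bool \<times> 'n \<times> 3 \<Rightarrow> complex) \<Rightarrow> 'n \<Rightarrow> complex ^ 3" where
  "cacc G m z = nbody_acc G m (positions z) (\<lambda>i j. cdist (positions z) i j ^ 3)"

definition field ::
  "real \<Rightarrow> ('n::{finite,linorder} \<Rightarrow> real) \<Rightarrow> (bool \<times> 'n \<times> 3 \<Rightarrow> complex) \<Rightarrow> bool \<times> 'n \<times> 3 \<Rightarrow> complex" where
  "field G m z = (\<lambda>(b, i, k). 1 / csqrt (crad G m z) *
      (if b then velocities z $ i $ k else cacc G m z i $ k))"

lemma csqrt_scale:
  assumes "0 < r"
  shows "csqrt (of_real (r\<^sup>2) * z) = of_real r * csqrt z"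
proof (rule csqrt_unique)
  show "(of_real r * csqrt z)\<^sup>2 = of_real (r\<^sup>2) * z" by (simp add: power_mult_distrib)
  have "0 < Re (csqrt z) \<or> Re (csqrt z) = 0 \<and> 0 \<le> Im (csqrt z)" by (rule csqrt_principal)
  moreover have "Re (of_real r * csqrt z) = r * Re (csqrt z)" "Im (of_real r * csqrt z) = r * Im (csqrt z)"
    by (simp_all del: csqrt.simps)
  ultimately show "0 < Re (of_real r * csqrt z) \<or> Re (of_real r * csqrt z) = 0 \<and> 0 \<le> Im (of_real r * csqrt z)"
    using assms by (metis mult_pos_pos mult_nonneg_nonneg mult_zero_right less_imp_le)
qed

text \<open>The change of the velocity term of one pair. Here \<open>\<delta>\<close> is the change of the relative velocity
and \<open>\<kappa>\<close> is the potential term of the pair. The product \<open>2 n \<delta> / r\<^sup>2\<close> is split into \<open>(n/r)\<^sup>2 / 12\<close> and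
\<open>(\<kappa>/R)\<^sup>2 / 12 \<le> \<kappa> / 12\<close>, so that summing over all pairs loses no factor depending on their number.\<close>

lemma velocity_term_bound:
  fixes S w :: complex
  assumes pos: "0 < r" "0 < R" "0 \<le> n" and \<kappa>: "0 \<le> \<kappa>" "\<kappa> \<le> R\<^sup>2"
    and \<delta>: "\<delta> = \<kappa> * r / (12 * R)"
    and S: "cmod (S - of_real (n\<^sup>2)) \<le> 2 * n * \<delta> + \<delta>\<^sup>2"
    and w: "w \<noteq> 0" "cmod (of_real (r\<^sup>2) / w - 1) \<le> 3/20"
  shows "cmod (S / w - of_real (n\<^sup>2 / r\<^sup>2)) \<le> 1/4 * (n / r)\<^sup>2 + 11/100 * \<kappa>"
proof -
  define e d h Q where "e = n / r" and "d = \<delta> / r" and "h = \<kappa> / R" and "Q = of_real (r\<^sup>2) / w"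
  have d: "d = h / 12" using pos by (simp add: d_def h_def \<delta>)
  have kR: "h\<^sup>2 \<le> \<kappa>"
  proof -
    have "\<kappa> * \<kappa> \<le> \<kappa> * R\<^sup>2" using \<kappa> by (intro mult_left_mono)
    then show ?thesis using pos by (simp add: h_def power_divide field_simps power2_eq_square)
  qed
  have "2 * e * d = (2 * e * h) / 12" by (simp add: d)
  also have "\<dots> \<le> (e\<^sup>2 + \<kappa>) / 12"
    using sum_squares_bound[of e h] kR by (intro divide_right_mono) auto
  finally have ed: "2 * e * d \<le> (e\<^sup>2 + \<kappa>) / 12" .
  have dd: "d\<^sup>2 \<le> \<kappa> / 144" using kR by (simp add: d power_divide)
  have Q: "cmod Q \<le> 23/20"
    using norm_triangle_ineq[of "Q - 1" 1] w(2) by (simp add: Q_def)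
  have "S / w - of_real (n\<^sup>2 / r\<^sup>2) = (S - of_real (n\<^sup>2)) / of_real (r\<^sup>2) * Q + of_real (e\<^sup>2) * (Q - 1)"
    using w pos by (simp add: Q_def e_def field_simps power2_eq_square)
  also have "cmod \<dots> \<le> (2 * e * d + d\<^sup>2) * (23/20) + e\<^sup>2 * (3/20)"
  proof (rule norm_triangle_mono)
    have "cmod ((S - of_real (n\<^sup>2)) / of_real (r\<^sup>2)) \<le> (2 * n * \<delta> + \<delta>\<^sup>2) / r\<^sup>2"
      using S by (simp add: norm_divide norm_power divide_right_mono)
    also have "\<dots> = 2 * e * d + d\<^sup>2" using pos by (simp add: e_def d_def field_simps power2_eq_square)
    finally have "cmod ((S - of_real (n\<^sup>2)) / of_real (r\<^sup>2)) \<le> 2 * e * d + d\<^sup>2" .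
    then show "cmod ((S - of_real (n\<^sup>2)) / of_real (r\<^sup>2) * Q) \<le> (2 * e * d + d\<^sup>2) * (23/20)"
      unfolding norm_mult using Q by (intro mult_mono order_trans[OF norm_ge_zero]) auto
    show "cmod (of_real (e\<^sup>2) * (Q - 1)) \<le> e\<^sup>2 * (3/20)"
      unfolding norm_mult norm_of_real using w(2) by (intro mult_mono) (auto simp: Q_def)
  qed
  also have "\<dots> \<le> 1/4 * e\<^sup>2 + 11/100 * \<kappa>"
  proof -
    have "(x + y) * (23/20) + E * (3/20) \<le> 1/4 * E + 11/100 * \<kappa>"
      if "x \<le> (E + \<kappa>) / 12" "y \<le> \<kappa> / 144" "0 \<le> E" for x y E :: real
      using that \<kappa>(1) by (simp add: field_simps)
    from this[OF ed dd zero_le_power2] show ?thesis .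
  qed
  finally show ?thesis by (simp add: e_def)
qed

text \<open>A real initial state. In this locale \<open>r\<close>, \<open>n\<close> are distances and relative speeds, \<open>K\<close> bounds the
accelerations, and \<open>R = sqrt rad\<close> is the reciprocal of \<open>s\<close>.\<close>

locale noncollision_state =
  fixes G :: real and m :: "'n::{finite,linorder} \<Rightarrow> real" and q0 v0 :: "real ^ 3 ^ 'n::{finite,linorder}"
  assumes two_bodies: "CARD('n) \<ge> 2" and G_pos: "G > 0" and m_pos: "\<And>i. m i > 0"
    and noncollision: "q0 \<notin> collision_set"
begin

definition r :: "'n \<Rightarrow> 'n \<Rightarrow> real" where "r i j = norm (q0 $ i - q0 $ j)"

definition n :: "'n \<Rightarrow> 'n \<Rightarrow> real" where "n i j = norm (v0 $ i - v0 $ j)"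

definition K :: "'n \<Rightarrow> real" where "K = K_coeff G m q0"

definition rad :: real where
  "rad = s_radicand G m q0 v0 (\<lambda>i j. sqrt (sqT (q0 $ i - q0 $ j)))"

definition R :: real where "R = sqrt rad"

text \<open>The complex neighbourhood of the real state in which the solution is trapped for
\<open>\<bar>\<tau>\<bar> < 1/20\<close>. Its size is measured in the units of each pair and each body, which is what makes
the radius independent of the state.\<close>

definition D :: "(bool \<times> 'n \<times> 3 \<Rightarrow> complex) set" where
  "D = {z. (\<forall>i j. i \<noteq> j \<longrightarrow> norm (positions z $ i - positions z $ j - cvec (q0 $ i - q0 $ j)) \<le> r i j / 16) \<and>
           (\<forall>i. norm (velocities z $ i - cvec (v0 $ i)) \<le> K i / (12 * R))}"

lemma r_pos: "i \<noteq> j \<Longrightarrow> 0 < r i j"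
  using noncollision by (auto simp: r_def collision_set_def)

lemma r_sym: "r i j = r j i"
  by (simp add: r_def norm_minus_commute)

lemma n_sym: "n i j = n j i"
  by (simp add: n_def norm_minus_commute)

lemma n_nonneg: "0 \<le> n i j"
  by (simp add: n_def)

lemma K_eq: "K i = (\<Sum>k\<in>UNIV - {i}. G * m k / (r i k)\<^sup>2)"
  by (simp add: K_def K_coeff_def sqT_real r_def)

lemma ex_other: "\<exists>k. k \<noteq> (i::'n)"
proof (rule ccontr)
  assume "\<nexists>k. k \<noteq> i"
  then have "(UNIV :: 'n set) = {i}" by auto
  then have "CARD('n) = card {i}" by (rule arg_cong)
  then show False using two_bodies by simp
qed

lemma K_pos: "0 < K i"
proof -
  obtain k where "k \<noteq> i" using ex_other by blast
  then have ne: "UNIV - {i} \<noteq> {}" by auto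
  have "0 < G * m k / (r i k)\<^sup>2" if "k \<in> UNIV - {i}" for k
    using that r_pos[of i k] G_pos m_pos[of k] by (intro divide_pos_pos mult_pos_pos zero_less_power) auto
  then show ?thesis unfolding K_eq using ne by (intro sum_pos) auto
qed

lemma rad_eq: "rad = (\<Sum>(i,j)\<in>{(i,j). i < j}. (n i j / r i j)\<^sup>2) + (\<Sum>(i,j)\<in>{(i,j). i < j}. (K i + K j) / r i j)"
  by (simp add: rad_def s_radicand_def K_def sqT_real n_def r_def power_divide)

text \<open>This is where the form of \<open>s\<close> enters: each pair contributes nonnegative terms to \<open>1 / s\<^sup>2\<close>.\<close>

lemma pair_le_rad:
  assumes "i \<noteq> j"
  shows "(n i j / r i j)\<^sup>2 + (K i + K j) / r i j \<le> rad"
proof -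
  have *: "(n i j / r i j)\<^sup>2 + (K i + K j) / r i j \<le> rad" if "i < j" for i j
  proof -
    have fin: "finite {(i::'n, j). i < j}" by (rule finite_subset[of _ UNIV]) auto
    have "(n i j / r i j)\<^sup>2 \<le> (\<Sum>(i,j)\<in>{(i,j). i < j}. (n i j / r i j)\<^sup>2)"
      using member_le_sum[of "(i, j)" "{(i,j). i < j}" "\<lambda>(i,j). (n i j / r i j)\<^sup>2"] fin that by auto
    moreover have "(K i + K j) / r i j \<le> (\<Sum>(i,j)\<in>{(i,j). i < j}. (K i + K j) / r i j)"
    proof -
      have "0 \<le> (case p of (i, j) \<Rightarrow> (K i + K j) / r i j)" if "p \<in> {(i,j). i < j}" for p
        using that less_imp_le[OF r_pos[of "fst p" "snd p"]] K_pos[of "fst p"] K_pos[of "snd p"]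
        by (auto simp: case_prod_beta intro!: divide_nonneg_nonneg)
      then have "(case (i, j) of (i, j) \<Rightarrow> (K i + K j) / r i j) \<le> (\<Sum>(i,j)\<in>{(i,j). i < j}. (K i + K j) / r i j)"
        using fin that by (intro member_le_sum) auto
      then show ?thesis by simp
    qed
    ultimately show ?thesis unfolding rad_eq by linarith
  qed
  show ?thesis
  proof (cases "i < j")
    case False
    then have "j < i" using assms by simp
    from *[OF this] show ?thesis by (simp add: r_sym[of j] n_sym[of j] add.commute)
  qed (rule *)
qed

lemma rad_pos: "0 < rad"
proof -
  obtain i j :: 'n where "j \<noteq> i" using ex_other by blast
  then have ij: "i \<noteq> j" by simp
  have "0 < (K i + K j) / r i j" using K_pos[of i] K_pos[of j] r_pos[OF ij] by simp
  then show ?thesis using pair_le_rad[OF ij] zero_le_power2[of "n i j / r i j"] by linarith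
qed

lemma R_pos: "0 < R" and R_power2: "R\<^sup>2 = rad"
  using rad_pos by (auto simp: R_def)

lemma position_facts:
  assumes z: "z \<in> D" and ij: "i \<noteq> j"
  defines "u \<equiv> positions z $ i - positions z $ j"
  shows "223/256 * (r i j)\<^sup>2 \<le> Re (sqT u)" "223/256 * (r i j)\<^sup>2 \<le> cmod (sqT u)"
    "cmod (of_real ((r i j)\<^sup>2) / sqT u - 1) \<le> 3/20"
    "93/100 * r i j \<le> cmod (cdist (positions z) i j)"
    "cmod (of_real (r i j) / cdist (positions z) i j - 1) \<le> 2/25"
    "norm u \<le> 17/16 * r i j"
proof -
  define \<rho> where "\<rho> = r i j"
  have \<rho>: "0 < \<rho>" using r_pos[OF ij] by (simp add: \<rho>_def)
  define b where "b = cvec (q0 $ i - q0 $ j)"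
  have b: "norm b = \<rho>" "sqT b = of_real (\<rho>\<^sup>2)" by (simp_all add: b_def norm_cvec sqT_cvec \<rho>_def r_def)
  have ub: "norm (u - b) \<le> \<rho> / 16" using z ij by (simp add: D_def u_def b_def \<rho>_def)
  show "norm u \<le> 17/16 * r i j"
    using norm_triangle_ineq[of b "u - b"] ub b unfolding \<rho>_def[symmetric] by simp
  define \<zeta> where "\<zeta> = sqT u / of_real (\<rho>\<^sup>2)"
  have u\<zeta>: "sqT u = of_real (\<rho>\<^sup>2) * \<zeta>" using \<rho> by (simp add: \<zeta>_def)
  have "\<zeta> - 1 = (sqT u - sqT b) / of_real (\<rho>\<^sup>2)" using \<rho> b by (simp add: \<zeta>_def diff_divide_distrib)
  then have "cmod (\<zeta> - 1) = cmod (sqT u - sqT b) / \<rho>\<^sup>2" by (simp add: norm_divide norm_power)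
  also have "\<dots> \<le> (2 * \<rho> * (\<rho> / 16) + (\<rho> / 16)\<^sup>2) / \<rho>\<^sup>2"
  proof (rule divide_right_mono)
    have "cmod (sqT u - sqT b) \<le> 2 * norm b * norm (u - b) + (norm (u - b))\<^sup>2" by (rule cmod_sqT_diff_le)
    also have "\<dots> \<le> 2 * \<rho> * (\<rho> / 16) + (\<rho> / 16)\<^sup>2"
      using ub \<rho> unfolding b by (intro add_mono mult_left_mono power_mono) auto
    finally show "cmod (sqT u - sqT b) \<le> 2 * \<rho> * (\<rho> / 16) + (\<rho> / 16)\<^sup>2" .
  qed simp
  also have "\<dots> = 33/256" using \<rho> by (simp add: field_simps power2_eq_square)
  finally have "cmod (\<zeta> - 1) \<le> 33/256" .
  note \<zeta> = sqrt_perturbation[OF this]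
  have d: "cdist (positions z) i j = of_real \<rho> * csqrt \<zeta>"
    unfolding cdist_def u_def[symmetric] u\<zeta> by (rule csqrt_scale[OF \<rho>])
  show "223/256 * (r i j)\<^sup>2 \<le> Re (sqT u)"
    using mult_left_mono[OF \<zeta>(1), of "\<rho>\<^sup>2"] unfolding u\<zeta> \<rho>_def[symmetric] by (simp add: mult_ac)
  show "223/256 * (r i j)\<^sup>2 \<le> cmod (sqT u)"
    using mult_left_mono[OF \<zeta>(2), of "\<rho>\<^sup>2"] unfolding u\<zeta> \<rho>_def[symmetric] by (simp add: norm_mult norm_power mult_ac)
  show "cmod (of_real ((r i j)\<^sup>2) / sqT u - 1) \<le> 3/20"
    using \<zeta>(3) \<rho> unfolding u\<zeta> \<rho>_def[symmetric] by simp
  show "93/100 * r i j \<le> cmod (cdist (positions z) i j)"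
    using mult_left_mono[OF \<zeta>(4), of \<rho>] \<rho> unfolding d \<rho>_def[symmetric] by (simp add: norm_mult mult_ac)
  show "cmod (of_real (r i j) / cdist (positions z) i j - 1) \<le> 2/25"
    using \<zeta>(5) \<rho> unfolding d \<rho>_def[symmetric] by simp
qed

lemma sqT_nz: "z \<in> D \<Longrightarrow> i \<noteq> j \<Longrightarrow> sqT (positions z $ i - positions z $ j) \<noteq> 0"
  using position_facts(1)[of z i j] r_pos[of i j] by auto

lemma cdist_nz: "z \<in> D \<Longrightarrow> i \<noteq> j \<Longrightarrow> cdist (positions z) i j \<noteq> 0"
  using sqT_nz by (simp add: cdist_def)

lemma velocity_diff:
  assumes z: "z \<in> D" and ij: "i \<noteq> j"
  shows "norm ((velocities z $ i - velocities z $ j) - cvec (v0 $ i - v0 $ j)) \<le> (K i + K j) / r i j * r i j / (12 * R)"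
proof -
  have "norm ((velocities z $ i - cvec (v0 $ i)) - (velocities z $ j - cvec (v0 $ j))) \<le> K i / (12 * R) + K j / (12 * R)"
  proof -
    have "norm (velocities z $ k - cvec (v0 $ k)) \<le> K k / (12 * R)" for k using z by (simp add: D_def)
    then show ?thesis by (intro order_trans[OF norm_triangle_ineq4 add_mono])
  qed
  moreover have "(velocities z $ i - cvec (v0 $ i)) - (velocities z $ j - cvec (v0 $ j)) =
      (velocities z $ i - velocities z $ j) - cvec (v0 $ i - v0 $ j)" by (simp add: cvec_diff)
  moreover have "K i / (12 * R) + K j / (12 * R) = (K i + K j) / r i j * r i j / (12 * R)"
  proof -
    have "(K i + K j) / r i j * r i j = K i + K j" using r_pos[OF ij] by simp
    then show ?thesis by (simp only: add_divide_distrib)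
  qed
  ultimately show ?thesis by simp
qed

lemma pair_potential_bounds: 
  assumes "i \<noteq> j"
  shows "0 \<le> (K i + K j) / r i j" "(K i + K j) / r i j \<le> R\<^sup>2"
proof -
  show "0 \<le> (K i + K j) / r i j" using K_pos[of i] K_pos[of j] r_pos[OF assms] by simp
  show "(K i + K j) / r i j \<le> R\<^sup>2"
    using pair_le_rad[OF assms] zero_le_power2[of "n i j / r i j"] unfolding R_power2 by linarith
qed

text \<open>With \<open>e = n i j / (r i j * R)\<close> and \<open>\<kappa>\<close> the potential share of the pair one has \<open>e\<^sup>2 + \<kappa> \<le> 1\<close>, and then
\<open>e + \<kappa> / 12 \<le> 1\<close>: a pair that moves at full speed leaves no room for its velocity to grow.\<close>

lemma norm_velocity_le:
  assumes z: "z \<in> D" and ij: "i \<noteq> j"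
  shows "norm (velocities z $ i - velocities z $ j) \<le> r i j * R"
proof -
  define \<kappa> e where "\<kappa> = (K i + K j) / r i j / R\<^sup>2" and "e = n i j / r i j / R"
  note pos = r_pos[OF ij] R_pos
  have "norm (velocities z $ i - velocities z $ j) \<le> n i j + (K i + K j) / r i j * r i j / (12 * R)"
    using velocity_diff[OF z ij] norm_triangle_ineq[of "cvec (v0 $ i - v0 $ j)" "(velocities z $ i - velocities z $ j) - cvec (v0 $ i - v0 $ j)"]
    by (simp add: norm_cvec n_def)
  also have "\<dots> = r i j * R * (e + \<kappa> / 12)"
    using pos by (simp add: e_def \<kappa>_def field_simps power2_eq_square)
  also have "\<dots> \<le> r i j * R * 1"
  proof (rule mult_left_mono)
    have "((n i j / r i j)\<^sup>2 + (K i + K j) / r i j) / R\<^sup>2 \<le> 1"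
      using pair_le_rad[OF ij] rad_pos by (simp add: R_power2)
    then have e: "e\<^sup>2 + \<kappa> \<le> 1" by (simp add: e_def \<kappa>_def power_divide add_divide_distrib power_mult_distrib)
    have "0 \<le> \<kappa>" unfolding \<kappa>_def by (intro divide_nonneg_nonneg[of "(K i + K j) / r i j"] pair_potential_bounds ij) simp
    then have "e\<^sup>2 \<le> 1" using e by linarith
    moreover have e0: "0 \<le> e" using n_nonneg pos by (simp add: e_def)
    ultimately have "e \<le> 1" by (simp add: power_le_one_iff)
    then have "0 \<le> (1 - e) * (1 - (1 + e) / 12)" using e0 by (intro mult_nonneg_nonneg) auto
    also have "\<dots> = 1 - e - (1 - e\<^sup>2) / 12" by (simp add: field_simps power2_eq_square)
    finally show "e + \<kappa> / 12 \<le> 1" using e by (simp add: field_simps)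
  qed (use pos in auto)
  finally show ?thesis by simp
qed

lemma K_perturbation:
  assumes z: "z \<in> D"
  shows "cmod (K_coeff G m (positions z) i - of_real (K i)) \<le> 3/20 * K i"
proof -
  have "K_coeff G m (positions z) i - of_real (K i) =
      (\<Sum>k\<in>UNIV - {i}. of_real (G * m k / (r i k)\<^sup>2) * (of_real ((r i k)\<^sup>2) / sqT (positions z $ i - positions z $ k) - 1))"
    unfolding K_coeff_def K_eq of_real_sum sum_subtractf[symmetric]
  proof (rule sum.cong)
    fix k assume "k \<in> UNIV - {i}"
    then have "i \<noteq> k" by auto
    then show "of_real (G * m k) / sqT (positions z $ i - positions z $ k) - of_real (G * m k / (r i k)\<^sup>2) =
        of_real (G * m k / (r i k)\<^sup>2) * (of_real ((r i k)\<^sup>2) / sqT (positions z $ i - positions z $ k) - 1)"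
      using r_pos[of i k] by (simp add: field_simps)
  qed simp
  also have "cmod \<dots> \<le> (\<Sum>k\<in>UNIV - {i}. G * m k / (r i k)\<^sup>2 * (3/20))"
  proof (rule sum_norm_le)
    fix k assume "k \<in> UNIV - {i}"
    then have "i \<noteq> k" by auto
    moreover have "0 \<le> G * m k / (r i k)\<^sup>2" using G_pos m_pos[of k] by simp
    ultimately show "cmod (of_real (G * m k / (r i k)\<^sup>2) * (of_real ((r i k)\<^sup>2) / sqT (positions z $ i - positions z $ k) - 1))
        \<le> G * m k / (r i k)\<^sup>2 * (3/20)"
      unfolding norm_mult norm_of_real using position_facts(3)[OF z] by (intro mult_mono) auto
  qed
  also have "\<dots> = 3/20 * K i" by (simp add: K_eq sum_distrib_left mult_ac)
  finally show ?thesis .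
qed

text \<open>The constant is \<open>3/20 * 27/25 + 2/25 = 121/500 \<le> 1/4\<close>.\<close>

lemma potential_term_bound:
  assumes z: "z \<in> D" and ij: "i \<noteq> j"
  shows "cmod ((K_coeff G m (positions z) i + K_coeff G m (positions z) j) / cdist (positions z) i j
      - of_real ((K i + K j) / r i j)) \<le> 1/4 * ((K i + K j) / r i j)"
proof -
  define s A B where "s = cdist (positions z) i j" and "A = K_coeff G m (positions z) i + K_coeff G m (positions z) j"
    and "B = K i + K j"
  define Q where "Q = of_real (r i j) / s"
  note pos = r_pos[OF ij]
  have s: "s \<noteq> 0" using cdist_nz[OF z ij] by (simp add: s_def)
  have B: "0 \<le> B" using K_pos[of i] K_pos[of j] by (simp add: B_def)
  have "A - of_real B = (K_coeff G m (positions z) i - of_real (K i)) + (K_coeff G m (positions z) j - of_real (K j))"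
    by (simp add: A_def B_def)
  then have AB: "cmod (A - of_real B) \<le> 3/20 * B"
    using norm_triangle_mono[OF K_perturbation[OF z, of i] K_perturbation[OF z, of j]] by (simp add: B_def algebra_simps)
  have Q1: "cmod (Q - 1) \<le> 2/25" using position_facts(5)[OF z ij] by (simp add: Q_def s_def)
  then have Q: "cmod Q \<le> 27/25" using norm_triangle_ineq[of "Q - 1" 1] by simp
  have "A / s - of_real (B / r i j) = (A - of_real B) * Q / of_real (r i j) + of_real (B / r i j) * (Q - 1)"
    using s pos by (simp add: Q_def field_simps)
  also have "cmod \<dots> \<le> (3/20 * B) * (27/25) / r i j + (B / r i j) * (2/25)"
  proof (rule norm_triangle_mono)
    show "cmod ((A - of_real B) * Q / of_real (r i j)) \<le> 3/20 * B * (27/25) / r i j"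
      unfolding norm_divide norm_mult norm_of_real using AB Q pos B
      by (simp only: abs_of_pos) (intro divide_right_mono mult_mono, auto)
    show "cmod (of_real (B / r i j) * (Q - 1)) \<le> B / r i j * (2/25)"
      unfolding norm_mult norm_of_real using Q1 pos B by (intro mult_mono) auto
  qed
  also have "\<dots> = 121/500 * (B / r i j)" by (simp add: field_simps)
  also have "\<dots> \<le> 1/4 * (B / r i j)" using B pos by (intro mult_right_mono) auto
  finally show ?thesis by (simp add: A_def B_def s_def)
qed

text \<open>Pair by pair: the velocity term contributes \<open>1/4\<close> of itself and \<open>11/100\<close> of the potential term, and
the potential term changes by at most \<open>1/4\<close> of itself; \<open>11/100 + 1/4 = 9/25\<close>.\<close>

lemma crad_perturbation:
  assumes z: "z \<in> D"
  shows "cmod (crad G m z - of_real (R\<^sup>2)) \<le> 9/25 * R\<^sup>2"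
proof -
  let ?P = "{(i::'n, j). i < j}"
  let ?A = "\<lambda>i j. sqT (velocities z $ i - velocities z $ j) / sqT (positions z $ i - positions z $ j)"
  let ?B = "\<lambda>i j. (K_coeff G m (positions z) i + K_coeff G m (positions z) j) / cdist (positions z) i j"
  let ?X = "\<Sum>(i,j)\<in>?P. (?A i j - of_real ((n i j)\<^sup>2 / (r i j)\<^sup>2)) + (?B i j - of_real ((K i + K j) / r i j))"
  have split: "crad G m z - of_real (R\<^sup>2) = ?X"
    unfolding crad_def s_radicand_def R_power2 rad_eq
    by (simp add: sum.distrib sum_subtractf case_prod_beta power_divide)
  have bound: "cmod ?X \<le> (\<Sum>(i,j)\<in>?P. 9/25 * ((n i j / r i j)\<^sup>2 + (K i + K j) / r i j))"
  proof (rule sum_norm_le)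
    fix p assume "p \<in> ?P"
    then obtain i j where p: "p = (i, j)" and "i < j" by auto
    then have ij: "i \<noteq> j" by simp
    define \<kappa> where "\<kappa> = (K i + K j) / r i j"
    have \<kappa>: "0 \<le> \<kappa>" "\<kappa> \<le> R\<^sup>2" using pair_potential_bounds[OF ij] by (simp_all add: \<kappa>_def)
    define \<delta> where "\<delta> = \<kappa> * r i j / (12 * R)"
    define u where "u = velocities z $ i - velocities z $ j"
    have \<delta>: "norm (u - cvec (v0 $ i - v0 $ j)) \<le> \<delta>"
      using velocity_diff[OF z ij] by (simp only: \<delta>_def \<kappa>_def u_def)
    have "cmod (sqT u - of_real ((n i j)\<^sup>2)) \<le> 2 * n i j * norm (u - cvec (v0 $ i - v0 $ j)) + (norm (u - cvec (v0 $ i - v0 $ j)))\<^sup>2"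
      using cmod_sqT_diff_le[of u "cvec (v0 $ i - v0 $ j)"] by (simp add: norm_cvec sqT_cvec n_def)
    also have "\<dots> \<le> 2 * n i j * \<delta> + \<delta>\<^sup>2"
      using \<delta> n_nonneg by (intro add_mono mult_left_mono power_mono) auto
    finally have S: "cmod (sqT u - of_real ((n i j)\<^sup>2)) \<le> 2 * n i j * \<delta> + \<delta>\<^sup>2" .
    have "cmod (?A i j - of_real ((n i j)\<^sup>2 / (r i j)\<^sup>2)) \<le> 1/4 * (n i j / r i j)\<^sup>2 + 11/100 * \<kappa>"
      unfolding u_def[symmetric]
      by (rule velocity_term_bound[OF r_pos[OF ij] R_pos n_nonneg \<kappa> \<delta>_def S sqT_nz[OF z ij] position_facts(3)[OF z ij]])
    moreover have "cmod (?B i j - of_real ((K i + K j) / r i j)) \<le> 1/4 * \<kappa>"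
      unfolding \<kappa>_def by (rule potential_term_bound[OF z ij])
    ultimately have "cmod ((?A i j - of_real ((n i j)\<^sup>2 / (r i j)\<^sup>2)) + (?B i j - of_real ((K i + K j) / r i j)))
        \<le> (1/4 * (n i j / r i j)\<^sup>2 + 11/100 * \<kappa>) + 1/4 * \<kappa>"
      by (rule norm_triangle_mono)
    also have "\<dots> \<le> 9/25 * ((n i j / r i j)\<^sup>2 + \<kappa>)"
    proof -
      have "1/4 * x + 11/100 * y + 1/4 * y \<le> 9/25 * (x + y)" if "0 \<le> x" for x y :: real
        using that by (simp add: algebra_simps)
      from this[OF zero_le_power2] show ?thesis .
    qed
    finally show "cmod (case p of (i, j) \<Rightarrow> (?A i j - of_real ((n i j)\<^sup>2 / (r i j)\<^sup>2)) + (?B i j - of_real ((K i + K j) / r i j)))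
        \<le> (case p of (i, j) \<Rightarrow> 9/25 * ((n i j / r i j)\<^sup>2 + (K i + K j) / r i j))"
      by (simp only: p prod.case \<kappa>_def)
  qed
  have "(\<Sum>(i,j)\<in>?P. 9/25 * ((n i j / r i j)\<^sup>2 + (K i + K j) / r i j)) =
      9/25 * (\<Sum>(i,j)\<in>?P. (n i j / r i j)\<^sup>2 + (K i + K j) / r i j)"
    unfolding sum_distrib_left by (rule sum.cong) auto
  moreover have "(\<Sum>(i,j)\<in>?P. (n i j / r i j)\<^sup>2 + (K i + K j) / r i j) = rad"
    unfolding rad_eq sum.distrib[symmetric] by (rule sum.cong) auto
  ultimately have "cmod ?X \<le> 9/25 * R\<^sup>2" using bound by (simp only: R_power2)
  then show ?thesis unfolding split .
qed

text \<open>As \<open>1 - 9/25 = (4/5)\<^sup>2\<close>, the modulus of the factor \<open>s\<close> grows by at most \<open>5/4\<close>.\<close>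

lemma crad_facts:
  assumes z: "z \<in> D"
  shows "16/25 * R\<^sup>2 \<le> Re (crad G m z)" "4/5 * R \<le> cmod (csqrt (crad G m z))"
    "cmod (1 / csqrt (crad G m z)) \<le> 5 / (4 * R)"
proof -
  have "\<bar>Re (crad G m z - of_real (R\<^sup>2))\<bar> \<le> 9/25 * R\<^sup>2"
    using crad_perturbation[OF z] abs_Re_le_cmod order_trans by blast
  then have "- (9/25 * R\<^sup>2) \<le> Re (crad G m z - of_real (R\<^sup>2))" by linarith
  then have "- (9/25 * R\<^sup>2) \<le> Re (crad G m z) - R\<^sup>2" by (simp only: minus_complex.sel Re_complex_of_real)
  then show re: "16/25 * R\<^sup>2 \<le> Re (crad G m z)" by linarith
  have "(4/5 * R)\<^sup>2 \<le> cmod (crad G m z)"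
    using re complex_Re_le_cmod[of "crad G m z"] by (simp add: power_mult_distrib power2_eq_square)
  then show *: "4/5 * R \<le> cmod (csqrt (crad G m z))"
    unfolding norm_csqrt by (rule real_le_rsqrt)
  have "cmod (1 / csqrt (crad G m z)) \<le> 1 / (4/5 * R)"
    unfolding norm_divide norm_one using * R_pos by (intro divide_left_mono mult_pos_pos) auto
  then show "cmod (1 / csqrt (crad G m z)) \<le> 5 / (4 * R)" using R_pos by (simp add: field_simps)
qed

text \<open>Each summand grows by at most \<open>(17/16) / (93/100) ^ 3 \<le> 4/3\<close>.\<close>

lemma norm_cacc_le:
  assumes z: "z \<in> D"
  shows "norm (cacc G m z i) \<le> 4/3 * K i"
proof -
  have "norm (cacc G m z i) \<le> (\<Sum>j\<in>UNIV - {i}. 4/3 * (G * m j / (r i j)\<^sup>2))"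
    unfolding cacc_def nbody_acc_def
  proof (rule sum_norm_le)
    fix j assume "j \<in> UNIV - {i}"
    then have ij: "i \<noteq> j" by auto
    note pos = r_pos[OF ij]
    have gm: "0 \<le> G * m j" using G_pos m_pos[of j] by simp
    have "norm ((of_real (G * m j) / cdist (positions z) i j ^ 3) *s (positions z $ j - positions z $ i)) =
        G * m j / cmod (cdist (positions z) i j) ^ 3 * norm (positions z $ i - positions z $ j)"
      unfolding norm_vector_scalar_mult norm_divide norm_power norm_of_real abs_of_nonneg[OF gm]
      by (simp only: norm_minus_commute)
    also have "\<dots> \<le> G * m j / (93/100 * r i j) ^ 3 * (17/16 * r i j)"
      using gm pos position_facts(4,6)[OF z ij]
      by (intro mult_mono divide_left_mono power_mono mult_pos_pos zero_less_power divide_nonneg_nonneg zero_le_power) auto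
    also have "\<dots> = (17/16) / (93/100) ^ 3 * (G * m j / (r i j)\<^sup>2)"
      using pos by (simp add: field_simps power2_eq_square power3_eq_cube)
    also have "\<dots> \<le> 4/3 * (G * m j / (r i j)\<^sup>2)"
      using gm by (intro mult_right_mono) (auto simp: power3_eq_cube)
    finally show "norm ((of_real (G * m j) / cdist (positions z) i j ^ 3) *s (positions z $ j - positions z $ i))
        \<le> 4/3 * (G * m j / (r i j)\<^sup>2)" .
  qed
  then show ?thesis by (simp add: K_eq sum_distrib_left)
qed

end

section \<open>Local solutions and their uniqueness\<close>

lemma regular_components_lipschitz:
  fixes F :: "('i::finite \<Rightarrow> complex) \<Rightarrow> 'i \<Rightarrow> complex"
  assumes "\<And>a. regular_on D (\<lambda>z. F z a)"
  obtains L where "0 \<le> L" "lipschitz_field D F L"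
proof -
  obtain l where l: "\<And>a. 0 \<le> l a" "\<And>a. lipschitz_field D (\<lambda>z _. F z a) (l a)"
    using regular_on_lipschitz[OF assms] by metis
  have le: "l a \<le> (\<Sum>a\<in>UNIV. l a)" for a using l(1) by (intro member_le_sum) auto
  have "lipschitz_field D F (\<Sum>a\<in>UNIV. l a)"
    unfolding lipschitz_field_def
  proof (intro ballI allI impI)
    fix z w d a assume zw: "z \<in> D" "w \<in> D" and d: "\<forall>j. cmod (z j - w j) \<le> d"
    have "0 \<le> d" using d order_trans[OF norm_ge_zero] by blast
    then have "l a * d \<le> (\<Sum>a\<in>UNIV. l a) * d" using le by (intro mult_right_mono)
    moreover have "cmod (F z a - F w a) \<le> l a * d" using lipschitz_fieldD[OF l(2) zw] d by blast
    ultimately show "cmod (F z a - F w a) \<le> (\<Sum>a\<in>UNIV. l a) * d" by linarith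
  qed
  then show thesis using l(1) by (intro that[of "\<Sum>a\<in>UNIV. l a"] sum_nonneg)
qed

lemma regular_components_bounded:
  fixes F :: "('i::finite \<Rightarrow> complex) \<Rightarrow> 'i \<Rightarrow> complex"
  assumes "\<And>a. regular_on D (\<lambda>z. F z a)"
  obtains M where "\<And>z a. z \<in> D \<Longrightarrow> cmod (F z a) \<le> M"
proof -
  obtain b where b: "\<And>a. 0 \<le> b a" "\<And>a z. z \<in> D \<Longrightarrow> cmod (F z a) \<le> b a"
    using regular_on_bounded[OF assms] by metis
  have "b a \<le> (\<Sum>a\<in>UNIV. b a)" for a using b(1) by (intro member_le_sum) auto
  then show thesis using b(2) order_trans by (intro that[of "\<Sum>a\<in>UNIV. b a"]) blast
qed

lemma positions_real_state: "positions (real_state q v) $ i = cvec (q $ i)"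
  by (simp add: vec_eq_iff cvec_def real_state_def)

lemma velocities_real_state: "velocities (real_state q v) $ i = cvec (v $ i)"
  by (simp add: vec_eq_iff cvec_def real_state_def)

context noncollision_state
begin

lemma initial_in_D: "real_state q0 v0 \<in> D"
  using r_pos K_pos R_pos
  by (auto simp: D_def positions_real_state velocities_real_state cvec_diff less_imp_le)

lemma tendsto_positions_velocities:
  assumes "\<And>a. ((\<lambda>x. f x a) \<longlongrightarrow> z a) F"
  shows "((\<lambda>x. norm (positions (f x) $ i - positions (f x) $ j - b)) \<longlongrightarrow> norm (positions z $ i - positions z $ j - b)) F"
    and "((\<lambda>x. norm (velocities (f x) $ i - b)) \<longlongrightarrow> norm (velocities z $ i - b)) F"
proof -
  have "((\<lambda>x. positions (f x) $ i) \<longlongrightarrow> positions z $ i) F" "((\<lambda>x. velocities (f x) $ i) \<longlongrightarrow> velocities z $ i) F" for i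
    using assms by (auto intro: vec_tendstoI)
  then show "((\<lambda>x. norm (positions (f x) $ i - positions (f x) $ j - b)) \<longlongrightarrow> norm (positions z $ i - positions z $ j - b)) F"
    and "((\<lambda>x. norm (velocities (f x) $ i - b)) \<longlongrightarrow> norm (velocities z $ i - b)) F"
    by (auto intro!: tendsto_norm tendsto_diff tendsto_const)
qed

lemma D_closed:
  assumes "\<And>n::nat. f n \<in> D" "\<And>a. (\<lambda>n. f n a) \<longlonglongrightarrow> z a"
  shows "z \<in> D"
  unfolding D_def mem_Collect_eq
proof (intro conjI allI impI)
  fix i j :: 'n assume "i \<noteq> j"
  then show "norm (positions z $ i - positions z $ j - cvec (q0 $ i - q0 $ j)) \<le> r i j / 16"
    using assms(1) by (intro LIMSEQ_le_const2[OF tendsto_positions_velocities(1)[OF assms(2)]]) (auto simp: D_def)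
next
  fix i :: 'n
  show "norm (velocities z $ i - cvec (v0 $ i)) \<le> K i / (12 * R)"
    using assms(1) by (intro LIMSEQ_le_const2[OF tendsto_positions_velocities(2)[OF assms(2)]]) (auto simp: D_def)
qed

text \<open>\<open>D\<close> is a neighbourhood of the real state because every \<open>K i\<close> is positive, which needs a second body.
The filter form serves complex and real time alike.\<close>

lemma eventually_in_D:
  assumes "\<And>a. ((\<lambda>x. f x a) \<longlongrightarrow> real_state q0 v0 a) F"
  shows "\<forall>\<^sub>F x in F. f x \<in> D"
proof -
  have *: "\<forall>\<^sub>F x in F. norm (positions (f x) $ i - positions (f x) $ j - cvec (q0 $ i - q0 $ j)) < r i j / 16" if "i \<noteq> j" for i j
    using r_pos[OF that]
    by (intro order_tendstoD(2)[OF tendsto_positions_velocities(1)[OF assms]]) (simp add: positions_real_state cvec_diff)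
  have 1: "\<forall>\<^sub>F x in F. i \<noteq> j \<longrightarrow> norm (positions (f x) $ i - positions (f x) $ j - cvec (q0 $ i - q0 $ j)) \<le> r i j / 16" for i j
  proof (cases "i = j")
    case False
    show ?thesis by (rule eventually_mono[OF *[OF False]]) simp
  qed simp
  have *: "\<forall>\<^sub>F x in F. norm (velocities (f x) $ i - cvec (v0 $ i)) < K i / (12 * R)" for i
    using K_pos R_pos
    by (intro order_tendstoD(2)[OF tendsto_positions_velocities(2)[OF assms]]) (simp add: velocities_real_state)
  have 2: "\<forall>\<^sub>F x in F. norm (velocities (f x) $ i - cvec (v0 $ i)) \<le> K i / (12 * R)" for i
    by (rule eventually_mono[OF *[of i]]) simp
  have "\<forall>\<^sub>F x in F. \<forall>i j. i \<noteq> j \<longrightarrow> norm (positions (f x) $ i - positions (f x) $ j - cvec (q0 $ i - q0 $ j)) \<le> r i j / 16"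
    by (intro eventually_all_finite 1)
  moreover have "\<forall>\<^sub>F x in F. \<forall>i. norm (velocities (f x) $ i - cvec (v0 $ i)) \<le> K i / (12 * R)"
    by (intro eventually_all_finite 2)
  ultimately show ?thesis by eventually_elim (simp add: D_def)
qed

lemma regular_position_diff: "regular_on D (\<lambda>z. z (True, i, k) - z (True, j, k))"
proof (cases "i = j")
  case True
  then show ?thesis using regular_on_const[of D 0] by simp
next
  case False
  show ?thesis
  proof (rule regular_on_coordinate_diff)
    fix z assume z: "z \<in> D"
    show "cmod (z (True, i, k) - z (True, j, k)) \<le> 17/16 * r i j"
      using Finite_Cartesian_Product.norm_nth_le[of "positions z $ i - positions z $ j" k] position_facts(6)[OF z False] by simp
  qed (use r_pos[OF False] in simp)
qed

lemma regular_velocity: "regular_on D (\<lambda>z. z (False, i, k))"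
proof (rule regular_on_coordinate)
  fix z assume z: "z \<in> D"
  have "cmod (z (False, i, k)) \<le> norm (velocities z $ i)"
    using Finite_Cartesian_Product.norm_nth_le[of "velocities z $ i" k] by simp
  also have "\<dots> \<le> norm (cvec (v0 $ i)) + norm (velocities z $ i - cvec (v0 $ i))"
    using norm_triangle_ineq[of "cvec (v0 $ i)" "velocities z $ i - cvec (v0 $ i)"] by simp
  also have "\<dots> \<le> norm (cvec (v0 $ i)) + K i / (12 * R)" using z by (simp add: D_def)
  finally show "cmod (z (False, i, k)) \<le> norm (cvec (v0 $ i)) + K i / (12 * R)" .
qed (use K_pos R_pos in \<open>simp add: less_imp_le\<close>)

lemma regular_velocity_diff: "regular_on D (\<lambda>z. z (False, i, k) - z (False, j, k))"
  using regular_on_add[OF regular_velocity[of i k] regular_on_mult[OF regular_on_const[of D "-1"] regular_velocity[of j k]]]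
  by simp

lemma regular_sqT_position: "regular_on D (\<lambda>z. sqT (positions z $ i - positions z $ j))"
  unfolding sqT_def by (simp add: regular_on_sum regular_on_power regular_position_diff)

lemma regular_sqT_velocity: "regular_on D (\<lambda>z. sqT (velocities z $ i - velocities z $ j))"
  unfolding sqT_def by (simp add: regular_on_sum regular_on_power regular_velocity_diff)

lemma regular_cdist: "i \<noteq> j \<Longrightarrow> regular_on D (\<lambda>z. cdist (positions z) i j)"
  unfolding cdist_def using position_facts(1) r_pos[of i j]
  by (intro regular_on_csqrt[where c = "223/256 * (r i j)\<^sup>2"] regular_sqT_position) simp_all

lemma regular_divide_sqT:
  "regular_on D f \<Longrightarrow> i \<noteq> j \<Longrightarrow> regular_on D (\<lambda>z. f z / sqT (positions z $ i - positions z $ j))"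
  using position_facts(2) r_pos[of i j]
  by (intro regular_on_divide[where c = "223/256 * (r i j)\<^sup>2"] regular_sqT_position) simp_all

lemma regular_divide_cdist:
  "regular_on D f \<Longrightarrow> i \<noteq> j \<Longrightarrow> regular_on D (\<lambda>z. f z / cdist (positions z) i j)"
  using position_facts(4) r_pos[of i j]
  by (intro regular_on_divide[where c = "93/100 * r i j"] regular_cdist) simp_all

lemma regular_K: "regular_on D (\<lambda>z. K_coeff G m (positions z) i)"
  unfolding K_coeff_def by (intro regular_on_sum regular_divide_sqT regular_on_const) auto

lemma regular_crad: "regular_on D (crad G m)"
proof -
  have "regular_on D (\<lambda>z. (\<Sum>p\<in>{(i,j). i < j}. sqT (velocities z $ fst p - velocities z $ snd p) / sqT (positions z $ fst p - positions z $ snd p)) +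
     (\<Sum>p\<in>{(i,j). i < j}. (K_coeff G m (positions z) (fst p) + K_coeff G m (positions z) (snd p)) / cdist (positions z) (fst p) (snd p)))"
    by (intro regular_on_add regular_on_sum regular_divide_sqT regular_divide_cdist regular_sqT_velocity regular_K) auto
  then show ?thesis
    unfolding crad_def s_radicand_def case_prod_beta by simp
qed

lemma regular_cacc: "regular_on D (\<lambda>z. cacc G m z i $ k)"
proof -
  have "regular_on D (\<lambda>z. (\<Sum>j\<in>UNIV - {i}. of_real (G * m j) / cdist (positions z) i j ^ 3 * (z (True, j, k) - z (True, i, k))))"
  proof (intro regular_on_sum regular_on_mult regular_position_diff)
    fix j assume "j \<in> UNIV - {i}"
    then have ij: "i \<noteq> j" by auto
    have "regular_on D (\<lambda>z. of_real (G * m j) / cdist (positions z) i j / cdist (positions z) i j / cdist (positions z) i j)"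
      by (intro regular_divide_cdist regular_on_const ij)
    then show "regular_on D (\<lambda>z. of_real (G * m j) / cdist (positions z) i j ^ 3)"
      by (simp add: power3_eq_cube)
  qed
  moreover have "cacc G m z i $ k =
      (\<Sum>j\<in>UNIV - {i}. of_real (G * m j) / cdist (positions z) i j ^ 3 * (z (True, j, k) - z (True, i, k)))" for z
    unfolding cacc_def nbody_acc_def sum_component vector_smult_component vector_minus_component positions_nth ..
  ultimately show ?thesis by (simp only:)
qed

lemma regular_field: "regular_on D (\<lambda>z. field G m z a)"
proof -
  obtain b i k where a: "a = (b, i, k)" by (cases a)
  have "regular_on D (\<lambda>z. of_real 1 / csqrt (crad G m z))"
    using crad_facts(1,2) R_pos
    by (intro regular_on_divide[where c = "4/5 * R"] regular_on_const regular_on_csqrt[where c = "16/25 * R\<^sup>2"] regular_crad) auto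
  then have "regular_on D (\<lambda>z. 1 / csqrt (crad G m z) * (if b then velocities z $ i $ k else cacc G m z i $ k))"
    by (intro regular_on_mult) (cases b; simp add: regular_velocity regular_cacc)+
  then show ?thesis by (simp add: field_def a)
qed

lemma field_lipschitz:
  obtains L where "0 \<le> L" "lipschitz_field D (field G m) L"
  using regular_components_lipschitz regular_field by blast

lemma norm_displacement_le:
  fixes h :: "real \<Rightarrow> complex ^ 3"
  assumes "\<And>t. t \<in> {0..1} \<Longrightarrow> (h has_vector_derivative h' t) (at t within {0..1})"
    and "\<And>t. t \<in> {0..1} \<Longrightarrow> norm (h' t) \<le> C"
  shows "norm (h 1 - h 0) \<le> C"
  using vector_growth_bound[of h h' C 0 1] assms by simp

text \<open>The bootstrap that determines the radius: \<open>1/20 * 5/4 = 1/16\<close> for the positions and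
\<open>1/20 * 5/4 * 4/3 = 1/12\<close> for the velocities.\<close>

lemma D_invariant:
  assumes \<gamma>: "\<And>\<tau>. \<tau> \<in> ball 0 (1/20) \<Longrightarrow> \<gamma> \<tau> \<in> D"
    and init: "\<Gamma> 0 = real_state q0 v0"
    and der: "\<And>\<tau> a. \<tau> \<in> ball 0 (1/20) \<Longrightarrow> ((\<lambda>\<tau>. \<Gamma> \<tau> a) has_field_derivative field G m (\<gamma> \<tau>) a) (at \<tau>)"
    and \<tau>: "\<tau> \<in> ball 0 (1/20)"
  shows "\<Gamma> \<tau> \<in> D"
proof -
  define p where "p = (\<lambda>t. 0 + of_real t * \<tau>)"
  have p: "p t \<in> ball 0 (1/20)" if "t \<in> {0..1}" for t
    unfolding p_def by (rule ray_in_ball[OF \<tau> that])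
  have p01: "p 0 = 0" "p 1 = \<tau>" by (simp_all add: p_def)
  define \<sigma> where "\<sigma> = (\<lambda>t. 1 / csqrt (crad G m (\<gamma> (p t))))"
  have \<sigma>: "cmod (\<tau> * \<sigma> t) \<le> 1 / (16 * R)" if "t \<in> {0..1}" for t
  proof -
    have "cmod \<tau> * cmod (\<sigma> t) \<le> (1/20) * (5 / (4 * R))"
      using \<tau> crad_facts(3)[OF \<gamma>[OF p[OF that]]] unfolding \<sigma>_def by (intro mult_mono) auto
    then show ?thesis by (simp add: norm_mult)
  qed
  have d: "((\<lambda>t. \<Gamma> (p t) a) has_vector_derivative \<tau> * field G m (\<gamma> (p t)) a) (at t within {0..1})"
    if "t \<in> {0..1}" for t a
    unfolding p_def using der[OF p[OF that], of a]
    by (intro has_vector_derivative_along_ray) (simp add: p_def)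
  show ?thesis
    unfolding D_def mem_Collect_eq
  proof (intro conjI allI impI)
    fix i j :: 'n assume ij: "i \<noteq> j"
    have "norm ((positions (\<Gamma> (p 1)) $ i - positions (\<Gamma> (p 1)) $ j) - (positions (\<Gamma> (p 0)) $ i - positions (\<Gamma> (p 0)) $ j)) \<le> r i j / 16"
    proof (rule norm_displacement_le)
      fix t :: real assume t: "t \<in> {0..1}"
      show "((\<lambda>t. positions (\<Gamma> (p t)) $ i - positions (\<Gamma> (p t)) $ j) has_vector_derivative
          (\<tau> * \<sigma> t) *s (velocities (\<gamma> (p t)) $ i - velocities (\<gamma> (p t)) $ j)) (at t within {0..1})"
      proof (rule has_vector_derivative_vec)
        fix k
        show "((\<lambda>t. (positions (\<Gamma> (p t)) $ i - positions (\<Gamma> (p t)) $ j) $ k) has_vector_derivative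
            ((\<tau> * \<sigma> t) *s (velocities (\<gamma> (p t)) $ i - velocities (\<gamma> (p t)) $ j)) $ k) (at t within {0..1})"
          using has_vector_derivative_diff[OF d[OF t, of "(True, i, k)"] d[OF t, of "(True, j, k)"]]
          by (simp add: field_def \<sigma>_def algebra_simps)
      qed
      have "norm ((\<tau> * \<sigma> t) *s (velocities (\<gamma> (p t)) $ i - velocities (\<gamma> (p t)) $ j)) \<le> 1 / (16 * R) * (r i j * R)"
        unfolding norm_vector_scalar_mult
        using \<sigma>[OF t] norm_velocity_le[OF \<gamma>[OF p[OF t]] ij] R_pos by (intro mult_mono) auto
      then show "norm ((\<tau> * \<sigma> t) *s (velocities (\<gamma> (p t)) $ i - velocities (\<gamma> (p t)) $ j)) \<le> r i j / 16"
        using R_pos by simp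
    qed
    then show "norm (positions (\<Gamma> \<tau>) $ i - positions (\<Gamma> \<tau>) $ j - cvec (q0 $ i - q0 $ j)) \<le> r i j / 16"
      by (simp add: p01 init positions_real_state cvec_diff)
  next
    fix i
    have "norm (velocities (\<Gamma> (p 1)) $ i - velocities (\<Gamma> (p 0)) $ i) \<le> K i / (12 * R)"
    proof (rule norm_displacement_le)
      fix t :: real assume t: "t \<in> {0..1}"
      show "((\<lambda>t. velocities (\<Gamma> (p t)) $ i) has_vector_derivative (\<tau> * \<sigma> t) *s cacc G m (\<gamma> (p t)) i) (at t within {0..1})"
      proof (rule has_vector_derivative_vec)
        fix k
        show "((\<lambda>t. velocities (\<Gamma> (p t)) $ i $ k) has_vector_derivative
            ((\<tau> * \<sigma> t) *s cacc G m (\<gamma> (p t)) i) $ k) (at t within {0..1})"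
          using d[OF t, of "(False, i, k)"] by (simp add: field_def \<sigma>_def)
      qed
      have "norm ((\<tau> * \<sigma> t) *s cacc G m (\<gamma> (p t)) i) \<le> 1 / (16 * R) * (4/3 * K i)"
        unfolding norm_vector_scalar_mult
        using \<sigma>[OF t] norm_cacc_le[OF \<gamma>[OF p[OF t]]] R_pos by (intro mult_mono) auto
      then show "norm ((\<tau> * \<sigma> t) *s cacc G m (\<gamma> (p t)) i) \<le> K i / (12 * R)"
        by simp
    qed
    then show "norm (velocities (\<Gamma> \<tau>) $ i - cvec (v0 $ i)) \<le> K i / (12 * R)"
      by (simp add: p01 init velocities_real_state)
  qed
qed

theorem local_solution:
  obtains W where "W 0 = real_state q0 v0" "\<And>\<tau>. \<tau> \<in> ball 0 (1/20) \<Longrightarrow> W \<tau> \<in> D"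
    "\<And>\<tau> a. \<tau> \<in> ball 0 (1/20) \<Longrightarrow> ((\<lambda>\<tau>. W \<tau> a) has_field_derivative field G m (W \<tau>) a) (at \<tau>)"
    "\<And>t a. complex_of_real t \<in> ball 0 (1/20) \<Longrightarrow> W (of_real t) a \<in> \<real>"
proof -
  obtain L where L: "0 \<le> L" "lipschitz_field D (field G m) L" by (rule field_lipschitz)
  obtain M where M: "\<And>z a. z \<in> D \<Longrightarrow> cmod (field G m z a) \<le> M"
    using regular_components_bounded regular_field by blast
  show thesis
  proof (rule picard_holomorphic[of "1/20" "real_state q0 v0" D "field G m" L M])
    show "real_state q0 v0 a \<in> \<real>" for a by (auto simp: real_state_def split: prod.splits)
    show "(\<lambda>\<tau>. field G m (\<gamma> \<tau>) a) holomorphic_on ball 0 (1/20)"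
      if "\<And>\<tau>. \<tau> \<in> ball 0 (1/20) \<Longrightarrow> \<gamma> \<tau> \<in> D" "\<And>a. (\<lambda>\<tau>. \<gamma> \<tau> a) holomorphic_on ball 0 (1/20)" for \<gamma> a
      by (rule regular_on_holomorphic[OF regular_field]) (use that in auto)
    show "field G m z a \<in> \<real>" if "z \<in> D" "\<And>a. z a \<in> \<real>" for z a
      by (rule regular_on_real[OF regular_field that])
    show "\<Gamma> \<tau> \<in> D"
      if "\<And>\<tau>. \<tau> \<in> ball 0 (1/20) \<Longrightarrow> \<gamma> \<tau> \<in> D" "\<Gamma> 0 = real_state q0 v0"
        "\<And>\<tau> a. \<tau> \<in> ball 0 (1/20) \<Longrightarrow> ((\<lambda>\<tau>. \<Gamma> \<tau> a) has_field_derivative field G m (\<gamma> \<tau>) a) (at \<tau>)"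
        "\<tau> \<in> ball 0 (1/20)" for \<gamma> \<Gamma> \<tau>
      using that by (rule D_invariant)
    show "z \<in> D" if "\<And>n::nat. f n \<in> D" "\<And>a. (\<lambda>n. f n a) \<longlonglongrightarrow> z a" for f z
      using that by (rule D_closed)
  qed (use initial_in_D L M that in auto)
qed

text \<open>On a small disc both solutions lie in \<open>D\<close>, and the Lipschitz estimate is applied on each ray.\<close>

lemma local_unique:
  assumes S: "open S" "t0 \<in> S"
    and W: "\<And>\<tau> a. \<tau> \<in> S \<Longrightarrow> ((\<lambda>\<tau>. W \<tau> a) has_field_derivative field G m (W \<tau>) a) (at \<tau>)"
    and W': "\<And>\<tau> a. \<tau> \<in> S \<Longrightarrow> ((\<lambda>\<tau>. W' \<tau> a) has_field_derivative field G m (W' \<tau>) a) (at \<tau>)"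
    and init: "W t0 = real_state q0 v0" "W' t0 = real_state q0 v0"
  obtains e where "0 < e" "ball t0 e \<subseteq> S" "\<And>\<tau>. \<tau> \<in> ball t0 e \<Longrightarrow> W \<tau> = W' \<tau>"
proof -
  obtain L where L: "0 \<le> L" "lipschitz_field D (field G m) L" by (rule field_lipschitz)
  have ev: "\<forall>\<^sub>F \<tau> in nhds t0. U \<tau> \<in> D"
    if U: "\<And>\<tau> a. \<tau> \<in> S \<Longrightarrow> ((\<lambda>\<tau>. U \<tau> a) has_field_derivative field G m (U \<tau>) a) (at \<tau>)"
      and "U t0 = real_state q0 v0" for U
  proof (rule eventually_in_D)
    fix a
    have "isCont (\<lambda>\<tau>. U \<tau> a) t0" by (rule DERIV_isCont[OF U[OF S(2)]])
    then show "((\<lambda>\<tau>. U \<tau> a) \<longlongrightarrow> real_state q0 v0 a) (nhds t0)"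
      using \<open>U t0 = real_state q0 v0\<close> tendsto_at_iff_tendsto_nhds[of "\<lambda>\<tau>. U \<tau> a" t0]
      by (simp add: isCont_def)
  qed
  have "\<forall>\<^sub>F \<tau> in nhds t0. W \<tau> \<in> D \<and> W' \<tau> \<in> D \<and> \<tau> \<in> S"
    using ev[of W] ev[of W'] W W' init eventually_nhds_in_open[OF S] by (simp add: eventually_conj_iff)
  then obtain e where e: "0 < e" "\<And>\<tau>. dist \<tau> t0 < e \<Longrightarrow> W \<tau> \<in> D \<and> W' \<tau> \<in> D \<and> \<tau> \<in> S"
    unfolding eventually_nhds_metric by blast
  show thesis
  proof (rule that[OF e(1)])
    show "ball t0 e \<subseteq> S" using e(2) by (auto simp: dist_commute)
    fix \<tau> assume \<tau>: "\<tau> \<in> ball t0 e"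
    have ray: "dist (t0 + of_real t * (\<tau> - t0)) t0 < e" if "t \<in> {0..1}" for t
      using ray_in_ball[of "\<tau> - t0" e t] \<tau> that by (simp add: dist_norm norm_minus_commute)
    have "W (t0 + of_real 1 * (\<tau> - t0)) = W' (t0 + of_real 1 * (\<tau> - t0))"
    proof (rule lipschitz_ivp_unique[OF L(2,1), where x = "\<lambda>t. W (t0 + of_real t * (\<tau> - t0))" and y = "\<lambda>t. W' (t0 + of_real t * (\<tau> - t0))"
          and k = "\<lambda>_. \<tau> - t0" and C = "cmod (\<tau> - t0)"])
      fix t :: real assume t: "t \<in> {0..1}"
      note * = e(2)[OF ray[OF t]]
      show "W (t0 + of_real t * (\<tau> - t0)) \<in> D" "W' (t0 + of_real t * (\<tau> - t0)) \<in> D" using * by auto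
      show "((\<lambda>t. W (t0 + of_real t * (\<tau> - t0)) a) has_vector_derivative (\<tau> - t0) * field G m (W (t0 + of_real t * (\<tau> - t0))) a) (at t within {0..1})"
        "((\<lambda>t. W' (t0 + of_real t * (\<tau> - t0)) a) has_vector_derivative (\<tau> - t0) * field G m (W' (t0 + of_real t * (\<tau> - t0))) a) (at t within {0..1})" for a
        using * by (auto intro!: has_vector_derivative_along_ray W W')
    qed (use init in auto)
    then show "W \<tau> = W' \<tau>" by simp
  qed
qed

end

section \<open>Continuation to a strip\<close>

text \<open>The states at which all principal square roots in the vector field are holomorphic. Membership
persists along the strip, so no other branch is ever met.\<close>

definition admissible :: "real \<Rightarrow> ('n::{finite,linorder} \<Rightarrow> real) \<Rightarrow> (bool \<times> 'n \<times> 3 \<Rightarrow> complex) \<Rightarrow> bool" where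
  "admissible G m z \<longleftrightarrow>
     (\<forall>i j. i \<noteq> j \<longrightarrow> 0 < Re (sqT (positions z $ i - positions z $ j))) \<and> 0 < Re (crad G m z)"

definition solution_on ::
  "real \<Rightarrow> ('n::{finite,linorder} \<Rightarrow> real) \<Rightarrow> complex set \<Rightarrow> (complex \<Rightarrow> bool \<times> 'n \<times> 3 \<Rightarrow> complex) \<Rightarrow> bool" where
  "solution_on G m S W \<longleftrightarrow>
     (\<forall>\<tau>\<in>S. admissible G m (W \<tau>) \<and>
        (\<forall>a. ((\<lambda>\<tau>. W \<tau> a) has_field_derivative field G m (W \<tau>) a) (at \<tau>))) \<and>
     (\<forall>t a. complex_of_real t \<in> S \<longrightarrow> W (of_real t) a \<in> \<real>)"

lemma solution_onD:
  assumes "solution_on G m S W"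
  shows "\<tau> \<in> S \<Longrightarrow> admissible G m (W \<tau>)"
    and "\<tau> \<in> S \<Longrightarrow> ((\<lambda>\<tau>. W \<tau> a) has_field_derivative field G m (W \<tau>) a) (at \<tau>)"
    and "complex_of_real t \<in> S \<Longrightarrow> W (of_real t) a \<in> \<real>"
  using assms unfolding solution_on_def by blast+

lemma (in noncollision_state) D_admissible: "z \<in> D \<Longrightarrow> admissible G m z"
  unfolding admissible_def
proof (intro conjI allI impI)
  assume z: "z \<in> D"
  have "0 < 16/25 * R\<^sup>2" using R_pos by simp
  then show "0 < Re (crad G m z)" using crad_facts(1)[OF z] by linarith
  fix i j :: 'n assume ij: "i \<noteq> j"
  have "0 < 223/256 * (r i j)\<^sup>2" using r_pos[OF ij] by simp
  then show "0 < Re (sqT (positions z $ i - positions z $ j))" using position_facts(1)[OF z ij] by linarith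
qed

lemma admissible_real_state:
  assumes "admissible G m z" "\<And>a. z a \<in> \<real>"
  obtains q v where "z = real_state q v" "q \<notin> collision_set"
proof -
  define q v where "q = (\<chi> i k. Re (z (True, i, k)))" and "v = (\<chi> i k. Re (z (False, i, k)))"
  have "z a = real_state q v a" for a
    using assms(2)[of a] by (cases a) (auto simp: real_state_def q_def v_def)
  then have z: "z = real_state q v" by blast
  have "q \<notin> collision_set"
  proof
    assume "q \<in> collision_set"
    then obtain i j where ij: "i \<noteq> j" "q $ i = q $ j" by (auto simp: collision_set_def)
    then have "sqT (positions z $ i - positions z $ j) = 0" by (simp add: z positions_real_state sqT_def)
    then show False using assms(1) ij unfolding admissible_def by (metis less_irrefl zero_complex.sel(1))
  qed
  then show thesis using that z by blast
qed

lemma solution_on_subset: "solution_on G m S W \<Longrightarrow> T \<subseteq> S \<Longrightarrow> solution_on G m T W"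
  unfolding solution_on_def by blast

lemma solution_on_Un: "solution_on G m S W \<Longrightarrow> solution_on G m T W \<Longrightarrow> solution_on G m (S \<union> T) W"
  unfolding solution_on_def by blast

lemma solution_on_cong:
  assumes "solution_on G m S W" "open S" "\<And>\<tau>. \<tau> \<in> S \<Longrightarrow> W' \<tau> = W \<tau>"
  shows "solution_on G m S W'"
  unfolding solution_on_def
proof (intro conjI ballI allI impI)
  fix \<tau> a assume \<tau>: "\<tau> \<in> S"
  show "admissible G m (W' \<tau>)" using solution_onD(1)[OF assms(1) \<tau>] assms(3)[OF \<tau>] by simp
  have "((\<lambda>\<tau>. W \<tau> a) has_field_derivative field G m (W' \<tau>) a) (at \<tau>)"
    using solution_onD(2)[OF assms(1) \<tau>] assms(3)[OF \<tau>] by simp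
  then show "((\<lambda>\<tau>. W' \<tau> a) has_field_derivative field G m (W' \<tau>) a) (at \<tau>)"
    by (rule has_field_derivative_transform_within_open[OF _ assms(2) \<tau>]) (simp add: assms(3))
next
  fix t a assume "complex_of_real t \<in> S"
  then show "W' (of_real t) a \<in> \<real>" using solution_onD(3)[OF assms(1)] assms(3) by simp
qed

text \<open>\<open>9/200\<close> lies between \<open>0.0444443\<close> and the radius \<open>1/20\<close>; a rectangle of half-width \<open>1/50\<close> and half-height
\<open>9/200\<close> still fits into the disc, since \<open>(1/50)\<^sup>2 + (9/200)\<^sup>2 < (1/20)\<^sup>2\<close>.\<close>

definition slab :: "real \<Rightarrow> real \<Rightarrow> complex set" where
  "slab a b = {\<tau>. a < Re \<tau> \<and> Re \<tau> < b \<and> \<bar>Im \<tau>\<bar> < 9/200}"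

lemma open_slab: "open (slab a b)"
  unfolding slab_def by (intro open_Collect_conj open_Collect_less continuous_intros)

lemma convex_slab: "convex (slab a b)"
proof -
  have "slab a b = {\<tau>. a < Re \<tau>} \<inter> {\<tau>. Re \<tau> < b} \<inter> {\<tau>. - (9/200) < Im \<tau>} \<inter> {\<tau>. Im \<tau> < 9/200}"
    by (auto simp: slab_def)
  then show ?thesis
    by (simp only:) (intro convex_Int convex_halfspace_Re_gt convex_halfspace_Re_lt convex_halfspace_Im_gt convex_halfspace_Im_lt)
qed

lemma slab_subset_ball: "slab (x - 1/50) (x + 1/50) \<subseteq> ball (of_real x) (1/20)"
proof
  fix \<tau> assume \<tau>: "\<tau> \<in> slab (x - 1/50) (x + 1/50)"
  have "(Re \<tau> - x)\<^sup>2 \<le> (1/50)\<^sup>2" "(Im \<tau>)\<^sup>2 \<le> (9/200)\<^sup>2"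
    unfolding abs_le_square_iff[symmetric] using \<tau> unfolding slab_def mem_Collect_eq by linarith+
  then have "(Re \<tau> - x)\<^sup>2 + (Im \<tau>)\<^sup>2 < (1/20)\<^sup>2" by (simp add: power2_eq_square)
  then have "sqrt ((Re \<tau> - x)\<^sup>2 + (Im \<tau>)\<^sup>2) < sqrt ((1/20)\<^sup>2)" by (rule real_sqrt_less_mono)
  then show "\<tau> \<in> ball (of_real x) (1/20)"
    by (simp add: dist_norm cmod_def power2_commute[of x])
qed

definition open_strip :: "complex set" where
  "open_strip = {\<tau>. \<bar>Im \<tau>\<bar> < 9/200}"

locale masses =
  fixes G :: real and m :: "'n::{finite,linorder} \<Rightarrow> real"
  assumes two_bodies: "CARD('n) \<ge> 2" and G_pos: "G > 0" and m_pos: "\<And>i. m i > 0"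
begin

lemma noncollision_stateI: "q \<notin> collision_set \<Longrightarrow> noncollision_state G m q"
  using two_bodies G_pos m_pos by unfold_locales

lemma ex_local_solution:
  assumes "q \<notin> collision_set"
  obtains W where "solution_on G m (ball (of_real x) (1/20)) W" "W (of_real x) = real_state q v"
proof -
  interpret noncollision_state G m q v by (rule noncollision_stateI[OF assms])
  obtain W where W: "W 0 = real_state q v" "\<And>\<tau>. \<tau> \<in> ball 0 (1/20) \<Longrightarrow> W \<tau> \<in> D"
    "\<And>\<tau> a. \<tau> \<in> ball 0 (1/20) \<Longrightarrow> ((\<lambda>\<tau>. W \<tau> a) has_field_derivative field G m (W \<tau>) a) (at \<tau>)"
    "\<And>t a. complex_of_real t \<in> ball 0 (1/20) \<Longrightarrow> W (of_real t) a \<in> \<real>"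
    using local_solution by blast
  have shift: "\<tau> + - of_real x \<in> ball 0 (1/20)" if "\<tau> \<in> ball (complex_of_real x) (1/20)" for \<tau>
    using that by (simp add: dist_norm norm_minus_commute[of "of_real x"])
  have "solution_on G m (ball (of_real x) (1/20)) (\<lambda>\<tau>. W (\<tau> + - of_real x))"
    unfolding solution_on_def
  proof (intro conjI ballI allI impI)
    fix \<tau> a assume \<tau>: "\<tau> \<in> ball (complex_of_real x) (1/20)"
    show "admissible G m (W (\<tau> + - of_real x))" using D_admissible W(2) shift[OF \<tau>] by blast
    show "((\<lambda>\<tau>. W (\<tau> + - of_real x) a) has_field_derivative field G m (W (\<tau> + - of_real x)) a) (at \<tau>)"
      using W(3)[OF shift[OF \<tau>], of a] DERIV_shift[of "\<lambda>\<tau>. W \<tau> a" _ \<tau> "- of_real x"] by blast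
  next
    fix t a assume "complex_of_real t \<in> ball (of_real x) (1/20)"
    from shift[OF this] show "W (of_real t + - of_real x) a \<in> \<real>"
      using W(4)[of "t - x" a] by simp
  qed
  then show thesis using that W(1) by (metis add.right_inverse)
qed

text \<open>The Lipschitz estimate lives around real states, so local uniqueness is used at a real point and the
identity theorem does the rest.\<close>

lemma solution_unique:
  assumes "open S" "connected S" "solution_on G m S W" "solution_on G m S W'"
    and t: "complex_of_real t \<in> S" "W (of_real t) = W' (of_real t)" and \<tau>: "\<tau> \<in> S"
  shows "W \<tau> = W' \<tau>"
proof
  fix a
  have "admissible G m (W (of_real t))" "\<And>a. W (of_real t) a \<in> \<real>"
    by (rule solution_onD[OF assms(3) t(1)])+
  then obtain q v where qv: "W (of_real t) = real_state q v" "q \<notin> collision_set"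
    by (rule admissible_real_state)
  interpret noncollision_state G m q v by (rule noncollision_stateI[OF qv(2)])
  obtain e where e: "0 < e" "ball (of_real t) e \<subseteq> S" "\<And>\<tau>. \<tau> \<in> ball (of_real t) e \<Longrightarrow> W \<tau> = W' \<tau>"
    using local_unique[OF assms(1) t(1) solution_onD(2)[OF assms(3)] solution_onD(2)[OF assms(4)] qv(1)] t(2) qv(1)
    by metis
  have hol: "(\<lambda>\<tau>. U \<tau> a) holomorphic_on S" if "solution_on G m S U" for U
    using solution_onD(2)[OF that] assms(1) holomorphic_on_open by blast
  show "W \<tau> a = W' \<tau> a"
    by (rule analytic_continuation_open[of "ball (of_real t) e" S "\<lambda>\<tau>. W \<tau> a" "\<lambda>\<tau>. W' \<tau> a"])
       (use e assms hol in auto)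
qed

lemma solution_glue:
  assumes S: "open S" "solution_on G m S W1" and T: "open T" "solution_on G m T W2"
    and con: "connected (S \<inter> T)" and t: "complex_of_real t \<in> S \<inter> T" "W1 (of_real t) = W2 (of_real t)"
  obtains W where "solution_on G m (S \<union> T) W" "\<And>\<tau>. \<tau> \<in> S \<Longrightarrow> W \<tau> = W1 \<tau>"
proof -
  have eq: "W1 \<tau> = W2 \<tau>" if "\<tau> \<in> S \<inter> T" for \<tau>
    using solution_unique[OF open_Int[OF S(1) T(1)] con solution_on_subset[OF S(2)] solution_on_subset[OF T(2)] t that]
    by blast
  define W where "W = (\<lambda>\<tau>. if \<tau> \<in> S then W1 \<tau> else W2 \<tau>)"
  have "solution_on G m (S \<union> T) W"
    by (intro solution_on_Un solution_on_cong[OF S(2,1)] solution_on_cong[OF T(2,1)])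
       (use eq in \<open>auto simp: W_def\<close>)
  then show thesis by (rule that) (simp add: W_def)
qed

lemma extend_solution:
  assumes W: "solution_on G m S W" "open S" and x: "complex_of_real x \<in> S"
    and con: "connected (S \<inter> slab (x - 1/50) (x + 1/50))"
  obtains W' where "solution_on G m (S \<union> slab (x - 1/50) (x + 1/50)) W'" "\<And>\<tau>. \<tau> \<in> S \<Longrightarrow> W' \<tau> = W \<tau>"
proof -
  have "admissible G m (W (of_real x))" "\<And>a. W (of_real x) a \<in> \<real>"
    by (rule solution_onD[OF W(1) x])+
  then obtain q v where qv: "W (of_real x) = real_state q v" "q \<notin> collision_set"
    by (rule admissible_real_state)
  obtain W2 where W2: "solution_on G m (ball (of_real x) (1/20)) W2" "W2 (of_real x) = real_state q v"
    using ex_local_solution[OF qv(2)] .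
  show thesis
  proof (rule solution_glue[OF W(2,1) open_slab solution_on_subset[OF W2(1) slab_subset_ball] con])
    show "complex_of_real x \<in> S \<inter> slab (x - 1/50) (x + 1/50)" using x by (simp add: slab_def)
    show "W (of_real x) = W2 (of_real x)" using qv W2(2) by simp
  qed (rule that)
qed

text \<open>Each step restarts the solution at distance \<open>1/100\<close> from both ends, so the new rectangle
overlaps the old one in a rectangle and reaches \<open>1/100\<close> further.\<close>

lemma slab_solution:
  assumes "q \<notin> collision_set"
  shows "\<exists>W. solution_on G m (slab (- (1/50) - real n / 100) (1/50 + real n / 100)) W \<and> W 0 = real_state q v"
proof (induction n)
  case 0
  obtain W where "solution_on G m (ball (of_real 0) (1/20)) W" "W (of_real 0) = real_state q v"
    using ex_local_solution[OF assms] .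
  then have "solution_on G m (slab (0 - 1/50) (0 + 1/50)) W \<and> W 0 = real_state q v"
    using solution_on_subset[OF _ slab_subset_ball[of 0]] by simp
  then show ?case by auto
next
  case (Suc n)
  define a where "a = 1/50 + real n / 100"
  have a: "1/50 \<le> a" by (simp add: a_def)
  from Suc obtain W where W: "solution_on G m (slab (- a) a) W" "W 0 = real_state q v"
    by (auto simp: a_def)
  have eq1: "slab (- a) a \<union> slab ((a - 1/100) - 1/50) ((a - 1/100) + 1/50) = slab (- a) (a + 1/100)"
    using a by (auto simp: slab_def)
  have "slab (- a) a \<inter> slab ((a - 1/100) - 1/50) ((a - 1/100) + 1/50) = slab (max (- a) (a - 3/100)) a"
    by (auto simp: slab_def)
  then have con1: "connected (slab (- a) a \<inter> slab ((a - 1/100) - 1/50) ((a - 1/100) + 1/50))"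
    by (simp only: convex_connected[OF convex_slab])
  obtain W1 where W1: "solution_on G m (slab (- a) (a + 1/100)) W1" "\<And>\<tau>. \<tau> \<in> slab (- a) a \<Longrightarrow> W1 \<tau> = W \<tau>"
  proof (rule extend_solution[OF W(1) open_slab _ con1])
    show "complex_of_real (a - 1/100) \<in> slab (- a) a" using a by (simp add: slab_def)
  qed (unfold eq1, rule that)
  have eq2: "slab (- a) (a + 1/100) \<union> slab ((1/100 - a) - 1/50) ((1/100 - a) + 1/50) = slab (- (a + 1/100)) (a + 1/100)"
    using a by (auto simp: slab_def)
  have "slab (- a) (a + 1/100) \<inter> slab ((1/100 - a) - 1/50) ((1/100 - a) + 1/50) = slab (- a) (min (a + 1/100) (3/100 - a))"
    by (auto simp: slab_def)
  then have con2: "connected (slab (- a) (a + 1/100) \<inter> slab ((1/100 - a) - 1/50) ((1/100 - a) + 1/50))"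
    by (simp only: convex_connected[OF convex_slab])
  obtain W2 where W2: "solution_on G m (slab (- (a + 1/100)) (a + 1/100)) W2" "\<And>\<tau>. \<tau> \<in> slab (- a) (a + 1/100) \<Longrightarrow> W2 \<tau> = W1 \<tau>"
  proof (rule extend_solution[OF W1(1) open_slab _ con2])
    show "complex_of_real (1/100 - a) \<in> slab (- a) (a + 1/100)" using a by (simp add: slab_def)
  qed (unfold eq2, rule that)
  have "W2 0 = real_state q v" using W2(2)[of 0] W1(2)[of 0] W(2) a by (auto simp: slab_def)
  moreover have "a + 1/100 = 1/50 + real (Suc n) / 100" by (simp add: a_def field_simps)
  ultimately show ?case using W2(1) by auto
qed

text \<open>The solutions on the growing rectangles agree by uniqueness, so they define one function.\<close>

theorem strip_solution:
  assumes q: "q \<notin> collision_set"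
  obtains W where "solution_on G m open_strip W" "W 0 = real_state q v"
proof -
  define T where "T = (\<lambda>n::nat. slab (- (1/50) - real n / 100) (1/50 + real n / 100))"
  have "\<forall>n. \<exists>W. solution_on G m (T n) W \<and> W 0 = real_state q v"
    unfolding T_def using slab_solution[OF q] by simp
  from choice[OF this] obtain U where U: "\<And>n. solution_on G m (T n) (U n)" "\<And>n. U n 0 = real_state q v"
    by blast
  have T0: "complex_of_real 0 \<in> T n" for n by (simp add: T_def slab_def add_pos_nonneg)
  have mono: "T k \<subseteq> T n" if "k \<le> n" for k n using that by (auto simp: T_def slab_def)
  have agree: "U k \<tau> = U n \<tau>" if "k \<le> n" "\<tau> \<in> T k" for k n \<tau>
  proof (rule solution_unique[OF _ _ U(1) solution_on_subset[OF U(1) mono[OF that(1)]] T0 _ that(2)])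
    show "open (T k)" "connected (T k)"
      unfolding T_def by (rule open_slab convex_connected[OF convex_slab])+
    show "U k (of_real 0) = U n (of_real 0)" by (simp add: U(2))
  qed
  \<comment> \<open>a rectangle with this index contains \<open>\<tau>\<close>\<close>
  define N where "N = (\<lambda>\<tau>. nat \<lceil>100 * \<bar>Re \<tau>\<bar>\<rceil>)"
  have N: "\<tau> \<in> T (N \<tau>)" if "\<tau> \<in> open_strip" for \<tau>
  proof -
    have "100 * \<bar>Re \<tau>\<bar> \<le> real (N \<tau>)" unfolding N_def by (rule real_nat_ceiling_ge)
    then show ?thesis using that by (auto simp: T_def slab_def open_strip_def)
  qed
  define W where "W = (\<lambda>\<tau>. U (N \<tau>) \<tau>)"
  have W: "W \<tau> = U n \<tau>" if "\<tau> \<in> T n" for n \<tau>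
  proof -
    have "\<tau> \<in> open_strip" using that by (simp add: T_def slab_def open_strip_def)
    then have N\<tau>: "\<tau> \<in> T (N \<tau>)" by (rule N)
    show ?thesis
    proof (cases "N \<tau> \<le> n")
      case True
      then show ?thesis unfolding W_def by (rule agree[OF _ N\<tau>])
    next
      case False
      then show ?thesis unfolding W_def by (intro agree[OF _ that, symmetric]) simp
    qed
  qed
  have sol: "solution_on G m (T n) W" for n
    by (rule solution_on_cong[OF U(1) _ W]) (simp add: T_def open_slab)
  have "solution_on G m open_strip W"
    unfolding solution_on_def
  proof (intro conjI ballI allI impI)
    fix \<tau> a assume "\<tau> \<in> open_strip"
    note N\<tau> = N[OF this]
    show "admissible G m (W \<tau>)" by (rule solution_onD(1)[OF sol N\<tau>])
    show "((\<lambda>\<tau>. W \<tau> a) has_field_derivative field G m (W \<tau>) a) (at \<tau>)" by (rule solution_onD(2)[OF sol N\<tau>])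
  next
    fix t a assume "complex_of_real t \<in> open_strip"
    from solution_onD(3)[OF sol, OF N[OF this]] show "W (of_real t) a \<in> \<real>" .
  qed
  moreover have "W 0 = real_state q v" using W[OF T0[of 0]] U(2)[of 0] by simp
  ultimately show thesis by (rule that)
qed

end

section \<open>Branches and uniqueness on the closed strip\<close>

lemma csqrt_power3_exp: "z \<noteq> 0 \<Longrightarrow> csqrt z ^ 3 = exp (of_real (3/2) * Ln z)"
  by (simp add: csqrt_exp_Ln exp_of_nat_mult[symmetric])

lemma csqrt_exp: "z \<noteq> 0 \<Longrightarrow> csqrt z = exp (of_real (1/2) * Ln z)"
  by (simp add: csqrt_exp_Ln)

lemma inverse_csqrt_exp: "z \<noteq> 0 \<Longrightarrow> 1 / csqrt z = exp (of_real (- 1/2) * Ln z)"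
  by (simp add: csqrt_exp_Ln exp_minus inverse_eq_divide)

lemma powr_continuation_principal:
  assumes "f analytic_on S" "\<And>\<tau>. \<tau> \<in> S \<Longrightarrow> 0 < Re (f \<tau>)" "f 0 \<in> \<real>" "0 \<in> S"
    and g: "\<And>\<tau>. \<tau> \<in> S \<Longrightarrow> g \<tau> = exp (of_real a * Ln (f \<tau>))"
  shows "powr_continuation_on S f a g"
  unfolding powr_continuation_on_def
proof (intro exI[of _ "\<lambda>\<tau>. Ln (f \<tau>)"] conjI ballI)
  have "f \<tau> \<notin> \<real>\<^sub>\<le>\<^sub>0" if "\<tau> \<in> S" for \<tau>
    using assms(2)[OF that] by (auto simp: complex_nonpos_Reals_iff)
  then show "(\<lambda>\<tau>. Ln (f \<tau>)) analytic_on S" using assms(1) by (intro analytic_on_ln) auto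
  have "f 0 = of_real (Re (f 0))" using assms(3) by simp
  moreover have "0 < Re (f 0)" using assms by blast
  ultimately show "Ln (f 0) \<in> \<real>" by (metis Ln_of_real Reals_of_real)
  fix \<tau> assume \<tau>: "\<tau> \<in> S"
  then have "f \<tau> \<noteq> 0" using assms(2) by force
  then show "exp (Ln (f \<tau>)) = f \<tau>" by simp
  show "g \<tau> = exp (of_real a * Ln (f \<tau>))" by (rule g[OF \<tau>])
qed

text \<open>The continued logarithm is real at 0, so near 0 its imaginary part stays below \<open>pi\<close> in modulus,
which makes it the principal one.\<close>

lemma powr_continuation_near_0:
  assumes "powr_continuation_on S f a g" "open U" "0 \<in> U" "U \<subseteq> S"
  shows "\<forall>\<^sub>F \<tau> in nhds 0. g \<tau> = exp (of_real a * Ln (f \<tau>)) \<and> f \<tau> \<noteq> 0"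
proof -
  from assms(1) obtain L where L: "L analytic_on S" "L 0 \<in> \<real>"
    "\<And>\<tau>. \<tau> \<in> S \<Longrightarrow> exp (L \<tau>) = f \<tau> \<and> g \<tau> = exp (of_real a * L \<tau>)"
    unfolding powr_continuation_on_def by blast
  have "isCont L 0" using L(1) assms(3,4) analytic_on_imp_differentiable_at field_differentiable_imp_continuous_at
    by blast
  then have "((\<lambda>\<tau>. \<bar>Im (L \<tau>)\<bar>) \<longlongrightarrow> \<bar>Im (L 0)\<bar>) (nhds 0)"
    using tendsto_at_iff_tendsto_nhds[of L 0] unfolding isCont_def by (intro tendsto_intros) simp
  moreover have "\<bar>Im (L 0)\<bar> < pi" using L(2) by (simp add: complex_is_Real_iff)
  ultimately have "\<forall>\<^sub>F \<tau> in nhds 0. \<bar>Im (L \<tau>)\<bar> < pi" by (rule order_tendstoD(2))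
  moreover have "\<forall>\<^sub>F \<tau> in nhds 0. \<tau> \<in> U" using assms(2,3) by (rule eventually_nhds_in_open)
  ultimately show ?thesis
  proof eventually_elim
    case (elim \<tau>)
    then have L\<tau>: "exp (L \<tau>) = f \<tau>" "g \<tau> = exp (of_real a * L \<tau>)" using L(3) assms(4) by auto
    have "Ln (exp (L \<tau>)) = L \<tau>" using elim by (intro Ln_exp) auto
    then show ?case using L\<tau> by (metis exp_not_eq_zero)
  qed
qed

lemma closed_strip_subset: "\<beta> < 9/200 \<Longrightarrow> closed_strip \<beta> \<subseteq> open_strip"
  by (auto simp: closed_strip_def open_strip_def)

lemma open_open_strip: "open open_strip"
  unfolding open_strip_def by (intro open_Collect_less continuous_intros)

lemma s_radicand_cong:
  assumes "\<And>i j. i \<noteq> j \<Longrightarrow> r i j = r' i j"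
  shows "s_radicand G m q v r = s_radicand G m q v r'"
proof -
  have "(\<Sum>(i,j)\<in>{(i,j). i < j}. (K_coeff G m q i + K_coeff G m q j) / r i j) =
      (\<Sum>(i,j)\<in>{(i,j). i < j}. (K_coeff G m q i + K_coeff G m q j) / r' i j)"
    by (rule sum.cong) (auto simp: assms)
  then show ?thesis by (simp add: s_radicand_def)
qed

lemma nbody_acc_cong:
  assumes "\<And>i j. i \<noteq> j \<Longrightarrow> r i j = r' i j"
  shows "nbody_acc G m q r i = nbody_acc G m q r' i"
  unfolding nbody_acc_def by (rule sum.cong) (auto simp: assms)

text \<open>The identity theorem gives equality in the interior, and the boundary is reached by continuity
along points with contracted imaginary part.\<close>

lemma analytic_eq_on_closed_strip:
  assumes fg: "f analytic_on closed_strip \<beta>" "g analytic_on closed_strip \<beta>" and \<beta>: "0 < \<beta>"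
    and eq: "\<forall>\<^sub>F \<tau> in nhds 0. f \<tau> = g \<tau>" and \<tau>: "\<tau> \<in> closed_strip \<beta>"
  shows "f \<tau> = g \<tau>"
proof -
  define U where "U = {\<tau>. - \<beta> < Im \<tau>} \<inter> {\<tau>. Im \<tau> < \<beta>}"
  have U: "open U" "connected U" "0 \<in> U" "U \<subseteq> closed_strip \<beta>"
    unfolding U_def using \<beta>
    by (auto simp: closed_strip_def intro!: open_Int open_halfspace_Im_gt open_halfspace_Im_lt convex_connected
        convex_Int convex_halfspace_Im_gt convex_halfspace_Im_lt)
  from eq obtain e where e: "0 < e" "\<And>\<tau>. dist \<tau> 0 < e \<Longrightarrow> f \<tau> = g \<tau>"
    unfolding eventually_nhds_metric by blast
  have hol: "f holomorphic_on U" "g holomorphic_on U"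
    using fg U(4) analytic_imp_holomorphic analytic_on_subset by blast+
  have eqU: "f z = g z" if "z \<in> U" for z
  proof (rule analytic_continuation_open[of "ball 0 e \<inter> U" U f g])
    show "ball 0 e \<inter> U \<noteq> {}" using e(1) U(3) by force
  qed (use e U hol that in \<open>auto simp: dist_commute\<close>)
  define z where "z = (\<lambda>n::nat. Complex (Re \<tau>) (Im \<tau> * (1 - inverse (real (Suc n)))))"
  have "(\<lambda>n. 1 - inverse (real (Suc n))) \<longlonglongrightarrow> 1 - 0"
    by (intro tendsto_diff tendsto_const LIMSEQ_inverse_real_of_nat)
  then have "z \<longlonglongrightarrow> Complex (Re \<tau>) (Im \<tau> * (1 - 0))"
    unfolding z_def by (intro tendsto_Complex tendsto_mult tendsto_const)
  then have lim: "z \<longlonglongrightarrow> \<tau>" by simp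
  have zU: "z n \<in> U" for n
  proof -
    have c: "0 \<le> 1 - inverse (real (Suc n))" "1 - inverse (real (Suc n)) < 1" by (auto simp: field_simps)
    have "\<bar>Im \<tau> * (1 - inverse (real (Suc n)))\<bar> \<le> \<beta> * (1 - inverse (real (Suc n)))"
      using \<tau> c(1) unfolding abs_mult closed_strip_def by (simp add: mult_right_mono)
    also have "\<dots> < \<beta> * 1" using \<beta> c(2) by (intro mult_strict_left_mono)
    finally show ?thesis by (simp add: U_def z_def abs_less_iff)
  qed
  have cont: "isCont f \<tau>" "isCont g \<tau>"
    using fg \<tau> analytic_on_imp_differentiable_at field_differentiable_imp_continuous_at by blast+
  have "(\<lambda>n. f (z n)) \<longlonglongrightarrow> f \<tau>" "(\<lambda>n. g (z n)) \<longlonglongrightarrow> g \<tau>"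
    using cont lim by (auto intro: isCont_tendsto_compose)
  moreover have "(\<lambda>n. f (z n)) = (\<lambda>n. g (z n))" using eqU zU by auto
  ultimately show ?thesis by (metis LIMSEQ_unique)
qed

context masses
begin

lemma solution_analytic:
  assumes W: "solution_on G m open_strip W"
  shows "(\<lambda>\<tau>. W \<tau> a) analytic_on open_strip"
  using solution_onD(2)[OF W] open_open_strip analytic_on_open holomorphic_on_open by blast

lemma strip_solution_renormalized:
  assumes q: "q \<notin> collision_set" and W: "solution_on G m open_strip W" and W0: "W 0 = real_state q v"
    and S: "S \<subseteq> open_strip" and S0: "0 \<in> S"
  shows "renormalized_solution G m S q v (\<lambda>\<tau>. positions (W \<tau>)) (\<lambda>\<tau>. velocities (W \<tau>))"
proof -
  have an: "(\<lambda>\<tau>. W \<tau> a) analytic_on S" for a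
    using analytic_on_subset[OF solution_analytic[OF W] S] .
  have adm: "admissible G m (W \<tau>)" if "\<tau> \<in> S" for \<tau> using solution_onD(1)[OF W] S that by blast
  have W0real: "W 0 a \<in> \<real>" for a by (cases a) (auto simp: W0 real_state_def)
  define f where "f = (\<lambda>i j \<tau>. sqT (positions (W \<tau>) $ i - positions (W \<tau>) $ j))"
  have f_an: "f i j analytic_on S" for i j
    unfolding f_def sqT_def by (auto intro!: analytic_intros an)
  have f_pos: "0 < Re (f i j \<tau>)" if "i \<noteq> j" "\<tau> \<in> S" for i j \<tau>
    using adm[OF that(2)] that(1) by (simp add: admissible_def f_def)
  have f_nz: "f i j \<tau> \<noteq> 0" if "i \<noteq> j" "\<tau> \<in> S" for i j \<tau>
    using f_pos[OF that] by force
  have f_real: "f i j 0 \<in> \<real>" for i j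
    unfolding f_def sqT_def using W0real by (auto intro!: sum_in_Reals Reals_power Reals_diff)
  have sq_an: "(\<lambda>\<tau>. cdist (positions (W \<tau>)) i j) analytic_on S" if "i \<noteq> j" for i j
    unfolding cdist_def
  proof (rule analytic_on_csqrt')
    show "(\<lambda>\<tau>. sqT (positions (W \<tau>) $ i - positions (W \<tau>) $ j)) analytic_on S" using f_an by (simp add: f_def)
    show "sqT (positions (W \<tau>) $ i - positions (W \<tau>) $ j) \<notin> \<real>\<^sub>\<le>\<^sub>0" if "\<tau> \<in> S" for \<tau>
      using f_pos[OF \<open>i \<noteq> j\<close> that] by (auto simp: f_def complex_nonpos_Reals_iff)
  qed
  have d_nz: "cdist (positions (W \<tau>)) i j \<noteq> 0" if "i \<noteq> j" "\<tau> \<in> S" for i j \<tau>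
    using f_nz[OF that] by (simp add: cdist_def f_def)
  have K_an: "(\<lambda>\<tau>. K_coeff G m (positions (W \<tau>)) i) analytic_on S" for i
    unfolding K_coeff_def using f_an f_nz
    by (intro analytic_on_sum analytic_on_divide analytic_on_const) (auto simp: f_def)
  have vel_an: "(\<lambda>\<tau>. sqT (velocities (W \<tau>) $ i - velocities (W \<tau>) $ j)) analytic_on S" for i j
    unfolding sqT_def by (auto intro!: analytic_intros an)
  have rad_an: "(\<lambda>\<tau>. crad G m (W \<tau>)) analytic_on S"
    unfolding crad_def s_radicand_def case_prod_beta using f_an f_nz d_nz
    by (intro analytic_on_add analytic_on_sum analytic_on_divide vel_an K_an sq_an) (auto simp: f_def)
  have Re_crad_pos: "0 < Re (crad G m (W \<tau>))" if "\<tau> \<in> S" for \<tau>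
    using adm[OF that] by (simp add: admissible_def)
  interpret noncollision_state G m q v by (rule noncollision_stateI[OF q])
  have rad_real: "crad G m (W 0) \<in> \<real>"
    unfolding W0 by (rule regular_on_real[OF regular_crad initial_in_D]) (use W0real W0 in simp)
  define r1 r3 \<sigma> where "r1 = (\<lambda>i j \<tau>. cdist (positions (W \<tau>)) i j)"
    and "r3 = (\<lambda>i j \<tau>. cdist (positions (W \<tau>)) i j ^ 3)" and "\<sigma> = (\<lambda>\<tau>. 1 / csqrt (crad G m (W \<tau>)))"
  have r1: "powr_continuation_on S (\<lambda>\<tau>. sqT (positions (W \<tau>) $ i - positions (W \<tau>) $ j)) (1/2) (r1 i j)" if "i \<noteq> j" for i j
    using powr_continuation_principal[OF f_an f_pos[OF that] f_real S0, of "r1 i j" "1/2"] csqrt_exp[OF f_nz[OF that]]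
    by (simp add: r1_def cdist_def f_def)
  have r3: "powr_continuation_on S (\<lambda>\<tau>. sqT (positions (W \<tau>) $ i - positions (W \<tau>) $ j)) (3/2) (r3 i j)" if "i \<noteq> j" for i j
    using powr_continuation_principal[OF f_an f_pos[OF that] f_real S0, of "r3 i j" "3/2"] csqrt_power3_exp[OF f_nz[OF that]]
    by (simp add: r3_def cdist_def f_def)
  have rad_nz: "crad G m (W \<tau>) \<noteq> 0" if "\<tau> \<in> S" for \<tau> using Re_crad_pos[OF that] by force
  have "powr_continuation_on S (\<lambda>\<tau>. crad G m (W \<tau>)) (- 1/2) \<sigma>"
    unfolding \<sigma>_def by (rule powr_continuation_principal[OF rad_an Re_crad_pos rad_real S0 inverse_csqrt_exp[OF rad_nz]])
  then have \<sigma>: "powr_continuation_on S (\<lambda>\<tau>. s_radicand G m (positions (W \<tau>)) (velocities (W \<tau>)) (\<lambda>i j. r1 i j \<tau>)) (- 1/2) \<sigma>"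
    by (simp only: crad_def r1_def)
  have Qd: "((\<lambda>\<tau>. positions (W \<tau>) $ i $ k) has_field_derivative \<sigma> \<tau> * velocities (W \<tau>) $ i $ k) (at \<tau>)"
    and Vd: "((\<lambda>\<tau>. velocities (W \<tau>) $ i $ k) has_field_derivative
        \<sigma> \<tau> * nbody_acc G m (positions (W \<tau>)) (\<lambda>i j. r3 i j \<tau>) i $ k) (at \<tau>)" if "\<tau> \<in> S" for \<tau> i k
  proof -
    have \<tau>: "\<tau> \<in> open_strip" using S that by blast
    show "((\<lambda>\<tau>. positions (W \<tau>) $ i $ k) has_field_derivative \<sigma> \<tau> * velocities (W \<tau>) $ i $ k) (at \<tau>)"
      using solution_onD(2)[OF W \<tau>, of "(True, i, k)"] by (simp add: field_def \<sigma>_def)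
    show "((\<lambda>\<tau>. velocities (W \<tau>) $ i $ k) has_field_derivative
        \<sigma> \<tau> * nbody_acc G m (positions (W \<tau>)) (\<lambda>i j. r3 i j \<tau>) i $ k) (at \<tau>)"
      using solution_onD(2)[OF W \<tau>, of "(False, i, k)"] by (simp add: field_def cacc_def \<sigma>_def r3_def)
  qed
  have init: "positions (W 0) = complexify q" "velocities (W 0) = complexify v"
    by (simp_all add: vec_eq_iff W0 real_state_def complexify_def)
  have van: "vec_analytic_on (\<lambda>\<tau>. positions (W \<tau>)) S" "vec_analytic_on (\<lambda>\<tau>. velocities (W \<tau>)) S"
    by (simp_all add: vec_analytic_on_def an)
  show ?thesis
    unfolding renormalized_solution_def
    by (intro conjI exI[of _ r1] exI[of _ r3] exI[of _ \<sigma>] van init \<sigma> allI impI ballI r1 r3 Qd Vd)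
qed

text \<open>Near 0 the branches of any competitor are the principal ones, so it solves the same equation there.\<close>

lemma renormalized_solution_unique:
  assumes q: "q \<notin> collision_set" and W: "solution_on G m open_strip W" and W0: "W 0 = real_state q v"
    and \<beta>: "0 < \<beta>" "\<beta> < 9/200"
    and R: "renormalized_solution G m (closed_strip \<beta>) q v Q' V'" and \<tau>: "\<tau> \<in> closed_strip \<beta>"
  shows "Q' \<tau> = positions (W \<tau>) \<and> V' \<tau> = velocities (W \<tau>)"
proof -
  let ?S = "closed_strip \<beta>"
  define U where "U = {\<tau>. \<bar>Im \<tau>\<bar> < \<beta>}"
  have U: "open U" "0 \<in> U" "U \<subseteq> ?S"
    unfolding U_def using \<beta>(1) by (auto simp: closed_strip_def intro!: open_Collect_less continuous_intros)
  note R' = R[unfolded renormalized_solution_def]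
  have an: "vec_analytic_on Q' ?S" "vec_analytic_on V' ?S" and init: "Q' 0 = complexify q" "V' 0 = complexify v"
    using R' by simp_all
  from R'[THEN conjunct2, THEN conjunct2, THEN conjunct2, THEN conjunct2] obtain r1 r3 \<sigma> where
    X: "(\<forall>i j. i \<noteq> j \<longrightarrow>
           powr_continuation_on ?S (\<lambda>\<tau>. sqT (Q' \<tau> $ i - Q' \<tau> $ j)) (1/2) (r1 i j) \<and>
           powr_continuation_on ?S (\<lambda>\<tau>. sqT (Q' \<tau> $ i - Q' \<tau> $ j)) (3/2) (r3 i j)) \<and>
        powr_continuation_on ?S (\<lambda>\<tau>. s_radicand G m (Q' \<tau>) (V' \<tau>) (\<lambda>i j. r1 i j \<tau>)) (- 1/2) \<sigma> \<and>
        (\<forall>\<tau>\<in>?S. \<forall>i k.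
           ((\<lambda>z. Q' z $ i $ k) has_field_derivative \<sigma> \<tau> * V' \<tau> $ i $ k) (at \<tau>) \<and>
           ((\<lambda>z. V' z $ i $ k) has_field_derivative
               \<sigma> \<tau> * nbody_acc G m (Q' \<tau>) (\<lambda>i j. r3 i j \<tau>) i $ k) (at \<tau>))"
    by (elim exE) (rule that)
  note r13 = X[THEN conjunct1, rule_format]
    and \<sigma> = X[THEN conjunct2, THEN conjunct1]
    and QVd = X[THEN conjunct2, THEN conjunct2, rule_format]
  define W' where "W' = (\<lambda>\<tau> (b, i, k). if b then Q' \<tau> $ i $ k else V' \<tau> $ i $ k)"
  have pos: "positions (W' \<tau>) = Q' \<tau>" and vel: "velocities (W' \<tau>) = V' \<tau>" for \<tau>
    by (simp_all add: vec_eq_iff W'_def)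
  have "\<forall>\<^sub>F \<tau> in nhds 0. i \<noteq> j \<longrightarrow> r1 i j \<tau> = cdist (Q' \<tau>) i j \<and> r3 i j \<tau> = cdist (Q' \<tau>) i j ^ 3" for i j
  proof (cases "i = j")
    case False
    from powr_continuation_near_0[OF conjunct1[OF r13[OF False]] U] powr_continuation_near_0[OF conjunct2[OF r13[OF False]] U]
    show ?thesis
    proof eventually_elim
      case (elim \<tau>)
      then show ?case unfolding cdist_def
        using csqrt_exp[of "sqT (Q' \<tau> $ i - Q' \<tau> $ j)"] csqrt_power3_exp[of "sqT (Q' \<tau> $ i - Q' \<tau> $ j)"] by metis
    qed
  qed simp
  then have "\<forall>\<^sub>F \<tau> in nhds 0. \<forall>i j. i \<noteq> j \<longrightarrow> r1 i j \<tau> = cdist (Q' \<tau>) i j \<and> r3 i j \<tau> = cdist (Q' \<tau>) i j ^ 3"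
    by (intro eventually_all_finite)
  moreover note powr_continuation_near_0[OF \<sigma> U]
  moreover have "\<forall>\<^sub>F \<tau> in nhds 0. \<tau> \<in> U" using U(1,2) by (rule eventually_nhds_in_open)
  ultimately have ev: "\<forall>\<^sub>F \<tau> in nhds 0. \<forall>a. ((\<lambda>\<tau>. W' \<tau> a) has_field_derivative field G m (W' \<tau>) a) (at \<tau>)"
  proof eventually_elim
    case (elim \<tau>)
    then have \<tau>: "\<tau> \<in> ?S" using U(3) by blast
    have "s_radicand G m (Q' \<tau>) (V' \<tau>) (\<lambda>i j. r1 i j \<tau>) = crad G m (W' \<tau>)"
      unfolding crad_def pos vel by (rule s_radicand_cong) (use elim in auto)
    then have \<sigma>\<tau>: "\<sigma> \<tau> = 1 / csqrt (crad G m (W' \<tau>))"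
      using elim inverse_csqrt_exp[of "crad G m (W' \<tau>)"] by simp
    have acc: "nbody_acc G m (Q' \<tau>) (\<lambda>i j. r3 i j \<tau>) i = cacc G m (W' \<tau>) i" for i
      unfolding cacc_def pos by (rule nbody_acc_cong) (use elim in auto)
    show ?case
    proof
      fix a :: "bool \<times> 'n \<times> 3"
      obtain b i k where a: "a = (b, i, k)" by (cases a)
      show "((\<lambda>\<tau>. W' \<tau> a) has_field_derivative field G m (W' \<tau>) a) (at \<tau>)"
        using QVd[OF \<tau>, of i k] unfolding a field_def \<sigma>\<tau> acc vel
        by (cases b) (simp_all add: W'_def)
    qed
  qed
  then obtain A where A: "open A" "0 \<in> A"
    "\<And>\<tau> a. \<tau> \<in> A \<Longrightarrow> ((\<lambda>\<tau>. W' \<tau> a) has_field_derivative field G m (W' \<tau>) a) (at \<tau>)"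
    unfolding eventually_nhds by blast
  interpret noncollision_state G m q v by (rule noncollision_stateI[OF q])
  have W'0: "W' 0 = real_state q v"
    by (rule ext) (auto simp: W'_def init real_state_def complexify_def)
  have AS: "open (A \<inter> open_strip)" "0 \<in> A \<inter> open_strip"
    using A open_open_strip by (auto simp: open_strip_def)
  obtain e where e: "0 < e" "\<And>\<tau>. \<tau> \<in> ball 0 e \<Longrightarrow> W' \<tau> = W \<tau>"
  proof (rule local_unique[of "A \<inter> open_strip" 0 W' W, OF AS _ _ W'0 W0])
    show "((\<lambda>\<tau>. W' \<tau> a) has_field_derivative field G m (W' \<tau>) a) (at \<tau>)" if "\<tau> \<in> A \<inter> open_strip" for \<tau> a
      using A(3) that by blast
    show "((\<lambda>\<tau>. W \<tau> a) has_field_derivative field G m (W \<tau>) a) (at \<tau>)" if "\<tau> \<in> A \<inter> open_strip" for \<tau> a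
      using solution_onD(2)[OF W] that by blast
  qed blast
  have "W' \<tau> a = W \<tau> a" for a
  proof (rule analytic_eq_on_closed_strip[OF _ _ _ _ \<tau>])
    obtain b i k where a: "a = (b, i, k)" by (cases a)
    show "(\<lambda>\<tau>. W' \<tau> a) analytic_on ?S"
      using an unfolding a W'_def vec_analytic_on_def by (cases b) simp_all
    show "(\<lambda>\<tau>. W \<tau> a) analytic_on ?S"
      using analytic_on_subset[OF solution_analytic[OF W] closed_strip_subset[OF \<beta>(2)]] .
    show "\<forall>\<^sub>F \<tau> in nhds 0. W' \<tau> a = W \<tau> a"
      unfolding eventually_nhds_metric using e by (auto simp: dist_commute intro!: exI[of _ e])
  qed (rule \<beta>(1))
  then have "W' \<tau> = W \<tau>" by blast
  then show ?thesis using pos[of \<tau>] vel[of \<tau>] by simp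
qed

end

section \<open>Comparison with the solution in physical time\<close>

context noncollision_state
begin

lemma s_fun_eq: "s_fun G m (q0, v0) = 1 / R"
  using rad_pos by (simp add: s_fun_def rad_def[symmetric] R_def powr_minus_divide powr_half_sqrt)

lemma sqT_initial: "sqT (positions (real_state q0 v0) $ i - positions (real_state q0 v0) $ j) = of_real ((r i j)\<^sup>2)"
  by (simp add: positions_real_state cvec_diff[symmetric] sqT_cvec r_def)

lemma cdist_initial: "cdist (positions (real_state q0 v0)) i j = of_real (r i j)"
  unfolding cdist_def sqT_initial csqrt_of_real[OF zero_le_power2] by (simp add: r_def)

lemma K_initial: "K_coeff G m (positions (real_state q0 v0)) i = of_real (K i)"
  unfolding K_coeff_def sqT_initial by (simp add: K_eq)

lemma crad_initial: "crad G m (real_state q0 v0) = of_real rad"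
proof -
  have "sqT (velocities (real_state q0 v0) $ i - velocities (real_state q0 v0) $ j) = of_real ((n i j)\<^sup>2)" for i j
    by (simp add: velocities_real_state cvec_diff[symmetric] sqT_cvec n_def)
  then show ?thesis
    unfolding crad_def s_radicand_def sqT_initial cdist_initial K_initial rad_eq
    by (simp add: case_prod_beta power_divide)
qed

text \<open>This turns the real equations of motion into the complexified ones.\<close>

lemma field_initial:
  "field G m (real_state q0 v0) (b, i, k) = of_real (s_fun G m (q0, v0) *
     (if b then v0 $ i $ k else nbody_acc G m q0 (\<lambda>i j. norm (q0 $ i - q0 $ j) ^ 3) i $ k))"
proof -
  have "csqrt (crad G m (real_state q0 v0)) = of_real R"
    using rad_pos by (simp only: crad_initial R_def csqrt_of_real[OF less_imp_le])
  moreover have "cacc G m (real_state q0 v0) i $ k = of_real (nbody_acc G m q0 (\<lambda>i j. norm (q0 $ i - q0 $ j) ^ 3) i $ k)"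
    unfolding cacc_def nbody_acc_def sum_component vector_smult_component cdist_initial
    by (simp add: r_def real_state_def)
  moreover have "velocities (real_state q0 v0) $ i $ k = of_real (v0 $ i $ k)"
    by (simp add: real_state_def)
  ultimately show ?thesis by (simp add: field_def s_fun_eq)
qed

text \<open>The counterpart of \<open>local_unique\<close> for a real independent variable and the equation \<open>u' = k F u\<close>.\<close>

lemma ivp_locally_unique:
  fixes x y :: "real \<Rightarrow> bool \<times> 'n \<times> 3 \<Rightarrow> complex"
  assumes T: "open T" "t0 \<in> T"
    and x: "\<And>t a. t \<in> T \<Longrightarrow> ((\<lambda>t. x t a) has_vector_derivative k t * field G m (x t) a) (at t)"
    and y: "\<And>t a. t \<in> T \<Longrightarrow> ((\<lambda>t. y t a) has_vector_derivative k t * field G m (y t) a) (at t)"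
    and k: "continuous_on T k"
    and init: "x t0 = real_state q0 v0" "y t0 = real_state q0 v0"
  shows "\<forall>\<^sub>F t in nhds t0. x t = y t"
proof -
  obtain L where L: "0 \<le> L" "lipschitz_field D (field G m) L" by (rule field_lipschitz)
  have ev: "\<forall>\<^sub>F t in nhds t0. u t \<in> D"
    if u: "\<And>a. ((\<lambda>t. u t a) has_vector_derivative k t0 * field G m (u t0) a) (at t0)"
      and u0: "u t0 = real_state q0 v0" for u
  proof (rule eventually_in_D)
    fix a
    have "isCont (\<lambda>t. u t a) t0" using has_vector_derivative_continuous[OF u[of a]] by simp
    then show "((\<lambda>t. u t a) \<longlongrightarrow> real_state q0 v0 a) (nhds t0)"
      using u0 tendsto_at_iff_tendsto_nhds[of "\<lambda>t. u t a" t0] by (simp add: isCont_def)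
  qed
  have "isCont k t0" using k T by (simp add: continuous_on_eq_continuous_at)
  then have "((\<lambda>t. cmod (k t)) \<longlongrightarrow> cmod (k t0)) (nhds t0)"
    using tendsto_at_iff_tendsto_nhds[of k t0] unfolding isCont_def by (intro tendsto_norm) simp
  then have "\<forall>\<^sub>F t in nhds t0. cmod (k t) < cmod (k t0) + 1" by (rule order_tendstoD(2)) simp
  moreover have "\<forall>\<^sub>F t in nhds t0. t \<in> T" by (rule eventually_nhds_in_open[OF T])
  moreover note ev[OF x[OF T(2)] init(1)] ev[OF y[OF T(2)] init(2)]
  ultimately have "\<forall>\<^sub>F t in nhds t0. cmod (k t) < cmod (k t0) + 1 \<and> t \<in> T \<and> x t \<in> D \<and> y t \<in> D"
    by eventually_elim simp
  then obtain e where e: "0 < e" "\<And>t. dist t t0 < e \<Longrightarrow> cmod (k t) < cmod (k t0) + 1 \<and> t \<in> T \<and> x t \<in> D \<and> y t \<in> D"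
    unfolding eventually_nhds_metric by blast
  have "x t1 = y t1" if t1: "dist t1 t0 < e" for t1
  proof -
    define p where "p = (\<lambda>u. t0 + u * (t1 - t0))"
    have p: "dist (p u) t0 < e" if "u \<in> {0..1}" for u
    proof -
      have "\<bar>u\<bar> * \<bar>t1 - t0\<bar> \<le> 1 * \<bar>t1 - t0\<bar>" using that by (intro mult_right_mono) auto
      then show ?thesis using t1 by (simp add: p_def dist_real_def abs_mult)
    qed
    have pd: "(p has_vector_derivative (t1 - t0)) (at u within {0..1})" for u
      unfolding p_def by (auto intro!: derivative_eq_intros)
    have comp: "((\<lambda>u. w (p u) a) has_vector_derivative (of_real (t1 - t0) * k (p u)) * field G m (w (p u)) a) (at u within {0..1})"
      if "u \<in> {0..1}" and w: "\<And>t a. t \<in> T \<Longrightarrow> ((\<lambda>t. w t a) has_vector_derivative k t * field G m (w t) a) (at t)"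
      for u a and w :: "real \<Rightarrow> bool \<times> 'n \<times> 3 \<Rightarrow> complex"
    proof -
      have "p u \<in> T" using e(2)[OF p[OF that(1)]] by blast
      from vector_diff_chain_within[OF pd has_vector_derivative_at_within[OF w[OF this]]] show ?thesis
        by (simp add: o_def scaleR_conv_of_real mult.assoc)
    qed
    have "x (p 1) = y (p 1)"
    proof (rule lipschitz_ivp_unique[OF L(2,1), where x = "\<lambda>u. x (p u)" and y = "\<lambda>u. y (p u)"
          and k = "\<lambda>u. of_real (t1 - t0) * k (p u)" and C = "\<bar>t1 - t0\<bar> * (cmod (k t0) + 1)"])
      fix u :: real assume u: "u \<in> {0..1}"
      note * = e(2)[OF p[OF u]]
      show "x (p u) \<in> D" "y (p u) \<in> D" using * by auto
      show "((\<lambda>u. x (p u) a) has_vector_derivative (of_real (t1 - t0) * k (p u)) * field G m (x (p u)) a) (at u within {0..1})"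
        "((\<lambda>u. y (p u) a) has_vector_derivative (of_real (t1 - t0) * k (p u)) * field G m (y (p u)) a) (at u within {0..1})" for a
        by (rule comp[OF u x], assumption) (rule comp[OF u y], assumption)
      show "cmod (of_real (t1 - t0) * k (p u)) \<le> \<bar>t1 - t0\<bar> * (cmod (k t0) + 1)"
        unfolding norm_mult norm_of_real using * by (intro mult_left_mono) auto
    qed (use init in \<open>simp_all add: p_def\<close>)
    then show ?thesis by (simp add: p_def)
  qed
  then show ?thesis using e(1) unfolding eventually_nhds_metric by blast
qed

end

context masses
begin

lemma continuous_inverse_s_fun:
  assumes "continuous_on T q" "continuous_on T v" "\<And>t. t \<in> T \<Longrightarrow> q t \<notin> collision_set"
  shows "continuous_on T (\<lambda>t. 1 / s_fun G m (q t, v t))"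
proof -
  have nz: "sqT (q t $ i - q t $ j) \<noteq> 0" if "t \<in> T" "i \<noteq> j" for t i j
    using assms(3)[OF that(1)] that(2) by (auto simp: sqT_real collision_set_def)
  have sq: "continuous_on T (\<lambda>t. sqT (q t $ i - q t $ j))" "continuous_on T (\<lambda>t. sqT (v t $ i - v t $ j))" for i j
    unfolding sqT_def by (intro continuous_intros assms)+
  have K: "continuous_on T (\<lambda>t. K_coeff G m (q t) i)" for i
    unfolding K_coeff_def by (intro continuous_intros sq) (use nz in auto)
  have "continuous_on T (\<lambda>t. s_radicand G m (q t) (v t) (\<lambda>i j. sqrt (sqT (q t $ i - q t $ j))))"
    unfolding s_radicand_def case_prod_beta by (intro continuous_intros sq K) (use nz in auto)
  then have "continuous_on T (\<lambda>t. sqrt (s_radicand G m (q t) (v t) (\<lambda>i j. sqrt (sqT (q t $ i - q t $ j)))))"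
    by (intro continuous_intros)
  moreover have "1 / s_fun G m (q t, v t) = sqrt (s_radicand G m (q t) (v t) (\<lambda>i j. sqrt (sqT (q t $ i - q t $ j))))"
    if "t \<in> T" for t
  proof -
    interpret noncollision_state G m "q t" "v t" by (rule noncollision_stateI[OF assms(3)[OF that]])
    show ?thesis by (simp add: s_fun_eq R_def rad_def)
  qed
  ultimately show ?thesis by (simp cong: continuous_on_cong)
qed

lemma new_time_derivative:
  assumes T: "open T" "is_interval T" "0 \<in> T" "t \<in> T"
    and cont: "continuous_on T (\<lambda>t. 1 / s (q t, v t))"
  shows "(new_time s q v has_vector_derivative 1 / s (q t, v t)) (at t)"
proof -
  have room: "\<exists>e>0. {c - e..c + e} \<subseteq> T" if "c \<in> T" for c
    using open_contains_cball[of T] T(1) that by (auto simp: cball_eq_atLeastAtMost)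
  have "min 0 t \<in> T" "max 0 t \<in> T" using T by (simp_all add: min_def max_def)
  from room[OF this(1)] room[OF this(2)] obtain d e where d: "0 < d" "{min 0 t - d..min 0 t + d} \<subseteq> T"
    and e: "0 < e" "{max 0 t - e..max 0 t + e} \<subseteq> T" by blast
  define a b where "a = min 0 t - d" and "b = max 0 t + e"
  have "a \<in> {min 0 t - d..min 0 t + d}" "b \<in> {max 0 t - e..max 0 t + e}" using d(1) e(1) by (simp_all add: a_def b_def)
  then have "a \<in> T" "b \<in> T" using d(2) e(2) by blast+
  have ineq: "a < 0" "a < t" "0 < b" "t < b" unfolding a_def b_def using d(1) e(1) by linarith+
  have ab: "{a..b} \<subseteq> T"
    using mem_is_interval_1_I[OF T(2) \<open>a \<in> T\<close> \<open>b \<in> T\<close>] by auto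
  have "((\<lambda>u. LBINT y=ereal 0..ereal u. 1 / s (q y, v y)) has_vector_derivative 1 / s (q t, v t)) (at t within {a..b})"
    by (rule interval_integral_FTC2[of a 0 b "\<lambda>t. 1 / s (q t, v t)" t, OF _ _ continuous_on_subset[OF cont ab]])
       (use ineq in simp_all)
  moreover have "at t within {a..b} = at t"
    using ineq by (intro at_within_interior) (simp add: interior_atLeastAtMost_real)
  ultimately show ?thesis unfolding new_time_def[abs_def] by simp
qed

text \<open>Both sides, as functions of \<open>t\<close>, satisfy \<open>u' = F u / s(q t, v t)\<close>, which avoids inverting the new
time. The set of times at which they agree is open by local uniqueness and closed by continuity.\<close>

theorem solution_in_new_time:
  assumes q0: "q0 \<notin> collision_set" and sol: "nbody_solution G m T q0 v0 q v"
    and W: "solution_on G m open_strip W" and W0: "W 0 = real_state q0 v0" and t: "t \<in> T"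
  shows "W (of_real (new_time (s_fun G m) q v t)) = real_state (q t) (v t)"
proof -
  let ?\<theta> = "new_time (s_fun G m) q v"
  have T: "open T" "is_interval T" "0 \<in> T" and init: "q 0 = q0" "v 0 = v0"
    and nc: "\<And>t. t \<in> T \<Longrightarrow> q t \<notin> collision_set"
    and qd: "\<And>t i. t \<in> T \<Longrightarrow> ((\<lambda>u. q u $ i) has_vector_derivative v t $ i) (at t)"
    and vd: "\<And>t i. t \<in> T \<Longrightarrow> ((\<lambda>u. v u $ i) has_vector_derivative
                nbody_acc G m (q t) (\<lambda>i j. norm (q t $ i - q t $ j) ^ 3) i) (at t)"
    using sol unfolding nbody_solution_def by simp_all
  have "isCont q t" "isCont v t" if "t \<in> T" for t
    using has_vector_derivative_continuous[OF qd[OF that]] has_vector_derivative_continuous[OF vd[OF that]]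
    unfolding isCont_def by (auto intro: vec_tendstoI simp: isCont_def)
  then have "continuous_on T q" "continuous_on T v" by (auto intro: continuous_at_imp_continuous_on)
  then have cont: "continuous_on T (\<lambda>t. 1 / s_fun G m (q t, v t))"
    by (rule continuous_inverse_s_fun) (rule nc)
  define k where "k = (\<lambda>t. complex_of_real (1 / s_fun G m (q t, v t)))"
  have k: "continuous_on T k" unfolding k_def by (intro continuous_on_of_real cont)
  define x where "x = (\<lambda>t. real_state (q t) (v t))"
  define y where "y = (\<lambda>t. W (of_real (?\<theta> t)))"
  have xd: "((\<lambda>t. x t a) has_vector_derivative k t * field G m (x t) a) (at t)" if "t \<in> T" for t a
  proof -
    interpret noncollision_state G m "q t" "v t" by (rule noncollision_stateI[OF nc[OF that]])
    obtain b i j where a: "a = (b, i, j)" by (cases a)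
    have s: "s_fun G m (q t, v t) \<noteq> 0" using s_fun_eq R_pos by simp
    have "((\<lambda>u. of_real (if b then q u $ i $ j else v u $ i $ j)) has_vector_derivative
        complex_of_real (if b then v t $ i $ j else nbody_acc G m (q t) (\<lambda>i j. norm (q t $ i - q t $ j) ^ 3) i $ j)) (at t)"
      using bounded_linear.has_vector_derivative[OF bounded_linear_of_real
          bounded_linear.has_vector_derivative[OF bounded_linear_vec_nth qd[OF that]]]
        bounded_linear.has_vector_derivative[OF bounded_linear_of_real
          bounded_linear.has_vector_derivative[OF bounded_linear_vec_nth vd[OF that]]]
      by (cases b) simp_all
    then show ?thesis using s unfolding x_def a k_def field_initial
      by (simp add: real_state_def field_initial[unfolded real_state_def])
  qed
  have yd: "((\<lambda>t. y t a) has_vector_derivative k t * field G m (y t) a) (at t)" if "t \<in> T" for t a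
  proof -
    have "((\<lambda>t. complex_of_real (?\<theta> t)) has_vector_derivative k t) (at t)"
      unfolding k_def by (rule bounded_linear.has_vector_derivative[OF bounded_linear_of_real new_time_derivative[OF T that cont]])
    moreover have "((\<lambda>\<tau>. W \<tau> a) has_field_derivative field G m (y t) a) (at (of_real (?\<theta> t)))"
      unfolding y_def by (rule solution_onD(2)[OF W]) (simp add: open_strip_def)
    ultimately show ?thesis using field_vector_diff_chain_at unfolding y_def comp_def by blast
  qed
  have "x t = y t"
  proof (rule connected_induction_simple[where S = T and P = "\<lambda>t. x t = y t"])
    show "connected T" using T(2) by (simp add: is_interval_connected)
    show "x 0 = y 0"
      using W0 init by (simp add: x_def y_def new_time_def)
    fix t assume tT: "t \<in> T"
    have "\<forall>\<^sub>F u in nhds t. (x u = y u \<longleftrightarrow> x t = y t)"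
    proof (cases "x t = y t")
      case True
      interpret noncollision_state G m "q t" "v t" by (rule noncollision_stateI[OF nc[OF tT]])
      have "\<forall>\<^sub>F u in nhds t. x u = y u"
        by (rule ivp_locally_unique[OF T(1) tT xd yd k]) (use True in \<open>simp_all add: x_def\<close>)
      then show ?thesis by eventually_elim (simp add: True)
    next
      case False
      then obtain a where a: "x t a \<noteq> y t a" by blast
      have "isCont (\<lambda>u. x u a - y u a) t"
        using has_vector_derivative_continuous[OF xd[OF tT]] has_vector_derivative_continuous[OF yd[OF tT]]
        by (intro continuous_diff) auto
      then have "\<forall>\<^sub>F u in nhds t. x u a - y u a \<noteq> 0"
        using a tendsto_at_iff_tendsto_nhds[of "\<lambda>u. x u a - y u a" t] unfolding isCont_def
        by (intro tendsto_imp_eventually_ne) auto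
      then show ?thesis by eventually_elim (use False in auto)
    qed
    then obtain A where A: "open A" "t \<in> A" "\<forall>u\<in>A. (x u = y u \<longleftrightarrow> x t = y t)"
      by (auto simp: eventually_nhds)
    have "openin (top_of_set T) (T \<inter> A)" using A(1) by (rule openin_open_Int)
    moreover have "t \<in> T \<inter> A" using tT A(2) by simp
    moreover have "\<forall>u\<in>T \<inter> A. \<forall>w\<in>T \<inter> A. x u = y u \<longrightarrow> x w = y w" using A(3) by simp
    ultimately show "\<exists>A. openin (top_of_set T) A \<and> t \<in> A \<and> (\<forall>u\<in>A. \<forall>w\<in>A. x u = y u \<longrightarrow> x w = y w)"
      by (intro exI[of _ "T \<inter> A"] conjI)
  qed (rule T(3) t)+
  then show ?thesis by (simp add: x_def y_def)
qed

end

section \<open>Real analyticity of the time-renormalization function\<close>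

definition monomial :: "'a::euclidean_space \<Rightarrow> ('a \<Rightarrow> nat) \<Rightarrow> real" where
  "monomial y \<alpha> = (\<Prod>b\<in>Basis. (y \<bullet> b) ^ \<alpha> b)"

definition multi_indices :: "('a::euclidean_space \<Rightarrow> nat) set" where
  "multi_indices = PiE Basis (\<lambda>_. UNIV)"

definition total_degree :: "('a::euclidean_space \<Rightarrow> nat) \<Rightarrow> nat" where
  "total_degree \<alpha> = (\<Sum>b\<in>Basis. \<alpha> b)"

text \<open>A power series at \<open>x\<close> whose absolute sum at polyradius \<open>r\<close> is at most \<open>M\<close>. Carrying the bound \<open>M\<close>
makes products and infinite sums of such functions immediate.\<close>

definition expandable :: "'a::euclidean_space \<Rightarrow> real \<Rightarrow> ('a \<Rightarrow> real) \<Rightarrow> real \<Rightarrow> bool" where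
  "expandable x r f M \<longleftrightarrow>
     (\<exists>c N. ((\<lambda>\<alpha>. \<bar>c \<alpha>\<bar> * r ^ total_degree \<alpha>) has_sum N) multi_indices \<and> N \<le> M \<and>
        (\<forall>y\<in>ball x r. ((\<lambda>\<alpha>. c \<alpha> * monomial (y - x) \<alpha>) has_sum f y) multi_indices))"

lemma monomial_le:
  assumes "y \<in> ball x r"
  shows "\<bar>monomial (y - x) \<alpha>\<bar> \<le> r ^ total_degree \<alpha>"
proof -
  have "\<bar>(y - x) \<bullet> b\<bar> \<le> r" if "b \<in> Basis" for b
    using Basis_le_norm[OF that, of "y - x"] assms by (simp add: dist_norm norm_minus_commute)
  then have "(\<Prod>b\<in>Basis. \<bar>(y - x) \<bullet> b\<bar> ^ \<alpha> b) \<le> (\<Prod>b\<in>Basis. r ^ \<alpha> b)"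
    by (intro prod_mono conjI power_mono) auto
  then show ?thesis by (simp add: monomial_def total_degree_def abs_prod power_abs power_sum)
qed

lemma has_sum_group:
  fixes f :: "'j \<Rightarrow> real"
  assumes f: "(f has_sum S) J" and e: "e ` J \<subseteq> I"
  shows "((\<lambda>i. infsum f {j\<in>J. e j = i}) has_sum S) I"
proof (rule has_sum_SigmaD[where f = "\<lambda>(i, j). f j" and B = "\<lambda>i. {j\<in>J. e j = i}"])
  have "(f has_sum S) J = ((\<lambda>(i, j). f j) has_sum S) (Sigma I (\<lambda>i. {j\<in>J. e j = i}))"
    by (rule has_sum_reindex_bij_witness[where i = snd and j = "\<lambda>j. (e j, j)"]) (use e in auto)
  then show "((\<lambda>(i, j). f j) has_sum S) (Sigma I (\<lambda>i. {j\<in>J. e j = i}))" using f by simp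
  fix i
  have "f summable_on {j\<in>J. e j = i}"
    by (rule summable_on_subset_banach[OF has_sum_imp_summable[OF f]]) auto
  then show "((\<lambda>j. case (i, j) of (i, j) \<Rightarrow> f j) has_sum infsum f {j\<in>J. e j = i}) {j\<in>J. e j = i}"
    by simp
qed

text \<open>It suffices to present \<open>f\<close> as an absolutely convergent sum of monomials over any index set, with
repetitions; collecting equal exponents gives the power series. Sums and products are instances
with the obvious index sets.\<close>

lemma expandable_regroup:
  fixes c :: "'j \<Rightarrow> real"
  assumes r: "0 < r" and e: "\<And>j. j \<in> J \<Longrightarrow> e j \<in> multi_indices"
    and N: "((\<lambda>j. \<bar>c j\<bar> * r ^ total_degree (e j)) has_sum N) J" "N \<le> M"
    and f: "\<And>y. y \<in> ball x r \<Longrightarrow> ((\<lambda>j. c j * monomial (y - x) (e j)) has_sum f y) J"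
  shows "expandable x r f M"
proof -
  define fib where "fib = (\<lambda>i. {j\<in>J. e j = i})"
  have im: "e ` J \<subseteq> multi_indices" using e by auto
  have fib_abs: "(\<lambda>j. \<bar>c j\<bar>) summable_on fib i" for i
  proof -
    have "(\<lambda>j. \<bar>c j\<bar> * r ^ total_degree (e j)) summable_on fib i"
      by (rule summable_on_subset_banach[OF has_sum_imp_summable[OF N(1)]]) (auto simp: fib_def)
    then have "(\<lambda>j. \<bar>c j\<bar> * r ^ total_degree i) summable_on fib i"
      by (rule summable_on_cong[THEN iffD1, rotated]) (simp add: fib_def)
    then have "(\<lambda>j. \<bar>c j\<bar> * r ^ total_degree i * inverse (r ^ total_degree i)) summable_on fib i"
      by (rule summable_on_cmult_left)
    moreover have "r ^ total_degree i \<noteq> 0" using r by simp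
    ultimately show ?thesis by (simp add: mult.assoc)
  qed
  define C where "C = (\<lambda>i. infsum c (fib i))"
  have D: "((\<lambda>i. infsum (\<lambda>j. \<bar>c j\<bar>) (fib i) * r ^ total_degree i) has_sum N) multi_indices"
  proof -
    have "infsum (\<lambda>j. \<bar>c j\<bar> * r ^ total_degree (e j)) (fib i) = infsum (\<lambda>j. \<bar>c j\<bar>) (fib i) * r ^ total_degree i" for i
    proof -
      have "infsum (\<lambda>j. \<bar>c j\<bar> * r ^ total_degree (e j)) (fib i) = infsum (\<lambda>j. \<bar>c j\<bar> * r ^ total_degree i) (fib i)"
        by (rule infsum_cong) (simp add: fib_def)
      also have "\<dots> = infsum (\<lambda>j. \<bar>c j\<bar>) (fib i) * r ^ total_degree i"
        by (rule infsum_cmult_left) (rule fib_abs)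
      finally show ?thesis .
    qed
    then show ?thesis using has_sum_group[OF N(1) im] by (simp add: fib_def)
  qed
  have le: "\<bar>C i\<bar> \<le> infsum (\<lambda>j. \<bar>c j\<bar>) (fib i)" for i
    using norm_infsum_bound[of c "fib i"] fib_abs[of i] by (simp add: C_def)
  have le': "\<bar>C i\<bar> * r ^ total_degree i \<le> infsum (\<lambda>j. \<bar>c j\<bar>) (fib i) * r ^ total_degree i" for i
    using le r by (intro mult_right_mono) auto
  have "(\<lambda>i. \<bar>C i\<bar> * r ^ total_degree i) summable_on multi_indices"
    by (rule summable_on_comparison_test[OF has_sum_imp_summable[OF D] le']) (use r in simp)
  then have CN: "((\<lambda>i. \<bar>C i\<bar> * r ^ total_degree i) has_sum infsum (\<lambda>i. \<bar>C i\<bar> * r ^ total_degree i) multi_indices) multi_indices"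
    by simp
  have "infsum (\<lambda>i. \<bar>C i\<bar> * r ^ total_degree i) multi_indices \<le> N"
    by (rule has_sum_mono[OF CN D le'])
  moreover have "((\<lambda>\<alpha>. C \<alpha> * monomial (y - x) \<alpha>) has_sum f y) multi_indices" if y: "y \<in> ball x r" for y
  proof -
    have "infsum (\<lambda>j. c j * monomial (y - x) (e j)) (fib i) = C i * monomial (y - x) i" for i
    proof -
      have "infsum (\<lambda>j. c j * monomial (y - x) (e j)) (fib i) = infsum (\<lambda>j. c j * monomial (y - x) i) (fib i)"
        by (rule infsum_cong) (simp add: fib_def)
      also have "\<dots> = C i * monomial (y - x) i"
        unfolding C_def using fib_abs[of i]
        by (intro infsum_cmult_left) (simp add: summable_on_iff_abs_summable_on_real[of c])
      finally show ?thesis .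
    qed
    then show ?thesis using has_sum_group[OF f[OF y] im] by (simp add: fib_def)
  qed
  ultimately show ?thesis using CN N(2) unfolding expandable_def by (meson order_trans)
qed

lemma expandable_bound:
  assumes "expandable x r f M" "y \<in> ball x r"
  shows "\<bar>f y\<bar> \<le> M"
proof -
  obtain c N where c: "((\<lambda>\<alpha>. \<bar>c \<alpha>\<bar> * r ^ total_degree \<alpha>) has_sum N) multi_indices" "N \<le> M"
    "((\<lambda>\<alpha>. c \<alpha> * monomial (y - x) \<alpha>) has_sum f y) multi_indices"
    using assms unfolding expandable_def by blast
  have le: "\<bar>c \<alpha> * monomial (y - x) \<alpha>\<bar> \<le> \<bar>c \<alpha>\<bar> * r ^ total_degree \<alpha>" for \<alpha>
    unfolding abs_mult by (intro mult_left_mono monomial_le assms) simp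
  have "(\<lambda>\<alpha>. \<bar>c \<alpha> * monomial (y - x) \<alpha>\<bar>) summable_on multi_indices"
    by (rule summable_on_comparison_test[OF has_sum_imp_summable[OF c(1)] le]) simp
  then have s: "((\<lambda>\<alpha>. norm (c \<alpha> * monomial (y - x) \<alpha>)) has_sum infsum (\<lambda>\<alpha>. \<bar>c \<alpha> * monomial (y - x) \<alpha>\<bar>) multi_indices) multi_indices"
    by simp
  have "\<bar>f y\<bar> \<le> infsum (\<lambda>\<alpha>. \<bar>c \<alpha> * monomial (y - x) \<alpha>\<bar>) multi_indices"
    using norm_has_sum_bound[OF s c(3)] by simp
  also have "\<dots> \<le> N" by (rule has_sum_mono[OF s c(1)]) (use le in simp)
  finally show ?thesis using c(2) by linarith
qed

lemma expandable_mono: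
  assumes "expandable x r f M" "M \<le> M'"
  shows "expandable x r f M'"
  using assms unfolding expandable_def by (meson order_trans)

lemma expandable_const:
  assumes "0 < r"
  shows "expandable x r (\<lambda>_. k) \<bar>k\<bar>"
proof (rule expandable_regroup[OF assms, where J = "{()}" and c = "\<lambda>_. k" and e = "\<lambda>_. (\<lambda>b\<in>Basis. 0)" and N = "\<bar>k\<bar>"])
  show "(\<lambda>b\<in>Basis. 0) \<in> (multi_indices :: ('a \<Rightarrow> nat) set)" by (auto simp: multi_indices_def)
  have d: "total_degree (\<lambda>b\<in>Basis. 0 :: nat) = 0" by (simp add: total_degree_def)
  show "((\<lambda>_. \<bar>k\<bar> * r ^ total_degree (\<lambda>b\<in>Basis. 0 :: nat)) has_sum \<bar>k\<bar>) {()}"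
    using has_sum_finite[of "{()}" "\<lambda>_. \<bar>k\<bar>"] by (simp add: d)
  show "((\<lambda>_. k * monomial (y - x) (\<lambda>b\<in>Basis. 0)) has_sum k) {()}" for y
    using has_sum_finite[of "{()}" "\<lambda>_. k"] by (simp add: monomial_def)
qed simp

lemma expandable_coordinate:
  assumes "0 < r" "b \<in> Basis"
  shows "expandable x r (\<lambda>y. (y - x) \<bullet> b) r"
proof (rule expandable_regroup[OF assms(1), where J = "{()}" and c = "\<lambda>_. 1" and e = "\<lambda>_. (\<lambda>b'\<in>Basis. if b' = b then 1 else 0)" and N = r])
  show "(\<lambda>b'\<in>Basis. if b' = b then 1 else 0) \<in> multi_indices" by (auto simp: multi_indices_def)
  have d: "total_degree (\<lambda>b'\<in>Basis. if b' = b then 1 else 0 :: nat) = 1"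
    using assms(2) by (simp add: total_degree_def)
  show "((\<lambda>_. \<bar>1\<bar> * r ^ total_degree (\<lambda>b'\<in>Basis. if b' = b then 1 else 0 :: nat)) has_sum r) {()}"
    using has_sum_finite[of "{()}" "\<lambda>_. r"] by (simp add: d)
  have "monomial (y - x) (\<lambda>b'\<in>Basis. if b' = b then 1 else 0) = (y - x) \<bullet> b" for y
  proof -
    have "monomial (y - x) (\<lambda>b'\<in>Basis. if b' = b then 1 else 0) = (\<Prod>b'\<in>Basis. if b' = b then (y - x) \<bullet> b' else 1)"
      unfolding monomial_def by (rule prod.cong) auto
    also have "\<dots> = (y - x) \<bullet> b" using assms(2) by simp
    finally show ?thesis .
  qed
  then show "((\<lambda>_. 1 * monomial (y - x) (\<lambda>b'\<in>Basis. if b' = b then 1 else 0)) has_sum (y - x) \<bullet> b) {()}" for y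
    using has_sum_finite[of "{()}" "\<lambda>_. (y - x) \<bullet> b"] by simp
qed simp

lemma expandable_family:
  fixes F :: "'k \<Rightarrow> 'a::euclidean_space \<Rightarrow> real"
  assumes r: "0 < r" and F: "\<And>a. a \<in> A \<Longrightarrow> expandable x r (F a) (M a)"
    and M: "(M has_sum S) A"
    and f: "\<And>y. y \<in> ball x r \<Longrightarrow> ((\<lambda>a. F a y) has_sum f y) A"
  shows "expandable x r f S"
proof -
  define P where "P = (\<lambda>a p. ((\<lambda>\<alpha>. \<bar>fst p \<alpha>\<bar> * r ^ total_degree \<alpha>) has_sum snd p) multi_indices \<and> snd p \<le> M a \<and>
      (\<forall>y\<in>ball x r. ((\<lambda>\<alpha>. fst p \<alpha> * monomial (y - x) \<alpha>) has_sum F a y) multi_indices))"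
  have "\<forall>a\<in>A. \<exists>p. P a p"
  proof
    fix a assume "a \<in> A"
    from F[OF this] have "\<exists>c N. P a (c, N)" unfolding expandable_def P_def fst_conv snd_conv .
    then show "\<exists>p. P a p" by blast
  qed
  from bchoice[OF this] obtain p where p: "\<forall>a\<in>A. P a (p a)" ..
  define c N where "c = (\<lambda>a. fst (p a))" and "N = (\<lambda>a. snd (p a))"
  have cN: "((\<lambda>\<alpha>. \<bar>c a \<alpha>\<bar> * r ^ total_degree \<alpha>) has_sum N a) multi_indices" "N a \<le> M a"
    "y \<in> ball x r \<Longrightarrow> ((\<lambda>\<alpha>. c a \<alpha> * monomial (y - x) \<alpha>) has_sum F a y) multi_indices" if "a \<in> A" for a y
    using bspec[OF p that] unfolding P_def c_def N_def by blast+
  have N0: "0 \<le> N a" if "a \<in> A" for a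
    by (rule has_sum_nonneg[OF cN(1)[OF that]]) (use r in simp)
  have Ns: "N summable_on A"
    by (rule summable_on_comparison_test[OF has_sum_imp_summable[OF M] cN(2) N0])
  let ?g = "\<lambda>(a, \<alpha>). \<bar>c a \<alpha>\<bar> * r ^ total_degree \<alpha>"
  have inner: "((\<lambda>\<alpha>. ?g (a, \<alpha>)) has_sum N a) multi_indices" if "a \<in> A" for a
    using cN(1)[OF that] by simp
  have gs: "?g summable_on A \<times> multi_indices"
    by (rule summable_on_SigmaI[OF inner Ns]) (use r in auto)
  have gN: "(?g has_sum infsum N A) (A \<times> multi_indices)"
    by (rule has_sum_SigmaI[OF inner has_sum_infsum[OF Ns] gs])
  show ?thesis
  proof (rule expandable_regroup[OF r, where J = "A \<times> multi_indices" and c = "\<lambda>(a, \<alpha>). c a \<alpha>" and e = snd and N = "infsum N A"])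
    show "((\<lambda>j. \<bar>case j of (a, \<alpha>) \<Rightarrow> c a \<alpha>\<bar> * r ^ total_degree (snd j)) has_sum infsum N A) (A \<times> multi_indices)"
      using gN by (simp add: split_def)
    show "infsum N A \<le> S" by (rule has_sum_mono[OF has_sum_infsum[OF Ns] M cN(2)])
    fix y assume y: "y \<in> ball x r"
    let ?h = "\<lambda>j. (case j of (a, \<alpha>) \<Rightarrow> c a \<alpha>) * monomial (y - x) (snd j)"
    have "(\<lambda>j. \<bar>?h j\<bar>) summable_on A \<times> multi_indices"
    proof (rule summable_on_comparison_test[OF gs])
      fix j
      show "\<bar>?h j\<bar> \<le> ?g j"
        unfolding abs_mult case_prod_beta by (intro mult_left_mono monomial_le y) simp
    qed simp
    then have "?h summable_on A \<times> multi_indices"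
      using summable_on_iff_abs_summable_on_real[of ?h] by simp
    moreover have "((\<lambda>\<alpha>. ?h (a, \<alpha>)) has_sum F a y) multi_indices" if "a \<in> A" for a
      using cN(3)[OF that y] by simp
    ultimately show "(?h has_sum f y) (A \<times> multi_indices)"
      using f[OF y] by (intro has_sum_SigmaI[where g = "\<lambda>a. F a y"])
  qed auto
qed

lemma expandable_sum:
  assumes "0 < r" "finite A" "\<And>a. a \<in> A \<Longrightarrow> expandable x r (F a) (M a)"
  shows "expandable x r (\<lambda>y. \<Sum>a\<in>A. F a y) (\<Sum>a\<in>A. M a)"
  by (rule expandable_family[OF assms(1,3)]) (use assms(2) in auto)

lemma expandable_mult:
  assumes r: "0 < r" and f: "expandable x r f M1" and g: "expandable x r g M2"
  shows "expandable x r (\<lambda>y. f y * g y) (M1 * M2)"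
proof -
  have prod: "((\<lambda>(a, b). u a * w b) has_sum U * V) (I \<times> J)"
    if u: "(u has_sum U) I" and w: "(w has_sum V) J" for u w :: "_ \<Rightarrow> real" and U V I J
  proof -
    have au: "(\<lambda>a. \<bar>u a\<bar>) summable_on I" and aw: "(\<lambda>b. \<bar>w b\<bar>) summable_on J"
      using has_sum_imp_summable[OF u] has_sum_imp_summable[OF w]
        summable_on_iff_abs_summable_on_real[of u] summable_on_iff_abs_summable_on_real[of w] by auto
    have "(\<lambda>(a, b). \<bar>u a\<bar> * \<bar>w b\<bar>) summable_on I \<times> J"
    proof (rule summable_on_SigmaI)
      show "((\<lambda>b. case (a, b) of (a, b) \<Rightarrow> \<bar>u a\<bar> * \<bar>w b\<bar>) has_sum \<bar>u a\<bar> * infsum (\<lambda>b. \<bar>w b\<bar>) J) J" for a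
        using has_sum_cmult_right[OF has_sum_infsum[OF aw]] by simp
      show "(\<lambda>a. \<bar>u a\<bar> * infsum (\<lambda>b. \<bar>w b\<bar>) J) summable_on I" using au by (rule summable_on_cmult_left)
    qed auto
    then have "(\<lambda>(a, b). u a * w b) summable_on I \<times> J"
      using summable_on_iff_abs_summable_on_real[of "\<lambda>(a, b). u a * w b"] by (simp add: split_def abs_mult)
    moreover have "((\<lambda>b. case (a, b) of (a, b) \<Rightarrow> u a * w b) has_sum u a * V) J" for a
      using has_sum_cmult_right[OF w] by simp
    ultimately show ?thesis
      using has_sum_cmult_left[OF u] by (intro has_sum_SigmaI[where g = "\<lambda>a. u a * V"])
  qed
  obtain c1 N1 where c1: "((\<lambda>\<alpha>. \<bar>c1 \<alpha>\<bar> * r ^ total_degree \<alpha>) has_sum N1) multi_indices" "N1 \<le> M1"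
    "\<And>y. y \<in> ball x r \<Longrightarrow> ((\<lambda>\<alpha>. c1 \<alpha> * monomial (y - x) \<alpha>) has_sum f y) multi_indices"
    using f unfolding expandable_def by blast
  obtain c2 N2 where c2: "((\<lambda>\<alpha>. \<bar>c2 \<alpha>\<bar> * r ^ total_degree \<alpha>) has_sum N2) multi_indices" "N2 \<le> M2"
    "\<And>y. y \<in> ball x r \<Longrightarrow> ((\<lambda>\<alpha>. c2 \<alpha> * monomial (y - x) \<alpha>) has_sum g y) multi_indices"
    using g unfolding expandable_def by blast
  have N0: "0 \<le> N1" "0 \<le> N2"
    using has_sum_nonneg[OF c1(1)] has_sum_nonneg[OF c2(1)] r by auto
  define e where "e = (\<lambda>(\<alpha>, \<beta>). \<lambda>b\<in>(Basis :: 'a set). \<alpha> b + \<beta> b :: nat)"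
  have de: "total_degree (e j) = total_degree (fst j) + total_degree (snd j)" for j
    by (simp add: e_def total_degree_def sum.distrib case_prod_beta)
  have me: "monomial y (e j) = monomial y (fst j) * monomial y (snd j)" for y j
    by (simp add: e_def monomial_def prod.distrib[symmetric] power_add case_prod_beta)
  show ?thesis
  proof (rule expandable_regroup[OF r, where J = "multi_indices \<times> multi_indices" and c = "\<lambda>(\<alpha>, \<beta>). c1 \<alpha> * c2 \<beta>" and e = e and N = "N1 * N2"])
    show "e j \<in> multi_indices" for j by (auto simp: e_def multi_indices_def case_prod_beta)
    show "((\<lambda>j. \<bar>case j of (\<alpha>, \<beta>) \<Rightarrow> c1 \<alpha> * c2 \<beta>\<bar> * r ^ total_degree (e j)) has_sum N1 * N2) (multi_indices \<times> multi_indices)"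
      using prod[OF c1(1) c2(1)] by (simp add: de split_def abs_mult power_add mult_ac)
    show "N1 * N2 \<le> M1 * M2" using c1(2) c2(2) N0 by (intro mult_mono) auto
    show "((\<lambda>j. (case j of (\<alpha>, \<beta>) \<Rightarrow> c1 \<alpha> * c2 \<beta>) * monomial (y - x) (e j)) has_sum f y * g y) (multi_indices \<times> multi_indices)"
      if "y \<in> ball x r" for y
      using prod[OF c1(3)[OF that] c2(3)[OF that]] by (simp add: me split_def mult_ac)
  qed
qed

lemma expandable_power:
  assumes "0 < r" "expandable x r f M"
  shows "expandable x r (\<lambda>y. f y ^ n) (M ^ n)"
proof (induction n)
  case 0
  show ?case using expandable_const[OF assms(1), of x 1] by simp
next
  case (Suc n)
  then show ?case using expandable_mult[OF assms(1,2) Suc] by simp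
qed

lemma total_degree_0:
  assumes "\<alpha> \<in> multi_indices" "total_degree \<alpha> = 0"
  shows "\<alpha> = (\<lambda>b\<in>Basis. 0)"
  using assms by (auto simp: multi_indices_def total_degree_def PiE_def extensional_def restrict_def)

text \<open>Without a constant term, shrinking the radius by \<open>t\<close> shrinks every term by at least \<open>t\<close>. This makes
the bound small enough for the binomial series.\<close>

lemma expandable_shrink:
  assumes f: "expandable x r f M" and t: "0 < t" "t \<le> 1" and r: "0 < r" and f0: "f x = 0"
  shows "expandable x (t * r) f (t * M)"
proof -
  obtain c N where c: "((\<lambda>\<alpha>. \<bar>c \<alpha>\<bar> * r ^ total_degree \<alpha>) has_sum N) multi_indices" "N \<le> M"
    "\<And>y. y \<in> ball x r \<Longrightarrow> ((\<lambda>\<alpha>. c \<alpha> * monomial (y - x) \<alpha>) has_sum f y) multi_indices"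
    using f unfolding expandable_def by blast
  let ?o = "(\<lambda>b\<in>Basis. 0) :: 'a \<Rightarrow> nat"
  have o: "?o \<in> multi_indices" by (auto simp: multi_indices_def)
  have "c \<alpha> * monomial (x - x) \<alpha> = 0" if "\<alpha> \<in> multi_indices - {?o}" for \<alpha>
  proof -
    have "total_degree \<alpha> \<noteq> 0" using that total_degree_0 by blast
    then obtain b where "b \<in> Basis" "\<alpha> b \<noteq> 0" by (auto simp: total_degree_def)
    then have "monomial (x - x) \<alpha> = 0" by (auto simp: monomial_def)
    then show ?thesis by simp
  qed
  then have "((\<lambda>\<alpha>. c \<alpha> * monomial (x - x) \<alpha>) has_sum f x) {?o} =
      ((\<lambda>\<alpha>. c \<alpha> * monomial (x - x) \<alpha>) has_sum f x) multi_indices"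
    using o by (intro has_sum_cong_neutral) auto
  then have "((\<lambda>\<alpha>. c \<alpha> * monomial (x - x) \<alpha>) has_sum f x) {?o}" using c(3)[of x] r by simp
  from has_sum_unique[OF this has_sum_finite] have "f x = c ?o * monomial (x - x) ?o" by simp
  then have c0: "c ?o = 0" using f0 by (simp add: monomial_def)
  have le: "\<bar>c \<alpha>\<bar> * (t * r) ^ total_degree \<alpha> \<le> t * (\<bar>c \<alpha>\<bar> * r ^ total_degree \<alpha>)" if "\<alpha> \<in> multi_indices" for \<alpha>
  proof (cases "total_degree \<alpha>")
    case 0
    then show ?thesis using total_degree_0[OF that] c0 by simp
  next
    case (Suc k)
    have "t ^ Suc k \<le> t" using t power_decreasing[of 1 "Suc k" t] by simp
    then have "t ^ Suc k * (\<bar>c \<alpha>\<bar> * r ^ Suc k) \<le> t * (\<bar>c \<alpha>\<bar> * r ^ Suc k)"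
      using r by (intro mult_right_mono) auto
    then show ?thesis by (simp only: Suc power_mult_distrib mult_ac)
  qed
  have tN: "((\<lambda>\<alpha>. t * (\<bar>c \<alpha>\<bar> * r ^ total_degree \<alpha>)) has_sum t * N) multi_indices"
    by (rule has_sum_cmult_right[OF c(1)])
  have s: "(\<lambda>\<alpha>. \<bar>c \<alpha>\<bar> * (t * r) ^ total_degree \<alpha>) summable_on multi_indices"
    by (rule summable_on_comparison_test[OF has_sum_imp_summable[OF tN] le]) (use t r in auto)
  have "infsum (\<lambda>\<alpha>. \<bar>c \<alpha>\<bar> * (t * r) ^ total_degree \<alpha>) multi_indices \<le> t * N"
    by (rule has_sum_mono[OF has_sum_infsum[OF s] tN le])
  also have "\<dots> \<le> t * M" using c(2) t by simp
  finally have "infsum (\<lambda>\<alpha>. \<bar>c \<alpha>\<bar> * (t * r) ^ total_degree \<alpha>) multi_indices \<le> t * M" .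
  moreover have "ball x (t * r) \<subseteq> ball x r" using t r by (intro subset_ball) (simp add: mult_left_le_one_le)
  ultimately show ?thesis using s c(3) unfolding expandable_def
    by (intro exI[of _ c] exI conjI ballI has_sum_infsum) auto
qed

lemma expandable_restrict:
  assumes "expandable x r f M" "0 < r'" "r' \<le> r"
  shows "expandable x r' f M"
proof -
  obtain c N where c: "((\<lambda>\<alpha>. \<bar>c \<alpha>\<bar> * r ^ total_degree \<alpha>) has_sum N) multi_indices" "N \<le> M"
    "\<And>y. y \<in> ball x r \<Longrightarrow> ((\<lambda>\<alpha>. c \<alpha> * monomial (y - x) \<alpha>) has_sum f y) multi_indices"
    using assms(1) unfolding expandable_def by blast
  have le: "\<bar>c \<alpha>\<bar> * r' ^ total_degree \<alpha> \<le> \<bar>c \<alpha>\<bar> * r ^ total_degree \<alpha>" for \<alpha>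
    using assms by (intro mult_left_mono power_mono) auto
  have s: "(\<lambda>\<alpha>. \<bar>c \<alpha>\<bar> * r' ^ total_degree \<alpha>) summable_on multi_indices"
    by (rule summable_on_comparison_test[OF has_sum_imp_summable[OF c(1)] le]) (use assms in auto)
  have "infsum (\<lambda>\<alpha>. \<bar>c \<alpha>\<bar> * r' ^ total_degree \<alpha>) multi_indices \<le> N"
    by (rule has_sum_mono[OF has_sum_infsum[OF s] c(1) le])
  then have "infsum (\<lambda>\<alpha>. \<bar>c \<alpha>\<bar> * r' ^ total_degree \<alpha>) multi_indices \<le> M" using c(2) by linarith
  then show ?thesis using s c(3) assms(3) unfolding expandable_def
    by (intro exI[of _ c] exI conjI ballI has_sum_infsum) auto
qed

definition analytic_germ :: "'a::euclidean_space \<Rightarrow> ('a \<Rightarrow> real) \<Rightarrow> bool" where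
  "analytic_germ x f \<longleftrightarrow> (\<exists>r>0. \<exists>M. expandable x r f M)"

lemma analytic_germ_const: "analytic_germ x (\<lambda>_. k)"
  unfolding analytic_germ_def using expandable_const[of 1] by (intro exI[of _ 1]) auto

lemma analytic_germ_common:
  assumes "analytic_germ x f" "analytic_germ x g"
  obtains r M1 M2 where "0 < r" "expandable x r f M1" "expandable x r g M2"
proof -
  obtain r1 M1 r2 M2 where *: "0 < r1" "expandable x r1 f M1" "0 < r2" "expandable x r2 g M2"
    using assms unfolding analytic_germ_def by blast
  have r: "0 < min r1 r2" using * by simp
  show thesis
    by (rule that[OF r expandable_restrict[OF *(2) r] expandable_restrict[OF *(4) r]]) simp_all
qed

lemma analytic_germI: "0 < r \<Longrightarrow> expandable x r f M \<Longrightarrow> analytic_germ x f"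
  unfolding analytic_germ_def by blast

lemma analytic_germ_mult:
  assumes "analytic_germ x f" "analytic_germ x g"
  shows "analytic_germ x (\<lambda>y. f y * g y)"
proof -
  obtain r M1 M2 where r: "0 < r" "expandable x r f M1" "expandable x r g M2"
    using assms by (rule analytic_germ_common)
  show ?thesis by (rule analytic_germI[OF r(1) expandable_mult[OF r]])
qed

lemma analytic_germ_add:
  assumes "analytic_germ x f" "analytic_germ x g"
  shows "analytic_germ x (\<lambda>y. f y + g y)"
proof -
  obtain r M1 M2 where r: "0 < r" "expandable x r f M1" "expandable x r g M2"
    using assms by (rule analytic_germ_common)
  have "expandable x r (\<lambda>y. \<Sum>b\<in>UNIV. (if b then f y else g y)) (\<Sum>b\<in>UNIV. if b then M1 else M2)"
    by (rule expandable_sum[OF r(1)]) (use r in auto)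
  then show ?thesis using r(1) by (intro analytic_germI) (simp_all add: UNIV_bool add.commute)
qed

lemma analytic_germ_sum:
  assumes "\<And>a. a \<in> A \<Longrightarrow> analytic_germ x (F a)"
  shows "analytic_germ x (\<lambda>y. \<Sum>a\<in>A. F a y)"
  using assms
proof (induction A rule: infinite_finite_induct)
  case (insert a A)
  then show ?case using analytic_germ_add[of x "F a" "\<lambda>y. \<Sum>a\<in>A. F a y"] by simp
qed (simp_all add: analytic_germ_const)

lemma abs_gchoose_le_1: "\<bar>(-1/2 :: real) gchoose n\<bar> \<le> 1"
proof (induction n)
  case (Suc n)
  have "(-1/2 :: real) gchoose Suc n = ((-1/2) gchoose n) * ((-1/2 - real n) / (1 + real n))"
    using gbinomial_mult_1[of "-1/2 :: real" n] by (simp add: field_simps)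
  moreover have "\<bar>(-1/2 - real n) / (1 + real n)\<bar> \<le> 1" by (simp add: abs_divide)
  ultimately show ?case using mult_mono[OF Suc, of "\<bar>(-1/2 - real n) / (1 + real n)\<bar>" 1] by (simp add: abs_mult)
qed simp

text \<open>The binomial series is dominated by the geometric one, as the coefficients have modulus at most 1.\<close>

lemma expandable_binomial:
  assumes r: "0 < r" and h: "expandable x r h M" and M: "0 \<le> M" "M < 1"
  shows "expandable x r (\<lambda>y. (1 + h y) powr (-1/2)) (1 / (1 - M))"
proof (rule expandable_family[OF r, where A = UNIV and F = "\<lambda>n y. ((-1/2) gchoose n) * h y ^ n" and M = "\<lambda>n. M ^ n"])
  fix n :: nat
  show "expandable x r (\<lambda>y. ((-1/2) gchoose n) * h y ^ n) (M ^ n)"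
  proof (rule expandable_mono)
    show "expandable x r (\<lambda>y. ((-1/2) gchoose n) * h y ^ n) (\<bar>(-1/2) gchoose n\<bar> * M ^ n)"
      by (rule expandable_mult[OF r expandable_const[OF r] expandable_power[OF r h]])
    show "\<bar>(-1/2 :: real) gchoose n\<bar> * M ^ n \<le> M ^ n"
      using mult_right_mono[OF abs_gchoose_le_1, of "M ^ n"] M(1) by simp
  qed
next
  have "norm M < 1" using M by simp
  then have geo: "summable (\<lambda>n. M ^ n)" "(\<lambda>n. M ^ n) sums (1 / (1 - M))"
    by (rule summable_geometric, rule geometric_sums)
  have "summable (\<lambda>n. norm (M ^ n))" using geo(1) M(1) by simp
  then show "((\<lambda>n. M ^ n) has_sum 1 / (1 - M)) UNIV"
    using geo(2) by (rule norm_summable_imp_has_sum)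
  fix y assume "y \<in> ball x r"
  then have hy: "\<bar>h y\<bar> \<le> M" by (rule expandable_bound[OF h])
  show "((\<lambda>n. ((-1/2) gchoose n) * h y ^ n) has_sum (1 + h y) powr (-1/2)) UNIV"
  proof (rule norm_summable_imp_has_sum)
    have "norm (norm (((-1/2) gchoose n) * h y ^ n)) \<le> M ^ n" for n
    proof -
      have "\<bar>(-1/2) gchoose n\<bar> * \<bar>h y\<bar> ^ n \<le> 1 * M ^ n"
        using hy by (intro mult_mono abs_gchoose_le_1 power_mono) auto
      then show ?thesis by (simp add: abs_mult power_abs)
    qed
    then show "summable (\<lambda>n. norm (((-1/2) gchoose n) * h y ^ n))"
      by (intro summable_comparison_test[OF _ geo(1)] exI[of _ 0] allI impI)
    have "\<bar>h y\<bar> < 1" using hy M(2) by linarith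
    then show "(\<lambda>n. ((-1/2) gchoose n) * h y ^ n) sums (1 + h y) powr (-1/2)"
      by (rule gen_binomial_real)
  qed
qed

text \<open>Write \<open>w y = w x * (1 + h y)\<close> with \<open>h x = 0\<close> and shrink the radius until the binomial series applies.\<close>

lemma analytic_germ_inverse_sqrt:
  assumes w: "analytic_germ x w" and pos: "0 < w x"
  shows "analytic_germ x (\<lambda>y. w y powr (-1/2))"
proof -
  define h where "h = (\<lambda>y. inverse (w x) * w y + (-1))"
  have h0: "h x = 0" using pos by (simp add: h_def)
  have "analytic_germ x h"
    unfolding h_def by (intro analytic_germ_add analytic_germ_mult analytic_germ_const w)
  then obtain r M where r: "0 < r" "expandable x r h M" unfolding analytic_germ_def by blast
  have M: "0 \<le> M" using expandable_bound[OF r(2), of x] r(1) h0 by simp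
  define t where "t = 1 / (2 * (M + 1))"
  have t: "0 < t" "t \<le> 1" "0 \<le> t * M" "t * M < 1" using M by (simp_all add: t_def field_simps)
  have h: "expandable x (t * r) h (t * M)" by (rule expandable_shrink[OF r(2) t(1,2) r(1) h0])
  have tr: "0 < t * r" using t r by simp
  have "expandable x (t * r) (\<lambda>y. w x powr (-1/2) * (1 + h y) powr (-1/2)) (\<bar>w x powr (-1/2)\<bar> * (1 / (1 - t * M)))"
    by (intro expandable_mult expandable_const expandable_binomial tr h t)
  moreover have "w x powr (-1/2) * (1 + h y) powr (-1/2) = w y powr (-1/2)" if "y \<in> ball x (t * r)" for y
  proof -
    have "\<bar>h y\<bar> < 1" using expandable_bound[OF h that] t(4) by linarith
    then have "0 \<le> 1 + h y" by linarith
    then have "w x powr (-1/2) * (1 + h y) powr (-1/2) = (w x * (1 + h y)) powr (-1/2)"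
      using pos by (simp add: powr_mult)
    also have "w x * (1 + h y) = w y" using pos by (simp add: h_def distrib_left)
    finally show ?thesis .
  qed
  ultimately have "expandable x (t * r) (\<lambda>y. w y powr (-1/2)) (\<bar>w x powr (-1/2)\<bar> * (1 / (1 - t * M)))"
    unfolding expandable_def by simp
  then show ?thesis using tr by (rule analytic_germI[rotated])
qed

lemma analytic_germ_inner:
  assumes "b \<in> Basis"
  shows "analytic_germ x (\<lambda>y. y \<bullet> b)"
proof -
  have "analytic_germ x (\<lambda>y. (y - x) \<bullet> b + x \<bullet> b)"
    by (intro analytic_germ_add analytic_germ_const analytic_germI[OF _ expandable_coordinate[of 1]] assms) auto
  then show ?thesis by (simp add: inner_diff_left)
qed

lemma real_analytic_onI:
  assumes "\<And>x. x \<in> U \<Longrightarrow> analytic_germ x f"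
  shows "real_analytic_on f U"
  using assms unfolding real_analytic_on_def analytic_germ_def expandable_def monomial_def multi_indices_def by blast

lemma analytic_germ_position:
  "analytic_germ x (\<lambda>y :: (real ^ 3 ^ 'n::finite) \<times> (real ^ 3 ^ 'n). fst y $ i $ k)"
proof -
  let ?b = "(axis i (axis k 1), 0) :: (real ^ 3 ^ 'n::finite) \<times> (real ^ 3 ^ 'n)"
  have "axis i (axis k 1) \<in> (Basis :: (real ^ 3 ^ 'n) set)" by (auto simp: Basis_vec_def)
  then have "?b \<in> Basis" by (simp add: Basis_prod_def)
  from analytic_germ_inner[OF this, of x] show ?thesis by (simp add: inner_prod_def inner_axis)
qed

lemma analytic_germ_velocity:
  "analytic_germ x (\<lambda>y :: (real ^ 3 ^ 'n::finite) \<times> (real ^ 3 ^ 'n). snd y $ i $ k)"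
proof -
  let ?b = "(0, axis i (axis k 1)) :: (real ^ 3 ^ 'n::finite) \<times> (real ^ 3 ^ 'n)"
  have "axis i (axis k 1) \<in> (Basis :: (real ^ 3 ^ 'n) set)" by (auto simp: Basis_vec_def)
  then have "?b \<in> Basis" by (simp add: Basis_prod_def)
  from analytic_germ_inner[OF this, of x] show ?thesis by (simp add: inner_prod_def inner_axis)
qed

lemma analytic_germ_sqT_diff:
  fixes f :: "'a::euclidean_space \<Rightarrow> real ^ 3 ^ 'n"
  assumes "\<And>i k. analytic_germ x (\<lambda>y. f y $ i $ k)"
  shows "analytic_germ x (\<lambda>y. sqT (f y $ i - f y $ j))"
proof -
  have d: "analytic_germ x (\<lambda>y. f y $ i $ k + (-1) * f y $ j $ k)" for k
    by (intro analytic_germ_add analytic_germ_mult analytic_germ_const assms)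
  have "analytic_germ x (\<lambda>y. \<Sum>k\<in>UNIV. (f y $ i $ k + (-1) * f y $ j $ k) * (f y $ i $ k + (-1) * f y $ j $ k))"
    by (intro analytic_germ_sum analytic_germ_mult d)
  then show ?thesis by (simp add: sqT_def power2_eq_square)
qed

context masses
begin

lemma s_fun_pos:
  assumes "q \<notin> collision_set"
  shows "0 < s_fun G m (q, v)"
proof -
  interpret noncollision_state G m q v by (rule noncollision_stateI[OF assms])
  have "0 < rad powr (-1/2)" using rad_pos by simp
  then show ?thesis by (simp add: s_fun_def rad_def[symmetric])
qed

theorem s_fun_real_analytic: "real_analytic_on (s_fun G m) ((- collision_set) \<times> UNIV)"
proof (rule real_analytic_onI)
  fix x :: "(real ^ 3 ^ 'n::{finite,linorder}) \<times> (real ^ 3 ^ 'n::{finite,linorder})"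
  assume "x \<in> (- collision_set) \<times> UNIV"
  then have nc: "fst x \<notin> collision_set" by auto
  interpret noncollision_state G m "fst x" "snd x" by (rule noncollision_stateI[OF nc])
  define p where "p = (\<lambda>i j (y :: (real ^ 3 ^ 'n::{finite,linorder}) \<times> (real ^ 3 ^ 'n::{finite,linorder})). sqT (fst y $ i - fst y $ j) powr (-1/2))"
  have q: "analytic_germ x (\<lambda>y. sqT (fst y $ i - fst y $ j))" and v: "analytic_germ x (\<lambda>y. sqT (snd y $ i - snd y $ j))" for i j
    by (intro analytic_germ_sqT_diff analytic_germ_position analytic_germ_velocity)+
  have p: "analytic_germ x (p i j)" if "i \<noteq> j" for i j
    unfolding p_def by (intro analytic_germ_inverse_sqrt q) (use r_pos[OF that] in \<open>simp add: sqT_real r_def\<close>)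
  have sqT_nonneg: "0 \<le> sqT u" for u :: "real ^ 3" by (simp add: sqT_real)
  \<comment> \<open>the identities hold also at collisions, where both sides are 0, so \<open>s\<close> is literally a polynomial in
    the \<open>p i j\<close> and the coordinates, up to the outer power\<close>
  have p_eq: "p i j y = 1 / sqrt (sqT (fst y $ i - fst y $ j))" for y i j
    using sqT_nonneg by (simp add: p_def powr_minus_divide powr_half_sqrt)
  have inv_sqrt: "a / sqrt (sqT (fst y $ i - fst y $ j)) = a * p i j y" for a y i j
    by (simp add: p_eq)
  have inv: "a / sqT (fst y $ i - fst y $ j) = a * (p i j y * p i j y)" for a y i j
    using sqT_nonneg by (simp add: p_eq)
  have K: "analytic_germ x (\<lambda>y. K_coeff G m (fst y) i)" for i
    unfolding K_coeff_def inv by (intro analytic_germ_sum analytic_germ_mult analytic_germ_const p) auto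
  have "analytic_germ x (\<lambda>y. s_radicand G m (fst y) (snd y) (\<lambda>i j. sqrt (sqT (fst y $ i - fst y $ j))))"
    unfolding s_radicand_def inv inv_sqrt case_prod_beta
    by (intro analytic_germ_add analytic_germ_sum analytic_germ_mult v K p) auto
  then have "analytic_germ x (\<lambda>y. s_radicand G m (fst y) (snd y) (\<lambda>i j. sqrt (sqT (fst y $ i - fst y $ j))) powr (-1/2))"
    by (rule analytic_germ_inverse_sqrt) (use rad_pos in \<open>simp add: rad_def\<close>)
  then show "analytic_germ x (s_fun G m)" by (simp add: s_fun_def split_def)
qed

end

section \<open>The uniform global time-renormalization\<close>

theorem theorem3:
  fixes G :: real and m :: "'n::{finite,linorder} \<Rightarrow> real"
  assumes "CARD('n) \<ge> 2" and "G > 0" and "\<And>i. m i > 0"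
  shows "(\<forall>q0 v0. q0 \<notin> collision_set \<longrightarrow>
            (\<exists>Q V. renormalized_solution G m (closed_strip 0.0444443) q0 v0 Q V \<and>
               (\<forall>Q' V'. renormalized_solution G m (closed_strip 0.0444443) q0 v0 Q' V' \<longrightarrow>
                  (\<forall>\<tau>\<in>closed_strip 0.0444443. Q' \<tau> = Q \<tau> \<and> V' \<tau> = V \<tau>)))) \<and>
         uniform_time_renormalization G m (s_fun G m) 0.0444443"
proof -
  interpret masses G m by unfold_locales (rule assms)+
  define \<beta> :: real where "\<beta> = 0.0444443"
  have \<beta>: "0 < \<beta>" "\<beta> < 9/200" by (simp_all add: \<beta>_def)
  have strip: "closed_strip \<beta> \<subseteq> open_strip" "0 \<in> closed_strip \<beta>"
    using closed_strip_subset[OF \<beta>(2)] \<beta>(1) by (simp_all add: closed_strip_def)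
  have "\<exists>Q V. renormalized_solution G m (closed_strip \<beta>) q0 v0 Q V \<and>
      (\<forall>Q' V'. renormalized_solution G m (closed_strip \<beta>) q0 v0 Q' V' \<longrightarrow>
         (\<forall>\<tau>\<in>closed_strip \<beta>. Q' \<tau> = Q \<tau> \<and> V' \<tau> = V \<tau>))" if q0: "q0 \<notin> collision_set" for q0 v0
  proof -
    obtain W where W: "solution_on G m open_strip W" "W 0 = real_state q0 v0"
      using strip_solution[OF q0] .
    show ?thesis
    proof (intro exI conjI allI impI ballI)
      show "renormalized_solution G m (closed_strip \<beta>) q0 v0 (\<lambda>\<tau>. positions (W \<tau>)) (\<lambda>\<tau>. velocities (W \<tau>))"
        by (rule strip_solution_renormalized[OF q0 W strip])
      fix Q' V' \<tau> assume R: "renormalized_solution G m (closed_strip \<beta>) q0 v0 Q' V'" "\<tau> \<in> closed_strip \<beta>"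
      from renormalized_solution_unique[OF q0 W \<beta> R]
      show "Q' \<tau> = positions (W \<tau>)" "V' \<tau> = velocities (W \<tau>)" by simp_all
    qed
  qed
  moreover have "uniform_time_renormalization G m (s_fun G m) \<beta>"
    unfolding uniform_time_renormalization_def
  proof (intro conjI allI impI ballI)
    show "0 < \<beta>" by (rule \<beta>(1))
    show "real_analytic_on (s_fun G m) ((- collision_set) \<times> UNIV)" by (rule s_fun_real_analytic)
    show "0 < s_fun G m z" if "z \<in> (- collision_set) \<times> UNIV" for z
      using s_fun_pos that by (cases z) auto
    fix q0 v0 :: "real ^ 3 ^ 'n::{finite,linorder}" and T q v
    assume *: "q0 \<notin> collision_set \<and> maximal_nbody_solution G m T q0 v0 q v"
    then have q0: "q0 \<notin> collision_set" and sol: "nbody_solution G m T q0 v0 q v"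
      by (simp_all add: maximal_nbody_solution_def)
    obtain W where W: "solution_on G m open_strip W" "W 0 = real_state q0 v0"
      using strip_solution[OF q0] .
    have eq: "W (of_real (new_time (s_fun G m) q v t)) = real_state (q t) (v t)" if "t \<in> T" for t
      by (rule solution_in_new_time[OF q0 sol W that])
    have "renormalized_solution G m (closed_strip \<beta>) q0 v0 (\<lambda>\<tau>. positions (W \<tau>)) (\<lambda>\<tau>. velocities (W \<tau>))"
      by (rule strip_solution_renormalized[OF q0 W strip])
    then have "vec_analytic_on (\<lambda>\<tau>. positions (W \<tau>)) (closed_strip \<beta>)" "vec_analytic_on (\<lambda>\<tau>. velocities (W \<tau>)) (closed_strip \<beta>)"
      by (simp_all add: renormalized_solution_def)
    moreover have "\<forall>t\<in>T. positions (W (of_real (new_time (s_fun G m) q v t))) = complexify (q t) \<and>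
        velocities (W (of_real (new_time (s_fun G m) q v t))) = complexify (v t)"
      by (simp add: eq vec_eq_iff real_state_def complexify_def)
    ultimately show "\<exists>Q V. vec_analytic_on Q (closed_strip \<beta>) \<and> vec_analytic_on V (closed_strip \<beta>) \<and>
        (\<forall>t\<in>T. Q (of_real (new_time (s_fun G m) q v t)) = complexify (q t) \<and>
               V (of_real (new_time (s_fun G m) q v t)) = complexify (v t))"
      by (intro exI[of _ "\<lambda>\<tau>. positions (W \<tau>)"] exI[of _ "\<lambda>\<tau>. velocities (W \<tau>)"] conjI)
  qed
  ultimately show ?thesis unfolding \<beta>_def by blast
qed

end
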